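(* Let $\Bbbk$ be a field of characteristic zero or odd characteristic and let $\mathbb{X}$ be a strictly pro-representable group $\Bbbk$-functor. Then $\mathbb{X}=\mathbb{X}_{ev}{\bf E}_{\mathbb{X}}$, i.e. $\mathbb{X}(R)=\mathbb{X}_{ev}(R)\,{\bf E}_{\mathbb{X}}(R)$ for every superalgebra $R\in\mathsf{SAlg}_{\Bbbk}$.
   Context: All superalgebras are associative, unital, supercommutative $\mathbb{Z}_2$-graded $\Bbbk$-algebras; $\mathsf{SAlg}_{\Bbbk}$ is their category, with parity-preserving homomorphisms. A $\Bbbk$-functor is a functor $\mathsf{SAlg}_{\Bbbk}\to\mathsf{Sets}$; a group $\Bbbk$-functor takes values in groups. $\mathbb{X}$ is strictly pro-representable if there is a complete local augmented Noetherian superalgebra $A$ (maximal superideal $\mathfrak{M}_A$, augmentation $\epsilon_A:A\to\Bbbk=A/\mathfrak{M}_A$, $\mathfrak{M}_A$-adic topology) such that $\mathbb{X}(R)$ is the set of continuous superalgebra morphisms $A\to R$, naturally in $R\in\mathsf{SAlg}_{\Bbbk}$, with $R$ discrete. If $\mathbb{X}$ is a group functor, then $A$ is a complete Hopf superalgebra with coproduct $\Delta(a)=\sum a_{(0)}\otimes a_{(1)}\in\widehat{A\otimes A}$ and counit $\epsilon_A$. $\mathbb{X}_{ev}$ is the group subfunctor represented by $A/AA_1$, i.e. $\mathbb{X}_{ev}(R)$ consists of those morphisms $A\to R$ that vanish on $A_1$. $\mathrm{hyp}(\mathbb{X})$ is the space of continuous linear maps $A\to\Bbbk$ ($\Bbbk$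 discrete), with the Hopf superalgebra structure dual to that of $A$: the product is $\phi\psi(a)=\sum(-1)^{|\psi||a_{(0)}|}\phi(a_{(0)})\psi(a_{(1)})$, the unit is $\epsilon_A$, and the coproduct is $\Delta^*(\phi)=\sum\phi_{(0)}\otimes\phi_{(1)}$ with $\phi(ab)=\sum(-1)^{|\phi_{(1)}||a|}\phi_{(0)}(a)\phi_{(1)}(b)$. For a superalgebra $R$ there is the pairing $(\mathrm{hyp}(\mathbb{X})\otimes R)\times(A\otimes R)\to R$, $\langle\phi\otimes r,a\otimes r'\rangle=(-1)^{|r||a|}\phi(a)rr'$. Via this pairing the group $\mathbb{X}(R)$ is identified with the group of group-like elements $\{u\in(\mathrm{hyp}(\mathbb{X})\otimes R)^{\times}\mid(\Delta^*\otimes\mathrm{id}_R)(u)=u\otimes_Ru\}$. $\mathrm{Lie}(\mathbb{X})=\{\phi\in\mathrm{hyp}(\mathbb{X})\mid\phi(\mathfrak{M}_A^2)=0,\ \phi(1)=0\}$ is the Lie superalgebra of primitive elements of $\mathrm{hyp}(\mathbb{X})$, with bracket $[\phi,\psi]=\phi\psi-(-1)^{|\phi||\psi|}\psi\phi$. Fix a basis $\gamma_1,\dots,\gamma_l$ of its odd component $\mathrm{Lie}(\mathbb{X})_1$. For $v\in\mathrm{Lie}(\mathbb{X})_1$ and $a\in R_1$ put $e(a,v)=\epsilon_A\otimes1+v\otimes a$, a group-like element, hence an element of $\mathbb{X}(R)$. The subfunctor ${\bf E}_{\mathbb{X}}\subseteq\mathbb{X}$ is $${\bf E}_{\mathbb{X}}(R)=\{e(a_1,\gamma_1)\cdots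 e(a_l,\gamma_l)\mid a_1,\dots,a_l\in R_1\}.$$ $\mathbb{X}_{ev}{\bf E}_{\mathbb{X}}$ denotes the subfunctor $R\mapsto\{xe\mid x\in\mathbb{X}_{ev}(R),\ e\in{\bf E}_{\mathbb{X}}(R)\}$. *)

theory Defs
  imports
    "HOL-Algebra.Module"
    "HOL-Algebra.Ideal_Product"
    "HOL-Algebra.Ring_Divisibility"
    "HOL-Analysis.Abstract_Topology"
    "HOL-Library.Infinite_Typeclass"
begin

section \<open>Superalgebras\<close>

record ('k, 'a) superalg = "('k, 'a) module" +
  even_part :: "'a set"
  odd_part :: "'a set"

text \<open>The locale \<^locale>\<open>algebra\<close> of HOL-Algebra is restricted to commutative algebras, so the
  compatibility of the two multiplications is restated here. The zero algebra is allowed.\<close>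

locale superalgebra = K: field K + A: ring A + module K A
  for K :: "'k ring" (structure) and A :: "('k, 'a) superalg" (structure) +
  assumes smult_mult_left:
      "\<lbrakk>k \<in> carrier K; x \<in> carrier A; y \<in> carrier A\<rbrakk>
        \<Longrightarrow> (k \<odot>\<^bsub>A\<^esub> x) \<otimes>\<^bsub>A\<^esub> y = k \<odot>\<^bsub>A\<^esub> (x \<otimes>\<^bsub>A\<^esub> y)"
    and smult_mult_right:
      "\<lbrakk>k \<in> carrier K; x \<in> carrier A; y \<in> carrier A\<rbrakk>
        \<Longrightarrow> x \<otimes>\<^bsub>A\<^esub> (k \<odot>\<^bsub>A\<^esub> y) = k \<odot>\<^bsub>A\<^esub> (x \<otimes>\<^bsub>A\<^esub> y)"
    and even_submodule: "submodule (even_part A) K A"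
    and odd_submodule: "submodule (odd_part A) K A"
    and direct_sum:
      "x \<in> carrier A \<Longrightarrow> \<exists>!p. p \<in> even_part A \<times> odd_part A \<and> x = fst p \<oplus>\<^bsub>A\<^esub> snd p"
    and one_even: "\<one>\<^bsub>A\<^esub> \<in> even_part A"
    and even_even: "\<lbrakk>x \<in> even_part A; y \<in> even_part A\<rbrakk> \<Longrightarrow> x \<otimes>\<^bsub>A\<^esub> y \<in> even_part A"
    and even_odd: "\<lbrakk>x \<in> even_part A; y \<in> odd_part A\<rbrakk> \<Longrightarrow> x \<otimes>\<^bsub>A\<^esub> y \<in> odd_part A"
    and odd_even: "\<lbrakk>x \<in> odd_part A; y \<in> even_part A\<rbrakk> \<Longrightarrow> x \<otimes>\<^bsub>A\<^esub> y \<in> odd_part A"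
    and odd_odd: "\<lbrakk>x \<in> odd_part A; y \<in> odd_part A\<rbrakk> \<Longrightarrow> x \<otimes>\<^bsub>A\<^esub> y \<in> even_part A"
    and even_central: "\<lbrakk>x \<in> even_part A; y \<in> carrier A\<rbrakk> \<Longrightarrow> x \<otimes>\<^bsub>A\<^esub> y = y \<otimes>\<^bsub>A\<^esub> x"
    and odd_anticomm: "\<lbrakk>x \<in> odd_part A; y \<in> odd_part A\<rbrakk> \<Longrightarrow> x \<otimes>\<^bsub>A\<^esub> y = \<ominus>\<^bsub>A\<^esub> (y \<otimes>\<^bsub>A\<^esub> x)"

definition even_comp :: "('k, 'a) superalg \<Rightarrow> 'a \<Rightarrow> 'a" where
  "even_comp A x = (THE y. y \<in> even_part A \<and> (\<exists>z\<in>odd_part A. x = y \<oplus>\<^bsub>A\<^esub> z))"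

definition odd_comp :: "('k, 'a) superalg \<Rightarrow> 'a \<Rightarrow> 'a" where
  "odd_comp A x = (THE z. z \<in> odd_part A \<and> (\<exists>y\<in>even_part A. x = y \<oplus>\<^bsub>A\<^esub> z))"

text \<open>Morphisms are extensional functions, so that equality of morphisms is equality on the
  carrier, the identity is \<^term>\<open>\<lambda>x\<in>carrier A. x\<close>, and composition is \<^const>\<open>compose\<close>.\<close>

definition salg_hom ::
    "'k ring \<Rightarrow> ('k, 'a) superalg \<Rightarrow> ('k, 'b) superalg \<Rightarrow> ('a \<Rightarrow> 'b) set" where
  "salg_hom K A B =
    {f \<in> carrier A \<rightarrow>\<^sub>E carrier B.
       f \<in> ring_hom A B \<and>
       (\<forall>k\<in>carrier K. \<forall>x\<in>carrier A. f (k \<odot>\<^bsub>A\<^esub> x) = k \<odot>\<^bsub>B\<^esub> f x) \<and>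
       f ` even_part A \<subseteq> even_part B \<and> f ` odd_part A \<subseteq> odd_part B}"

definition ground_superalg :: "'k ring \<Rightarrow> ('k, 'k) superalg" where
  "ground_superalg K =
    \<lparr>carrier = carrier K, monoid.mult = monoid.mult K, one = \<one>\<^bsub>K\<^esub>, ring.zero = \<zero>\<^bsub>K\<^esub>,
     ring.add = ring.add K,
     smult = monoid.mult K, even_part = carrier K, odd_part = {\<zero>\<^bsub>K\<^esub>}\<rparr>"

section \<open>Complete local augmented Noetherian superalgebras\<close>

definition superideal :: "'a set \<Rightarrow> ('k, 'a) superalg \<Rightarrow> bool" where
  "superideal I A \<longleftrightarrow> ideal I A \<and> (\<forall>x\<in>I. even_comp A x \<in> I \<and> odd_comp A x \<in> I)"

definition maximal_superideal :: "'a set \<Rightarrow> ('k, 'a) superalg \<Rightarrow> bool" where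
  "maximal_superideal I A \<longleftrightarrow> superideal I A \<and> I \<noteq> carrier A \<and>
     (\<forall>J. superideal J A \<and> I \<subseteq> J \<longrightarrow> J = I \<or> J = carrier A)"

definition local_superalg :: "('k, 'a) superalg \<Rightarrow> bool" where
  "local_superalg A \<longleftrightarrow> (\<exists>!I. maximal_superideal I A)"

definition max_superideal :: "('k, 'a) superalg \<Rightarrow> 'a set" (\<open>\<MM>\<close>) where
  "\<MM> A = (THE I. maximal_superideal I A)"

text \<open>The graded analogue of \<^locale>\<open>noetherian_ring\<close>; for supercommutative superalgebras left,
  right and two-sided superideals coincide.\<close>

definition noetherian_superalg :: "('k, 'a) superalg \<Rightarrow> bool" where
  "noetherian_superalg A \<longleftrightarrow>
     (\<forall>I. superideal I A \<longrightarrow> (\<exists>S\<subseteq>carrier A. finite S \<and> I = Idl\<^bsub>A\<^esub> S))"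

primrec ideal_power :: "('a, 'm) ring_scheme \<Rightarrow> 'a set \<Rightarrow> nat \<Rightarrow> 'a set" where
  "ideal_power A I 0 = carrier A"
| "ideal_power A I (Suc n) = ideal_prod A (ideal_power A I n) I"

definition adic_topology :: "('a, 'm) ring_scheme \<Rightarrow> 'a set \<Rightarrow> 'a topology" where
  "adic_topology A I = topology (\<lambda>U. U \<subseteq> carrier A \<and>
     (\<forall>x\<in>U. \<exists>n. \<forall>y\<in>ideal_power A I n. x \<oplus>\<^bsub>A\<^esub> y \<in> U))"

lemma ideal_power_ideal:
  assumes "ring A" "ideal I A"
  shows "ideal (ideal_power A I n) A"
proof -
  interpret ring A by (rule assms)
  show ?thesis
    using assms(2) by (induction n) (auto intro: oneideal ideal_prod_is_ideal)
qed

lemma ideal_power_antimono: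
  assumes "ring A" "ideal I A" "m \<le> n"
  shows "ideal_power A I n \<subseteq> ideal_power A I m"
proof -
  interpret ring A by (rule assms)
  show ?thesis
    using assms(3)
  proof (induction n rule: dec_induct)
    case (step n)
    then show ?case
      using ideal_prod_inter[OF ideal_power_ideal[OF assms(1,2)] assms(2)] by fastforce
  qed simp
qed

lemma openin_adic_topology:
  assumes "ring A" "ideal I A"
  shows "openin (adic_topology A I) U \<longleftrightarrow>
    U \<subseteq> carrier A \<and> (\<forall>x\<in>U. \<exists>n. \<forall>y\<in>ideal_power A I n. x \<oplus>\<^bsub>A\<^esub> y \<in> U)"
proof -
  let ?L = "\<lambda>U. U \<subseteq> carrier A \<and> (\<forall>x\<in>U. \<exists>n. \<forall>y\<in>ideal_power A I n. x \<oplus>\<^bsub>A\<^esub> y \<in> U)"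
  have "istopology ?L"
    unfolding istopology_def
  proof (intro conjI allI impI)
    fix S T assume S: "?L S" and T: "?L T"
    show "S \<inter> T \<subseteq> carrier A" using S by blast
    show "\<forall>x\<in>S \<inter> T. \<exists>n. \<forall>y\<in>ideal_power A I n. x \<oplus>\<^bsub>A\<^esub> y \<in> S \<inter> T"
    proof
      fix x assume x: "x \<in> S \<inter> T"
      obtain m where m: "\<forall>y\<in>ideal_power A I m. x \<oplus>\<^bsub>A\<^esub> y \<in> S" using S x by blast
      obtain n where n: "\<forall>y\<in>ideal_power A I n. x \<oplus>\<^bsub>A\<^esub> y \<in> T" using T x by blast
      have "ideal_power A I (max m n) \<subseteq> ideal_power A I m \<inter> ideal_power A I n"
        using ideal_power_antimono[OF assms] by (simp add: le_infI)
      then show "\<exists>n. \<forall>y\<in>ideal_power A I n. x \<oplus>\<^bsub>A\<^esub> y \<in> S \<inter> T"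
        using m n by (intro exI[of _ "max m n"]) blast
    qed
  next
    fix \<K> assume \<K>: "\<forall>S\<in>\<K>. ?L S"
    show "\<Union>\<K> \<subseteq> carrier A" using \<K> by blast
    show "\<forall>x\<in>\<Union>\<K>. \<exists>n. \<forall>y\<in>ideal_power A I n. x \<oplus>\<^bsub>A\<^esub> y \<in> \<Union>\<K>"
      using \<K> by (meson UnionE UnionI)
  qed
  then show ?thesis by (simp add: adic_topology_def)
qed

text \<open>The last axiom says that \<open>A \<rightarrow> lim A/\<MM>\<^sup>n\<close> is bijective.\<close>

locale complete_local_augmented_superalgebra = superalgebra K A
  for K :: "'k ring" (structure) and A :: "('k, 'a) superalg" (structure) +
  fixes \<epsilon> :: "'a \<Rightarrow> 'k"
  assumes noetherian: "noetherian_superalg A"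
    and local: "local_superalg A"
    and augmentation_hom: "\<epsilon> \<in> salg_hom K A (ground_superalg K)"
    and augmentation_kernel: "a_kernel A (ground_superalg K) \<epsilon> = \<MM> A"
    and complete:
      "\<lbrakk>\<And>n::nat. x n \<in> carrier A;
        \<And>n. x (Suc n) \<ominus>\<^bsub>A\<^esub> x n \<in> ideal_power A (\<MM> A) n\<rbrakk>
       \<Longrightarrow> \<exists>!y. y \<in> carrier A \<and> (\<forall>n. y \<ominus>\<^bsub>A\<^esub> x n \<in> ideal_power A (\<MM> A) n)"

abbreviation max_adic :: "('k, 'a) superalg \<Rightarrow> 'a topology" where
  "max_adic A \<equiv> adic_topology A (\<MM> A)"

section \<open>Group functors and strict pro-representability\<close>

text \<open>The category of superalgebras over \<open>K\<close> consists of the superalgebras whose carrier is a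
  subset of a fixed but arbitrary infinite type \<open>'u\<close> (the universe), which also contains the
  carrier of \<open>K\<close>. All finite-dimensional superalgebras have isomorphic copies in it. The
  pro-representing superalgebra is not required to live in the universe.\<close>

record ('u, 'x) k_group_functor =
  points :: "('u, 'u) superalg \<Rightarrow> 'x monoid"
  induced :: "('u, 'u) superalg \<Rightarrow> ('u, 'u) superalg \<Rightarrow> ('u \<Rightarrow> 'u) \<Rightarrow> 'x \<Rightarrow> 'x"

locale group_functor = K: field K
  for K :: "'u::infinite ring" (structure) +
  fixes X :: "('u, 'x) k_group_functor"
  assumes group_points: "superalgebra K R \<Longrightarrow> group (points X R)"
    and induced_hom:
      "\<lbrakk>superalgebra K R; superalgebra K S; f \<in> salg_hom K R S\<rbrakk>
        \<Longrightarrow> induced X R S f \<in> hom (points X R) (points X S)"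
    and induced_id:
      "\<lbrakk>superalgebra K R; x \<in> carrier (points X R)\<rbrakk>
        \<Longrightarrow> induced X R R (\<lambda>r\<in>carrier R. r) x = x"
    and induced_compose:
      "\<lbrakk>superalgebra K R; superalgebra K S; superalgebra K T;
        f \<in> salg_hom K R S; g \<in> salg_hom K S T; x \<in> carrier (points X R)\<rbrakk>
        \<Longrightarrow> induced X R T (compose (carrier R) g f) x = induced X S T g (induced X R S f x)"

definition continuous_salg_hom ::
    "'k ring \<Rightarrow> ('k, 'a) superalg \<Rightarrow> ('k, 'b) superalg \<Rightarrow> ('a \<Rightarrow> 'b) set" where
  "continuous_salg_hom K A R =
    {f \<in> salg_hom K A R. continuous_map (max_adic A) (discrete_topology (carrier R)) f}"

text \<open>\<open>\<theta> R\<close> is the identification of \<open>X(R)\<close> with the set of continuous morphisms \<open>A \<rightarrow> R\<close>. It is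
  an isomorphism of set-valued functors; the group structure of \<open>X(R)\<close> is the one carried by
  \<open>X\<close>, and by Yoneda it induces the Hopf structure of \<open>A\<close>.\<close>

locale strictly_pro_represented =
  complete_local_augmented_superalgebra K A \<epsilon>
  for K :: "'u::infinite ring" and X :: "('u, 'x) k_group_functor"
    and A :: "('u, 'a) superalg" and \<epsilon> :: "'a \<Rightarrow> 'u" +
  fixes \<theta> :: "('u, 'u) superalg \<Rightarrow> 'x \<Rightarrow> 'a \<Rightarrow> 'u"
  assumes theta_bij:
      "superalgebra K R \<Longrightarrow> bij_betw (\<theta> R) (carrier (points X R)) (continuous_salg_hom K A R)"
    and theta_natural:
      "\<lbrakk>superalgebra K R; superalgebra K S; f \<in> salg_hom K R S; x \<in> carrier (points X R)\<rbrakk>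
        \<Longrightarrow> \<theta> S (induced X R S f x) = compose (carrier A) f (\<theta> R x)"

definition X_ev ::
    "('u, 'x) k_group_functor \<Rightarrow> ('u, 'a) superalg \<Rightarrow>
     (('u, 'u) superalg \<Rightarrow> 'x \<Rightarrow> 'a \<Rightarrow> 'u) \<Rightarrow> ('u, 'u) superalg \<Rightarrow> 'x set" where
  "X_ev X A \<theta> R = {x \<in> carrier (points X R). \<forall>a\<in>odd_part A. \<theta> R x a = \<zero>\<^bsub>R\<^esub>}"

section \<open>The dual space and the Lie superalgebra\<close>

text \<open>The multiplication of \<^typ>\<open>('k, 'a \<Rightarrow> 'k) module\<close> is not used: only the vector space
  underlying \<open>hyp(X)\<close> is represented.\<close>

definition hyp :: "'k ring \<Rightarrow> ('k, 'a) superalg \<Rightarrow> ('k, 'a \<Rightarrow> 'k) module" where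
  "hyp K A =
    \<lparr>carrier = {\<phi> \<in> carrier A \<rightarrow>\<^sub>E carrier K.
       (\<forall>x\<in>carrier A. \<forall>y\<in>carrier A. \<phi> (x \<oplus>\<^bsub>A\<^esub> y) = \<phi> x \<oplus>\<^bsub>K\<^esub> \<phi> y) \<and>
       (\<forall>k\<in>carrier K. \<forall>x\<in>carrier A. \<phi> (k \<odot>\<^bsub>A\<^esub> x) = k \<otimes>\<^bsub>K\<^esub> \<phi> x) \<and>
       continuous_map (max_adic A) (discrete_topology (carrier K)) \<phi>},
     monoid.mult = undefined,
     one = undefined,
     ring.zero = (\<lambda>x\<in>carrier A. \<zero>\<^bsub>K\<^esub>),
     ring.add = (\<lambda>\<phi> \<psi>. \<lambda>x\<in>carrier A. \<phi> x \<oplus>\<^bsub>K\<^esub> \<psi> x),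
     smult = (\<lambda>k \<phi>. \<lambda>x\<in>carrier A. k \<otimes>\<^bsub>K\<^esub> \<phi> x)\<rparr>"

definition Lie :: "'k ring \<Rightarrow> ('k, 'a) superalg \<Rightarrow> ('a \<Rightarrow> 'k) set" where
  "Lie K A = {\<phi> \<in> carrier (hyp K A).
     (\<forall>x\<in>ideal_power A (\<MM> A) 2. \<phi> x = \<zero>\<^bsub>K\<^esub>) \<and> \<phi> \<one>\<^bsub>A\<^esub> = \<zero>\<^bsub>K\<^esub>}"

text \<open>With \<open>K\<close> purely even, an odd functional is one that vanishes on the even part.\<close>

definition Lie_odd :: "'k ring \<Rightarrow> ('k, 'a) superalg \<Rightarrow> ('a \<Rightarrow> 'k) set" where
  "Lie_odd K A = {\<phi> \<in> Lie K A. \<forall>x\<in>even_part A. \<phi> x = \<zero>\<^bsub>K\<^esub>}"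

definition is_basis ::
    "'k ring \<Rightarrow> ('k, 'v) module \<Rightarrow> 'v set \<Rightarrow> nat \<Rightarrow> (nat \<Rightarrow> 'v) \<Rightarrow> bool" where
  "is_basis K V W l b \<longleftrightarrow> b ` {1..l} \<subseteq> W \<and>
     (\<forall>w\<in>W. \<exists>!c. c \<in> {1..l} \<rightarrow>\<^sub>E carrier K \<and>
        w = (\<Oplus>\<^bsub>V\<^esub>i\<in>{1..l}. c i \<odot>\<^bsub>V\<^esub> b i))"

section \<open>The subfunctor \<open>E\<close>\<close>

text \<open>\<open>pairing A R \<phi> r x r'\<close> is \<open>\<langle>\<phi> \<otimes> r, x \<otimes> r'\<rangle>\<close>, the sign \<open>(-1)\<^bsup>|r||x|\<^esup>\<close> of the homogeneous case
  being extended bilinearly to arbitrary \<open>r\<close> and \<open>x\<close>.\<close>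

definition pairing ::
    "('k, 'a) superalg \<Rightarrow> ('k, 'b) superalg \<Rightarrow> ('a \<Rightarrow> 'k) \<Rightarrow> 'b \<Rightarrow> 'a \<Rightarrow> 'b \<Rightarrow> 'b" where
  "pairing A R \<phi> r x r' =
     \<phi> (even_comp A x) \<odot>\<^bsub>R\<^esub> (even_comp R r \<otimes>\<^bsub>R\<^esub> r') \<oplus>\<^bsub>R\<^esub>
     \<phi> (even_comp A x) \<odot>\<^bsub>R\<^esub> (odd_comp R r \<otimes>\<^bsub>R\<^esub> r') \<oplus>\<^bsub>R\<^esub>
     \<phi> (odd_comp A x) \<odot>\<^bsub>R\<^esub> (even_comp R r \<otimes>\<^bsub>R\<^esub> r') \<ominus>\<^bsub>R\<^esub>
     \<phi> (odd_comp A x) \<odot>\<^bsub>R\<^esub> (odd_comp R r \<otimes>\<^bsub>R\<^esub> r')"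

text \<open>The functional \<open>x \<mapsto> \<langle>\<epsilon> \<otimes> 1 + v \<otimes> a, x \<otimes> 1\<rangle>\<close> on \<open>A\<close> given by the group-like element
  \<open>e(a, v)\<close>; on an odd \<open>x\<close> its value is \<open>- v(x) a\<close>.\<close>

definition e_hom ::
    "('k, 'a) superalg \<Rightarrow> ('a \<Rightarrow> 'k) \<Rightarrow> ('k, 'b) superalg \<Rightarrow> 'b \<Rightarrow> ('a \<Rightarrow> 'k) \<Rightarrow> 'a \<Rightarrow> 'b" where
  "e_hom A \<epsilon> R a v =
    (\<lambda>x\<in>carrier A. pairing A R \<epsilon> \<one>\<^bsub>R\<^esub> x \<one>\<^bsub>R\<^esub> \<oplus>\<^bsub>R\<^esub> pairing A R v a x \<one>\<^bsub>R\<^esub>)"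

definition e_point ::
    "('u, 'x) k_group_functor \<Rightarrow> ('u, 'a) superalg \<Rightarrow> ('a \<Rightarrow> 'u) \<Rightarrow>
     (('u, 'u) superalg \<Rightarrow> 'x \<Rightarrow> 'a \<Rightarrow> 'u) \<Rightarrow> ('u, 'u) superalg \<Rightarrow> 'u \<Rightarrow> ('a \<Rightarrow> 'u) \<Rightarrow> 'x" where
  "e_point X A \<epsilon> \<theta> R a v = inv_into (carrier (points X R)) (\<theta> R) (e_hom A \<epsilon> R a v)"

definition E_sub ::
    "('u, 'x) k_group_functor \<Rightarrow> ('u, 'a) superalg \<Rightarrow> ('a \<Rightarrow> 'u) \<Rightarrow>
     (('u, 'u) superalg \<Rightarrow> 'x \<Rightarrow> 'a \<Rightarrow> 'u) \<Rightarrow> nat \<Rightarrow> (nat \<Rightarrow> 'a \<Rightarrow> 'u) \<Rightarrow>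
     ('u, 'u) superalg \<Rightarrow> 'x set" where
  "E_sub X A \<epsilon> \<theta> l \<gamma> R =
    {foldr (monoid.mult (points X R)) (map (\<lambda>i. e_point X A \<epsilon> \<theta> R (a i) (\<gamma> i)) [1..<Suc l])
       \<one>\<^bsub>points X R\<^esub> | a. \<forall>i\<in>{1..l}. a i \<in> odd_part R}"

text \<open>The additive order of the unit, which by definition of \<^const>\<open>group.ord\<close> is 0 when no positive
  multiple of the unit vanishes.\<close>

definition ring_characteristic :: "'k ring \<Rightarrow> nat" where
  "ring_characteristic K = group.ord (add_monoid K) \<one>\<^bsub>K\<^esub>"

end

theory Submission
  imports Defs
begin

text \<open>Write \<open>H(R)\<close> for the set of continuous morphisms \<open>A \<rightarrow> R\<close>, which carries the group structure of
  \<open>X(R)\<close>. The multiplication is only known through functoriality, so every computation of a product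
  has to come from morphisms of superalgebras. The one product that is needed is the following. Let \<open>R\<close> have
  an augmentation \<open>\<eta>\<close>, and let \<open>J \<subseteq> ker \<eta>\<close> be a superideal annihilated by \<open>ker \<eta>\<close>. If \<open>d : A \<rightarrow> J\<close> is a
  linear parity-preserving map vanishing on \<open>1\<close> and on \<open>\<MM>\<^sup>2\<close>, then \<open>\<epsilon> + d\<close> is a point of \<open>X(R)\<close>, and
  \<open>g \<cdot> (\<epsilon> + d) = g + d = (\<epsilon> + d) \<cdot> g\<close> for every \<open>g\<close>. To see this, multiply the points \<open>(g, \<epsilon>)\<close> and
  \<open>(\<epsilon>, \<epsilon> + d)\<close> in the fibre product of \<open>R\<close> and \<open>K + J\<close> over \<open>K\<close>, where the two projections show that
  the product is \<open>(g, \<epsilon> + d)\<close>, and apply the morphism \<open>(r, k + j) \<mapsto> r + j\<close>. This is lemma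
  \<open>perturb_conv\<close>. In particular these points are central, and \<open>e(a + j, v) = e(a, v) + d\<close> with \<open>d = - v j\<close>
  for an odd \<open>j\<close> in \<open>J\<close>.

  Let now \<open>g : A \<rightarrow> R\<close> be a point. It kills some \<open>\<MM>\<^sup>n\<close>, and after replacing \<open>R\<close> by the image of \<open>(g, \<epsilon>)\<close>
  in \<open>R \<times> K\<close> it is surjective and \<open>R\<close> is augmented with nilpotent augmentation ideal. Induct on \<open>n\<close>
  (lemma \<open>factorization_surjective\<close>). Let \<open>J\<close> be the annihilator of the augmentation ideal inside it;
  it contains \<open>g(\<MM>\<^bsup>n-1\<^esup>)\<close>, so the image of \<open>g\<close> in \<open>X(R/J)\<close> has a factorization \<open>y E\<close>. The even point \<open>y\<close>
  need not lift to \<open>X\<^sub>e\<^sub>v(R)\<close>, but the parameters of \<open>E\<close> lift, hence so does \<open>E\<close>, and the point \<open>x' = g E\<^bsup>-1\<^esup>\<close> then maps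
  \<open>A\<^sub>1\<close> into \<open>J\<close>. The odd component \<open>d\<close> of \<open>x'\<close> is a tangent map as above, whence \<open>x' = x (\<epsilon> + d)\<close> with
  \<open>x = x' - d\<close> killing \<open>A\<^sub>1\<close> (lemma \<open>even_times_unipotent\<close>). Every odd functional on \<open>A\<close> vanishing on
  \<open>\<MM>\<^sup>2\<close> is a combination of the \<open>\<gamma>\<^sub>i\<close>, so \<open>d = - \<Sum> \<gamma>\<^sub>i j\<^sub>i\<close> with odd \<open>j\<^sub>i\<close> in \<open>J\<close> (lemma
  \<open>odd_tangent_expansion\<close>), and by centrality \<open>(\<epsilon> + d) E\<close> is \<open>E\<close> with the parameters \<open>a\<^sub>i\<close> replaced by
  \<open>a\<^sub>i + j\<^sub>i\<close> (lemma \<open>E_prod_perturb\<close>).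

  The characteristic enters only through \<open>a\<^sup>2 = 0\<close> for odd \<open>a\<close>, which makes \<open>e(a, v)\<close> multiplicative.
  Superalgebras formed on the way (quotients, subalgebras of products) have to be realised again with
  carrier in the universe; cosets are replaced by representatives, and pairs are coded by a bijection
  between the infinite universe and its square.\<close>

section \<open>Homogeneous components\<close>

context superalgebra
begin

lemma even_in_carrier: "x \<in> even_part A \<Longrightarrow> x \<in> carrier A"
  using submoduleE(1)[OF even_submodule] by blast

lemma odd_in_carrier: "x \<in> odd_part A \<Longrightarrow> x \<in> carrier A"
  using submoduleE(1)[OF odd_submodule] by blast

lemma even_closed:
  "\<zero>\<^bsub>A\<^esub> \<in> even_part A"
  "\<lbrakk>x \<in> even_part A; y \<in> even_part A\<rbrakk> \<Longrightarrow> x \<oplus>\<^bsub>A\<^esub> y \<in> even_part A"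
  "x \<in> even_part A \<Longrightarrow> \<ominus>\<^bsub>A\<^esub> x \<in> even_part A"
  "\<lbrakk>k \<in> carrier K; x \<in> even_part A\<rbrakk> \<Longrightarrow> k \<odot>\<^bsub>A\<^esub> x \<in> even_part A"
proof -
  interpret subgroup "even_part A" "add_monoid A"
    using even_submodule by (simp add: submodule_def)
  show "\<zero>\<^bsub>A\<^esub> \<in> even_part A" using one_closed by simp
qed (use submoduleE[OF even_submodule] in auto)

lemma odd_closed:
  "\<zero>\<^bsub>A\<^esub> \<in> odd_part A"
  "\<lbrakk>x \<in> odd_part A; y \<in> odd_part A\<rbrakk> \<Longrightarrow> x \<oplus>\<^bsub>A\<^esub> y \<in> odd_part A"
  "x \<in> odd_part A \<Longrightarrow> \<ominus>\<^bsub>A\<^esub> x \<in> odd_part A"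
  "\<lbrakk>k \<in> carrier K; x \<in> odd_part A\<rbrakk> \<Longrightarrow> k \<odot>\<^bsub>A\<^esub> x \<in> odd_part A"
proof -
  interpret subgroup "odd_part A" "add_monoid A"
    using odd_submodule by (simp add: submodule_def)
  show "\<zero>\<^bsub>A\<^esub> \<in> odd_part A" using one_closed by simp
qed (use submoduleE[OF odd_submodule] in auto)

lemma decomposition_unique:
  assumes "y \<in> even_part A" "z \<in> odd_part A" "y' \<in> even_part A" "z' \<in> odd_part A"
    and "y \<oplus>\<^bsub>A\<^esub> z = y' \<oplus>\<^bsub>A\<^esub> z'"
  shows "y = y' \<and> z = z'"
proof -
  have "y \<oplus>\<^bsub>A\<^esub> z \<in> carrier A"
    using assms even_in_carrier odd_in_carrier by simp
  from direct_sum[OF this] have "(y, z) = (y', z')"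
    by (rule ex1E) (metis assms fst_conv snd_conv mem_Sigma_iff)
  then show ?thesis by simp
qed

lemma comp_sum_eq:
  assumes "y \<in> even_part A" "z \<in> odd_part A"
  shows "even_comp A (y \<oplus>\<^bsub>A\<^esub> z) = y" "odd_comp A (y \<oplus>\<^bsub>A\<^esub> z) = z"
  unfolding even_comp_def odd_comp_def
  by (rule the_equality; use assms decomposition_unique in blast)+

lemma decomposition:
  assumes "x \<in> carrier A"
  shows "even_comp A x \<in> even_part A" "odd_comp A x \<in> odd_part A"
    "even_comp A x \<oplus>\<^bsub>A\<^esub> odd_comp A x = x"
proof -
  obtain p where "p \<in> even_part A \<times> odd_part A" "x = fst p \<oplus>\<^bsub>A\<^esub> snd p"
    using direct_sum[OF assms] by blast
  then obtain y z where yz: "y \<in> even_part A" "z \<in> odd_part A" "x = y \<oplus>\<^bsub>A\<^esub> z"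
    by auto
  show "even_comp A x \<in> even_part A" "odd_comp A x \<in> odd_part A"
    "even_comp A x \<oplus>\<^bsub>A\<^esub> odd_comp A x = x"
    using yz comp_sum_eq[OF yz(1,2)] by auto
qed

lemma comp_closed [simp]:
  assumes "x \<in> carrier A"
  shows "even_comp A x \<in> carrier A" "odd_comp A x \<in> carrier A"
  using decomposition[OF assms] even_in_carrier odd_in_carrier by auto

lemma comp_even:
  assumes "x \<in> even_part A"
  shows "even_comp A x = x" "odd_comp A x = \<zero>\<^bsub>A\<^esub>"
  using comp_sum_eq[OF assms odd_closed(1)] even_in_carrier[OF assms] by auto

lemma comp_odd:
  assumes "x \<in> odd_part A"
  shows "even_comp A x = \<zero>\<^bsub>A\<^esub>" "odd_comp A x = x"
  using comp_sum_eq[OF even_closed(1) assms] odd_in_carrier[OF assms] by auto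

lemma comp_add:
  assumes "x \<in> carrier A" "y \<in> carrier A"
  shows "even_comp A (x \<oplus>\<^bsub>A\<^esub> y) = even_comp A x \<oplus>\<^bsub>A\<^esub> even_comp A y"
    "odd_comp A (x \<oplus>\<^bsub>A\<^esub> y) = odd_comp A x \<oplus>\<^bsub>A\<^esub> odd_comp A y"
proof -
  note x = decomposition[OF assms(1)] and y = decomposition[OF assms(2)]
  have eq: "x \<oplus>\<^bsub>A\<^esub> y = (even_comp A x \<oplus>\<^bsub>A\<^esub> even_comp A y) \<oplus>\<^bsub>A\<^esub> (odd_comp A x \<oplus>\<^bsub>A\<^esub> odd_comp A y)"
  proof -
    have "x \<oplus>\<^bsub>A\<^esub> y =
      (even_comp A x \<oplus>\<^bsub>A\<^esub> odd_comp A x) \<oplus>\<^bsub>A\<^esub> (even_comp A y \<oplus>\<^bsub>A\<^esub> odd_comp A y)"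
      using x(3) y(3) by simp
    then show ?thesis using assms by (simp only: A.add.m_ac comp_closed A.add.m_closed)
  qed
  show "even_comp A (x \<oplus>\<^bsub>A\<^esub> y) = even_comp A x \<oplus>\<^bsub>A\<^esub> even_comp A y"
    "odd_comp A (x \<oplus>\<^bsub>A\<^esub> y) = odd_comp A x \<oplus>\<^bsub>A\<^esub> odd_comp A y"
    unfolding eq using comp_sum_eq[OF even_closed(2) odd_closed(2)] x y by auto
qed

lemma comp_smult:
  assumes "k \<in> carrier K" "x \<in> carrier A"
  shows "even_comp A (k \<odot>\<^bsub>A\<^esub> x) = k \<odot>\<^bsub>A\<^esub> even_comp A x"
    "odd_comp A (k \<odot>\<^bsub>A\<^esub> x) = k \<odot>\<^bsub>A\<^esub> odd_comp A x"
proof -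
  note x = decomposition[OF assms(2)]
  have eq: "k \<odot>\<^bsub>A\<^esub> x = k \<odot>\<^bsub>A\<^esub> even_comp A x \<oplus>\<^bsub>A\<^esub> k \<odot>\<^bsub>A\<^esub> odd_comp A x"
    using smult_r_distr[OF assms(1), of "even_comp A x" "odd_comp A x"] x assms by simp
  show "even_comp A (k \<odot>\<^bsub>A\<^esub> x) = k \<odot>\<^bsub>A\<^esub> even_comp A x"
    "odd_comp A (k \<odot>\<^bsub>A\<^esub> x) = k \<odot>\<^bsub>A\<^esub> odd_comp A x"
    unfolding eq using comp_sum_eq[OF even_closed(4) odd_closed(4)] x assms by auto
qed

lemma odd_comp_mult:
  assumes "x \<in> carrier A" "y \<in> carrier A"
  shows "odd_comp A (x \<otimes>\<^bsub>A\<^esub> y) =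
    even_comp A x \<otimes>\<^bsub>A\<^esub> odd_comp A y \<oplus>\<^bsub>A\<^esub> odd_comp A x \<otimes>\<^bsub>A\<^esub> even_comp A y"
proof -
  note x = decomposition[OF assms(1)] and y = decomposition[OF assms(2)]
  have "x \<otimes>\<^bsub>A\<^esub> y =
    (even_comp A x \<oplus>\<^bsub>A\<^esub> odd_comp A x) \<otimes>\<^bsub>A\<^esub> (even_comp A y \<oplus>\<^bsub>A\<^esub> odd_comp A y)"
    using x y by simp
  also have "\<dots> =
    (even_comp A x \<otimes>\<^bsub>A\<^esub> even_comp A y \<oplus>\<^bsub>A\<^esub> odd_comp A x \<otimes>\<^bsub>A\<^esub> odd_comp A y) \<oplus>\<^bsub>A\<^esub>
    (even_comp A x \<otimes>\<^bsub>A\<^esub> odd_comp A y \<oplus>\<^bsub>A\<^esub> odd_comp A x \<otimes>\<^bsub>A\<^esub> even_comp A y)"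
    using assms by (simp add: A.l_distr A.r_distr A.add.m_ac)
  finally have eq: "x \<otimes>\<^bsub>A\<^esub> y = \<dots>" .
  show ?thesis
    unfolding eq using x y
    by (intro comp_sum_eq even_closed odd_closed even_even odd_odd even_odd odd_even)
qed

lemma minus_smult: "x \<in> carrier A \<Longrightarrow> (\<ominus>\<^bsub>K\<^esub> \<one>\<^bsub>K\<^esub>) \<odot>\<^bsub>A\<^esub> x = \<ominus>\<^bsub>A\<^esub> x"
  by (simp add: smult_l_minus)

text \<open>Anticommutativity gives \<open>2 x\<^sup>2 = 0\<close>, and 2 is invertible.\<close>

lemma odd_square_zero:
  assumes "\<one>\<^bsub>K\<^esub> \<oplus>\<^bsub>K\<^esub> \<one>\<^bsub>K\<^esub> \<noteq> \<zero>\<^bsub>K\<^esub>" "x \<in> odd_part A"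
  shows "x \<otimes>\<^bsub>A\<^esub> x = \<zero>\<^bsub>A\<^esub>"
proof -
  let ?two = "\<one>\<^bsub>K\<^esub> \<oplus>\<^bsub>K\<^esub> \<one>\<^bsub>K\<^esub>"
  have x: "x \<in> carrier A" using assms(2) by (rule odd_in_carrier)
  have two: "?two \<in> Units K" using assms(1) by (simp add: K.field_Units)
  have "?two \<odot>\<^bsub>A\<^esub> (x \<otimes>\<^bsub>A\<^esub> x) = x \<otimes>\<^bsub>A\<^esub> x \<oplus>\<^bsub>A\<^esub> x \<otimes>\<^bsub>A\<^esub> x"
    using x by (simp add: smult_l_distr)
  also have "\<dots> = \<zero>\<^bsub>A\<^esub>"
    using odd_anticomm[OF assms(2,2)] x by (metis A.r_neg A.m_closed)
  finally have "inv\<^bsub>K\<^esub> ?two \<odot>\<^bsub>A\<^esub> (?two \<odot>\<^bsub>A\<^esub> (x \<otimes>\<^bsub>A\<^esub> x)) = \<zero>\<^bsub>A\<^esub>"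
    using two by simp
  then show ?thesis
    using two x by (simp flip: smult_assoc1)
qed

text \<open>Both factors lie in the image of the dual numbers \<open>K[t]/(t\<^sup>2)\<close> under \<open>t \<mapsto> a\<close>.\<close>

lemma dual_number_mult:
  assumes "p \<in> carrier K" "q \<in> carrier K" "s \<in> carrier K" "t \<in> carrier K"
    and a: "a \<in> carrier A" "a \<otimes>\<^bsub>A\<^esub> a = \<zero>\<^bsub>A\<^esub>"
  shows "(p \<odot>\<^bsub>A\<^esub> \<one>\<^bsub>A\<^esub> \<oplus>\<^bsub>A\<^esub> s \<odot>\<^bsub>A\<^esub> a) \<otimes>\<^bsub>A\<^esub> (q \<odot>\<^bsub>A\<^esub> \<one>\<^bsub>A\<^esub> \<oplus>\<^bsub>A\<^esub> t \<odot>\<^bsub>A\<^esub> a) =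
    (p \<otimes>\<^bsub>K\<^esub> q) \<odot>\<^bsub>A\<^esub> \<one>\<^bsub>A\<^esub> \<oplus>\<^bsub>A\<^esub> (p \<otimes>\<^bsub>K\<^esub> t \<oplus>\<^bsub>K\<^esub> q \<otimes>\<^bsub>K\<^esub> s) \<odot>\<^bsub>A\<^esub> a"
proof -
  have 1: "(p \<odot>\<^bsub>A\<^esub> \<one>\<^bsub>A\<^esub>) \<otimes>\<^bsub>A\<^esub> (q \<odot>\<^bsub>A\<^esub> \<one>\<^bsub>A\<^esub>) = (p \<otimes>\<^bsub>K\<^esub> q) \<odot>\<^bsub>A\<^esub> \<one>\<^bsub>A\<^esub>"
    "(p \<odot>\<^bsub>A\<^esub> \<one>\<^bsub>A\<^esub>) \<otimes>\<^bsub>A\<^esub> (t \<odot>\<^bsub>A\<^esub> a) = (p \<otimes>\<^bsub>K\<^esub> t) \<odot>\<^bsub>A\<^esub> a"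
    using assms by (simp_all add: smult_mult_left smult_assoc1)
  have 2: "(s \<odot>\<^bsub>A\<^esub> a) \<otimes>\<^bsub>A\<^esub> (t \<odot>\<^bsub>A\<^esub> a) = \<zero>\<^bsub>A\<^esub>"
    "(s \<odot>\<^bsub>A\<^esub> a) \<otimes>\<^bsub>A\<^esub> (q \<odot>\<^bsub>A\<^esub> \<one>\<^bsub>A\<^esub>) = (q \<otimes>\<^bsub>K\<^esub> s) \<odot>\<^bsub>A\<^esub> a"
    using assms by (simp_all add: smult_mult_left smult_mult_right smult_assoc1)
  show ?thesis
    using assms by (simp add: A.l_distr A.r_distr 1 2 smult_l_distr A.add.m_ac)
qed

end

text \<open>The axioms elementwise, with negatives expressed as multiplication by the scalar \<open>-1\<close>: this form
  transports along images and componentwise constructions without mentioning \<^const>\<open>a_inv\<close> of the new record.\<close>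

lemma superalgebraI:
  fixes K :: "'k ring" and T :: "('k, 'a) superalg"
  assumes "field K"
    and add_closed: "\<And>x y. \<lbrakk>x \<in> carrier T; y \<in> carrier T\<rbrakk> \<Longrightarrow> x \<oplus>\<^bsub>T\<^esub> y \<in> carrier T"
    and zero_closed: "\<zero>\<^bsub>T\<^esub> \<in> carrier T"
    and add_assoc: "\<And>x y z. \<lbrakk>x \<in> carrier T; y \<in> carrier T; z \<in> carrier T\<rbrakk> \<Longrightarrow>
      (x \<oplus>\<^bsub>T\<^esub> y) \<oplus>\<^bsub>T\<^esub> z = x \<oplus>\<^bsub>T\<^esub> (y \<oplus>\<^bsub>T\<^esub> z)"
    and add_comm: "\<And>x y. \<lbrakk>x \<in> carrier T; y \<in> carrier T\<rbrakk> \<Longrightarrow> x \<oplus>\<^bsub>T\<^esub> y = y \<oplus>\<^bsub>T\<^esub> x"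
    and zero_add: "\<And>x. x \<in> carrier T \<Longrightarrow> \<zero>\<^bsub>T\<^esub> \<oplus>\<^bsub>T\<^esub> x = x"
    and neg: "\<And>x. x \<in> carrier T \<Longrightarrow> ((\<ominus>\<^bsub>K\<^esub> \<one>\<^bsub>K\<^esub>) \<odot>\<^bsub>T\<^esub> x) \<oplus>\<^bsub>T\<^esub> x = \<zero>\<^bsub>T\<^esub>"
    and mult_closed: "\<And>x y. \<lbrakk>x \<in> carrier T; y \<in> carrier T\<rbrakk> \<Longrightarrow> x \<otimes>\<^bsub>T\<^esub> y \<in> carrier T"
    and one_closed: "\<one>\<^bsub>T\<^esub> \<in> carrier T"
    and mult_assoc: "\<And>x y z. \<lbrakk>x \<in> carrier T; y \<in> carrier T; z \<in> carrier T\<rbrakk> \<Longrightarrow>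
      (x \<otimes>\<^bsub>T\<^esub> y) \<otimes>\<^bsub>T\<^esub> z = x \<otimes>\<^bsub>T\<^esub> (y \<otimes>\<^bsub>T\<^esub> z)"
    and one_mult: "\<And>x. x \<in> carrier T \<Longrightarrow> \<one>\<^bsub>T\<^esub> \<otimes>\<^bsub>T\<^esub> x = x" "\<And>x. x \<in> carrier T \<Longrightarrow> x \<otimes>\<^bsub>T\<^esub> \<one>\<^bsub>T\<^esub> = x"
    and distr: "\<And>x y z. \<lbrakk>x \<in> carrier T; y \<in> carrier T; z \<in> carrier T\<rbrakk> \<Longrightarrow>
      (x \<oplus>\<^bsub>T\<^esub> y) \<otimes>\<^bsub>T\<^esub> z = x \<otimes>\<^bsub>T\<^esub> z \<oplus>\<^bsub>T\<^esub> y \<otimes>\<^bsub>T\<^esub> z"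
      "\<And>x y z. \<lbrakk>x \<in> carrier T; y \<in> carrier T; z \<in> carrier T\<rbrakk> \<Longrightarrow>
      z \<otimes>\<^bsub>T\<^esub> (x \<oplus>\<^bsub>T\<^esub> y) = z \<otimes>\<^bsub>T\<^esub> x \<oplus>\<^bsub>T\<^esub> z \<otimes>\<^bsub>T\<^esub> y"
    and smult_closed: "\<And>k x. \<lbrakk>k \<in> carrier K; x \<in> carrier T\<rbrakk> \<Longrightarrow> k \<odot>\<^bsub>T\<^esub> x \<in> carrier T"
    and smult_distr: "\<And>k m x. \<lbrakk>k \<in> carrier K; m \<in> carrier K; x \<in> carrier T\<rbrakk> \<Longrightarrow>
      (k \<oplus>\<^bsub>K\<^esub> m) \<odot>\<^bsub>T\<^esub> x = k \<odot>\<^bsub>T\<^esub> x \<oplus>\<^bsub>T\<^esub> m \<odot>\<^bsub>T\<^esub> x"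
      "\<And>k x y. \<lbrakk>k \<in> carrier K; x \<in> carrier T; y \<in> carrier T\<rbrakk> \<Longrightarrow>
      k \<odot>\<^bsub>T\<^esub> (x \<oplus>\<^bsub>T\<^esub> y) = k \<odot>\<^bsub>T\<^esub> x \<oplus>\<^bsub>T\<^esub> k \<odot>\<^bsub>T\<^esub> y"
    and smult_assoc: "\<And>k m x. \<lbrakk>k \<in> carrier K; m \<in> carrier K; x \<in> carrier T\<rbrakk> \<Longrightarrow>
      (k \<otimes>\<^bsub>K\<^esub> m) \<odot>\<^bsub>T\<^esub> x = k \<odot>\<^bsub>T\<^esub> (m \<odot>\<^bsub>T\<^esub> x)"
    and smult_one: "\<And>x. x \<in> carrier T \<Longrightarrow> \<one>\<^bsub>K\<^esub> \<odot>\<^bsub>T\<^esub> x = x"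
    and smult_mult: "\<And>k x y. \<lbrakk>k \<in> carrier K; x \<in> carrier T; y \<in> carrier T\<rbrakk> \<Longrightarrow>
      (k \<odot>\<^bsub>T\<^esub> x) \<otimes>\<^bsub>T\<^esub> y = k \<odot>\<^bsub>T\<^esub> (x \<otimes>\<^bsub>T\<^esub> y)"
      "\<And>k x y. \<lbrakk>k \<in> carrier K; x \<in> carrier T; y \<in> carrier T\<rbrakk> \<Longrightarrow>
      x \<otimes>\<^bsub>T\<^esub> (k \<odot>\<^bsub>T\<^esub> y) = k \<odot>\<^bsub>T\<^esub> (x \<otimes>\<^bsub>T\<^esub> y)"
    and even: "even_part T \<subseteq> carrier T" "\<zero>\<^bsub>T\<^esub> \<in> even_part T" "\<one>\<^bsub>T\<^esub> \<in> even_part T"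
      "\<And>x y. \<lbrakk>x \<in> even_part T; y \<in> even_part T\<rbrakk> \<Longrightarrow> x \<oplus>\<^bsub>T\<^esub> y \<in> even_part T"
      "\<And>k x. \<lbrakk>k \<in> carrier K; x \<in> even_part T\<rbrakk> \<Longrightarrow> k \<odot>\<^bsub>T\<^esub> x \<in> even_part T"
    and odd: "odd_part T \<subseteq> carrier T" "\<zero>\<^bsub>T\<^esub> \<in> odd_part T"
      "\<And>x y. \<lbrakk>x \<in> odd_part T; y \<in> odd_part T\<rbrakk> \<Longrightarrow> x \<oplus>\<^bsub>T\<^esub> y \<in> odd_part T"
      "\<And>k x. \<lbrakk>k \<in> carrier K; x \<in> odd_part T\<rbrakk> \<Longrightarrow> k \<odot>\<^bsub>T\<^esub> x \<in> odd_part T"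
    and sum: "\<And>x. x \<in> carrier T \<Longrightarrow> \<exists>y\<in>even_part T. \<exists>z\<in>odd_part T. x = y \<oplus>\<^bsub>T\<^esub> z"
    and direct: "\<And>x. \<lbrakk>x \<in> even_part T; x \<in> odd_part T\<rbrakk> \<Longrightarrow> x = \<zero>\<^bsub>T\<^esub>"
    and even_even: "\<And>x y. \<lbrakk>x \<in> even_part T; y \<in> even_part T\<rbrakk> \<Longrightarrow> x \<otimes>\<^bsub>T\<^esub> y \<in> even_part T"
    and even_odd: "\<And>x y. \<lbrakk>x \<in> even_part T; y \<in> odd_part T\<rbrakk> \<Longrightarrow> x \<otimes>\<^bsub>T\<^esub> y \<in> odd_part T"
    and odd_even: "\<And>x y. \<lbrakk>x \<in> odd_part T; y \<in> even_part T\<rbrakk> \<Longrightarrow> x \<otimes>\<^bsub>T\<^esub> y \<in> odd_part T"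
    and odd_odd: "\<And>x y. \<lbrakk>x \<in> odd_part T; y \<in> odd_part T\<rbrakk> \<Longrightarrow> x \<otimes>\<^bsub>T\<^esub> y \<in> even_part T"
    and even_central: "\<And>x y. \<lbrakk>x \<in> even_part T; y \<in> carrier T\<rbrakk> \<Longrightarrow> x \<otimes>\<^bsub>T\<^esub> y = y \<otimes>\<^bsub>T\<^esub> x"
    and odd_anticomm: "\<And>x y. \<lbrakk>x \<in> odd_part T; y \<in> odd_part T\<rbrakk> \<Longrightarrow>
      x \<otimes>\<^bsub>T\<^esub> y = (\<ominus>\<^bsub>K\<^esub> \<one>\<^bsub>K\<^esub>) \<odot>\<^bsub>T\<^esub> (y \<otimes>\<^bsub>T\<^esub> x)"
  shows "superalgebra K T"
proof -
  interpret K: field K by (rule assms(1))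
  have m1: "\<ominus>\<^bsub>K\<^esub> \<one>\<^bsub>K\<^esub> \<in> carrier K" by simp
  have abelian: "abelian_group T"
    using neg smult_closed[OF m1]
    by (intro abelian_groupI add_closed zero_closed add_assoc add_comm zero_add) blast+
  have monoid: "monoid T"
    by (rule monoidI) (use mult_closed one_closed mult_assoc one_mult in auto)
  interpret T: ring T
    by (rule ringI) (use abelian monoid distr in auto)
  interpret module K T
    by (rule moduleI) (use abelian smult_closed smult_distr smult_assoc smult_one K.is_cring in auto)
  have m1_smult: "(\<ominus>\<^bsub>K\<^esub> \<one>\<^bsub>K\<^esub>) \<odot>\<^bsub>T\<^esub> x = \<ominus>\<^bsub>T\<^esub> x" if "x \<in> carrier T" for x
    using that by (simp add: smult_l_minus)
  have even_submodule: "submodule (even_part T) K T"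
    by (rule submoduleI) (use even even(5)[OF m1] m1_smult in \<open>auto simp: subset_iff a_inv_def\<close>)
  have odd_submodule: "submodule (odd_part T) K T"
    by (rule submoduleI) (use odd odd(4)[OF m1] m1_smult in \<open>auto simp: subset_iff a_inv_def\<close>)
  have direct_sum: "\<exists>!p. p \<in> even_part T \<times> odd_part T \<and> x = fst p \<oplus>\<^bsub>T\<^esub> snd p"
    if x: "x \<in> carrier T" for x
  proof -
    obtain y z where yz: "y \<in> even_part T" "z \<in> odd_part T" "x = y \<oplus>\<^bsub>T\<^esub> z"
      using sum[OF x] by blast
    show ?thesis
    proof (rule ex1I[of _ "(y, z)"])
      fix p assume p: "p \<in> even_part T \<times> odd_part T \<and> x = fst p \<oplus>\<^bsub>T\<^esub> snd p"
      obtain y' z' where p_eq: "p = (y', z')" by (cases p)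
      have c: "y \<in> carrier T" "z \<in> carrier T" "y' \<in> carrier T" "z' \<in> carrier T"
        using yz p p_eq even(1) odd(1) by auto
      have eq: "y \<oplus>\<^bsub>T\<^esub> z = y' \<oplus>\<^bsub>T\<^esub> z'" using yz p p_eq by simp
      have "y \<oplus>\<^bsub>T\<^esub> \<ominus>\<^bsub>T\<^esub> y' = z' \<oplus>\<^bsub>T\<^esub> \<ominus>\<^bsub>T\<^esub> z"
      proof -
        have "y = (y' \<oplus>\<^bsub>T\<^esub> z') \<oplus>\<^bsub>T\<^esub> \<ominus>\<^bsub>T\<^esub> z"
          using c by (simp flip: eq add: T.add.m_assoc T.r_neg)
        then have "y \<oplus>\<^bsub>T\<^esub> \<ominus>\<^bsub>T\<^esub> y' = (z' \<oplus>\<^bsub>T\<^esub> \<ominus>\<^bsub>T\<^esub> z) \<oplus>\<^bsub>T\<^esub> (y' \<oplus>\<^bsub>T\<^esub> \<ominus>\<^bsub>T\<^esub> y')"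
          using c by (simp only: T.add.m_ac T.a_closed T.a_inv_closed)
        then show ?thesis using c by (simp add: T.r_neg)
      qed
      moreover have "y \<oplus>\<^bsub>T\<^esub> \<ominus>\<^bsub>T\<^esub> y' \<in> even_part T"
        using even(4)[OF yz(1)] even(5)[OF m1, of y'] m1_smult p p_eq c by simp
      moreover have "z' \<oplus>\<^bsub>T\<^esub> \<ominus>\<^bsub>T\<^esub> z \<in> odd_part T"
        using odd(3)[of z'] odd(4)[OF m1 yz(2)] m1_smult p p_eq c by simp
      ultimately have "y \<oplus>\<^bsub>T\<^esub> \<ominus>\<^bsub>T\<^esub> y' = \<zero>\<^bsub>T\<^esub>" "z' \<oplus>\<^bsub>T\<^esub> \<ominus>\<^bsub>T\<^esub> z = \<zero>\<^bsub>T\<^esub>"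
        using direct by auto
      then show "p = (y, z)"
        using c p_eq by (metis T.add.inv_equality T.minus_minus T.a_inv_closed)
    qed (use yz in auto)
  qed
  have anticomm: "x \<otimes>\<^bsub>T\<^esub> y = \<ominus>\<^bsub>T\<^esub> (y \<otimes>\<^bsub>T\<^esub> x)" if "x \<in> odd_part T" "y \<in> odd_part T" for x y
  proof -
    have "y \<otimes>\<^bsub>T\<^esub> x \<in> carrier T" using that odd(1) by blast
    from m1_smult[OF this] show ?thesis using odd_anticomm[OF that] by (rule trans[rotated])
  qed
  show ?thesis
    by (rule superalgebra.intro[OF K.field_axioms T.ring_axioms module_axioms
      superalgebra_axioms.intro[OF smult_mult even_submodule odd_submodule direct_sum even(3)
        even_even even_odd odd_even odd_odd even_central anticomm]])
qed

section \<open>Morphisms, images and fibre products of superalgebras\<close>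

lemma salg_homI:
  assumes "\<And>x. x \<in> carrier A \<Longrightarrow> f x \<in> carrier B"
    and "\<And>x. x \<notin> carrier A \<Longrightarrow> f x = undefined"
    and "\<And>x y. \<lbrakk>x \<in> carrier A; y \<in> carrier A\<rbrakk> \<Longrightarrow> f (x \<oplus>\<^bsub>A\<^esub> y) = f x \<oplus>\<^bsub>B\<^esub> f y"
    and "\<And>x y. \<lbrakk>x \<in> carrier A; y \<in> carrier A\<rbrakk> \<Longrightarrow> f (x \<otimes>\<^bsub>A\<^esub> y) = f x \<otimes>\<^bsub>B\<^esub> f y"
    and "f \<one>\<^bsub>A\<^esub> = \<one>\<^bsub>B\<^esub>"
    and "\<And>k x. \<lbrakk>k \<in> carrier K; x \<in> carrier A\<rbrakk> \<Longrightarrow> f (k \<odot>\<^bsub>A\<^esub> x) = k \<odot>\<^bsub>B\<^esub> f x"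
    and "\<And>x. x \<in> even_part A \<Longrightarrow> f x \<in> even_part B"
    and "\<And>x. x \<in> odd_part A \<Longrightarrow> f x \<in> odd_part B"
  shows "f \<in> salg_hom K A B"
  using assms unfolding salg_hom_def ring_hom_def by auto

lemma salg_homD:
  assumes "f \<in> salg_hom K A B"
  shows "x \<in> carrier A \<Longrightarrow> f x \<in> carrier B"
    and "x \<notin> carrier A \<Longrightarrow> f x = undefined"
    and "\<lbrakk>x \<in> carrier A; y \<in> carrier A\<rbrakk> \<Longrightarrow> f (x \<oplus>\<^bsub>A\<^esub> y) = f x \<oplus>\<^bsub>B\<^esub> f y"
    and "\<lbrakk>x \<in> carrier A; y \<in> carrier A\<rbrakk> \<Longrightarrow> f (x \<otimes>\<^bsub>A\<^esub> y) = f x \<otimes>\<^bsub>B\<^esub> f y"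
    and "f \<one>\<^bsub>A\<^esub> = \<one>\<^bsub>B\<^esub>"
    and "\<lbrakk>k \<in> carrier K; x \<in> carrier A\<rbrakk> \<Longrightarrow> f (k \<odot>\<^bsub>A\<^esub> x) = k \<odot>\<^bsub>B\<^esub> f x"
    and "x \<in> even_part A \<Longrightarrow> f x \<in> even_part B"
    and "x \<in> odd_part A \<Longrightarrow> f x \<in> odd_part B"
  using assms unfolding salg_hom_def ring_hom_def by auto

lemma salg_hom_minus:
  assumes "superalgebra K A" "superalgebra K B" "f \<in> salg_hom K A B"
  shows "f \<zero>\<^bsub>A\<^esub> = \<zero>\<^bsub>B\<^esub>"
    and "x \<in> carrier A \<Longrightarrow> f (\<ominus>\<^bsub>A\<^esub> x) = \<ominus>\<^bsub>B\<^esub> f x"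
    and "\<lbrakk>x \<in> carrier A; y \<in> carrier A\<rbrakk> \<Longrightarrow> f (x \<ominus>\<^bsub>A\<^esub> y) = f x \<ominus>\<^bsub>B\<^esub> f y"
proof -
  interpret A: superalgebra K A by fact
  interpret B: superalgebra K B by fact
  note f = salg_homD[OF assms(3)]
  show "f \<zero>\<^bsub>A\<^esub> = \<zero>\<^bsub>B\<^esub>"
    using f(6)[OF A.K.zero_closed A.A.zero_closed] f(1) by simp
  show neg: "f (\<ominus>\<^bsub>A\<^esub> x) = \<ominus>\<^bsub>B\<^esub> f x" if "x \<in> carrier A" for x
    using f(6)[of "\<ominus>\<^bsub>K\<^esub> \<one>\<^bsub>K\<^esub>" x] f(1) that by (simp add: A.minus_smult B.minus_smult)
  show "f (x \<ominus>\<^bsub>A\<^esub> y) = f x \<ominus>\<^bsub>B\<^esub> f y" if "x \<in> carrier A" "y \<in> carrier A"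
    using that by (simp add: a_minus_def f neg)
qed

lemma salg_hom_comp:
  assumes "superalgebra K A" "superalgebra K B" "f \<in> salg_hom K A B" "x \<in> carrier A"
  shows "f (even_comp A x) = even_comp B (f x)" "f (odd_comp A x) = odd_comp B (f x)"
proof -
  interpret A: superalgebra K A by fact
  interpret B: superalgebra K B by fact
  note f = salg_homD[OF assms(3)]
  note x = A.decomposition[OF assms(4)]
  have "f x = f (even_comp A x) \<oplus>\<^bsub>B\<^esub> f (odd_comp A x)"
    using f(3)[of "even_comp A x" "odd_comp A x"] x assms(4) by simp
  then show "f (even_comp A x) = even_comp B (f x)" "f (odd_comp A x) = odd_comp B (f x)"
    using B.comp_sum_eq[OF f(7)[OF x(1)] f(8)[OF x(2)]] by simp_all
qed

lemma salg_hom_compose: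
  assumes "superalgebra K A" "f \<in> salg_hom K A B" "g \<in> salg_hom K B C"
  shows "compose (carrier A) g f \<in> salg_hom K A C"
proof -
  interpret A: superalgebra K A by fact
  note f = salg_homD[OF assms(2)] and g = salg_homD[OF assms(3)]
  show ?thesis
    by (rule salg_homI) (auto simp: compose_def f g A.even_in_carrier A.odd_in_carrier)
qed

lemma salg_hom_eqI:
  assumes "f \<in> salg_hom K A B" "g \<in> salg_hom K A C" "\<And>x. x \<in> carrier A \<Longrightarrow> f x = g x"
  shows "f = g"
  using assms salg_homD(2) by (metis ext)

lemma ground_superalg_simps [simp]:
  "carrier (ground_superalg K) = carrier K"
  "monoid.mult (ground_superalg K) = monoid.mult K"
  "\<one>\<^bsub>ground_superalg K\<^esub> = \<one>\<^bsub>K\<^esub>"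
  "\<zero>\<^bsub>ground_superalg K\<^esub> = \<zero>\<^bsub>K\<^esub>"
  "ring.add (ground_superalg K) = ring.add K"
  "smult (ground_superalg K) = monoid.mult K"
  "even_part (ground_superalg K) = carrier K"
  "odd_part (ground_superalg K) = {\<zero>\<^bsub>K\<^esub>}"
  by (simp_all add: ground_superalg_def)

lemma superalgebra_ground:
  assumes "field K"
  shows "superalgebra K (ground_superalg K)"
proof -
  interpret K: field K by fact
  show ?thesis
    by (rule superalgebraI) (auto simp: assms K.l_distr K.r_distr K.m_ac K.add.m_ac K.l_minus K.r_minus K.r_neg)
qed

lemma (in superalgebra) unit_hom:
  "(\<lambda>k\<in>carrier K. k \<odot>\<^bsub>A\<^esub> \<one>\<^bsub>A\<^esub>) \<in> salg_hom K (ground_superalg K) A"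
  by (rule salg_homI)
     (auto simp: smult_l_distr smult_mult_left smult_assoc1 even_closed one_even odd_closed)

text \<open>The algebra laws pass to the image of a surjection that respects the operations; only the directness
  of the grading has to be supplied, since it can fail when the kernel is not graded.\<close>

lemma superalgebra_image:
  fixes T :: "('k, 'b) superalg"
  assumes "superalgebra K A"
    and carrier: "carrier T = q ` carrier A"
    and add: "\<And>x y. \<lbrakk>x \<in> carrier A; y \<in> carrier A\<rbrakk> \<Longrightarrow> q x \<oplus>\<^bsub>T\<^esub> q y = q (x \<oplus>\<^bsub>A\<^esub> y)"
    and mult: "\<And>x y. \<lbrakk>x \<in> carrier A; y \<in> carrier A\<rbrakk> \<Longrightarrow> q x \<otimes>\<^bsub>T\<^esub> q y = q (x \<otimes>\<^bsub>A\<^esub> y)"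
    and smult: "\<And>k x. \<lbrakk>k \<in> carrier K; x \<in> carrier A\<rbrakk> \<Longrightarrow> k \<odot>\<^bsub>T\<^esub> q x = q (k \<odot>\<^bsub>A\<^esub> x)"
    and zero: "\<zero>\<^bsub>T\<^esub> = q \<zero>\<^bsub>A\<^esub>" and one: "\<one>\<^bsub>T\<^esub> = q \<one>\<^bsub>A\<^esub>"
    and even: "even_part T = q ` even_part A" and odd: "odd_part T = q ` odd_part A"
    and direct: "\<And>y z. \<lbrakk>y \<in> even_part A; z \<in> odd_part A; q y = q z\<rbrakk> \<Longrightarrow> q y = q \<zero>\<^bsub>A\<^esub>"
  shows "superalgebra K T"
proof -
  interpret A: superalgebra K A by fact
  note simps = carrier add mult smult zero one even odd A.even_in_carrier A.odd_in_carrier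
  show ?thesis
  proof (rule superalgebraI)
    show "field K" by (rule A.K.field_axioms)
    show "\<exists>y\<in>even_part T. \<exists>z\<in>odd_part T. x = y \<oplus>\<^bsub>T\<^esub> z" if "x \<in> carrier T" for x
    proof -
      obtain a where a: "a \<in> carrier A" "x = q a" using \<open>x \<in> carrier T\<close> carrier by auto
      have "x = q (even_comp A a) \<oplus>\<^bsub>T\<^esub> q (odd_comp A a)"
        using a A.decomposition[OF a(1)] by (simp add: simps)
      then show ?thesis using A.decomposition[OF a(1)] by (auto simp: even odd)
    qed
    show "x = \<zero>\<^bsub>T\<^esub>" if "x \<in> even_part T" "x \<in> odd_part T" for x
      using that direct by (auto simp: even odd zero)
    show "x \<otimes>\<^bsub>T\<^esub> y = y \<otimes>\<^bsub>T\<^esub> x" if x: "x \<in> even_part T" and y: "y \<in> carrier T" for x y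
    proof -
      obtain a b where "a \<in> even_part A" "b \<in> carrier A" "x = q a" "y = q b"
        using x y by (auto simp: even carrier)
      then show ?thesis using A.even_central[of a b] by (simp add: mult A.even_in_carrier)
    qed
    show "x \<otimes>\<^bsub>T\<^esub> y = (\<ominus>\<^bsub>K\<^esub> \<one>\<^bsub>K\<^esub>) \<odot>\<^bsub>T\<^esub> (y \<otimes>\<^bsub>T\<^esub> x)"
      if x: "x \<in> odd_part T" and y: "y \<in> odd_part T" for x y
    proof -
      obtain a b where "a \<in> odd_part A" "b \<in> odd_part A" "x = q a" "y = q b"
        using x y by (auto simp: odd)
      then show ?thesis
        using A.odd_anticomm[of a b]
        by (simp add: mult smult A.odd_in_carrier A.minus_smult)
    qed
  qed (auto simp: simps A.even_closed A.odd_closed A.one_even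
      A.smult_l_distr A.smult_r_distr A.smult_assoc1 A.A.l_distr A.A.r_distr A.A.m_assoc
      A.A.add.m_ac A.smult_mult_left A.smult_mult_right A.minus_smult A.A.r_neg
      A.even_even A.even_odd A.odd_even A.odd_odd
      intro!: imageI)
qed

text \<open>The map \<open>q\<close> picks a name for each class modulo a superideal. An injective \<open>q\<close> relabels the
  superalgebra, and a choice of representatives gives the quotient with carrier in the original type.\<close>

definition image_superalg :: "('k, 'a) superalg \<Rightarrow> ('a \<Rightarrow> 'b) \<Rightarrow> ('k, 'b) superalg" where
  "image_superalg A q =
    \<lparr>carrier = q ` carrier A,
     monoid.mult = (\<lambda>x y. q (inv_into (carrier A) q x \<otimes>\<^bsub>A\<^esub> inv_into (carrier A) q y)),
     one = q \<one>\<^bsub>A\<^esub>, ring.zero = q \<zero>\<^bsub>A\<^esub>,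
     ring.add = (\<lambda>x y. q (inv_into (carrier A) q x \<oplus>\<^bsub>A\<^esub> inv_into (carrier A) q y)),
     smult = (\<lambda>k x. q (k \<odot>\<^bsub>A\<^esub> inv_into (carrier A) q x)),
     even_part = q ` even_part A, odd_part = q ` odd_part A\<rparr>"

lemma image_superalg:
  assumes "superalgebra K A" "superideal J A"
    and ker: "\<And>x y. \<lbrakk>x \<in> carrier A; y \<in> carrier A\<rbrakk> \<Longrightarrow> q x = q y \<longleftrightarrow> x \<ominus>\<^bsub>A\<^esub> y \<in> J"
  shows "superalgebra K (image_superalg A q)"
    and "restrict q (carrier A) \<in> salg_hom K A (image_superalg A q)"
    and "restrict q (carrier A) ` carrier A = carrier (image_superalg A q)"
    and "restrict q (carrier A) ` even_part A = even_part (image_superalg A q)"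
    and "restrict q (carrier A) ` odd_part A = odd_part (image_superalg A q)"
proof -
  interpret A: superalgebra K A by fact
  interpret J: ideal J A using assms(2) by (simp add: superideal_def)
  let ?T = "image_superalg A q" and ?r = "inv_into (carrier A) q"
  have r: "?r (q x) \<in> carrier A" "?r (q x) \<ominus>\<^bsub>A\<^esub> x \<in> J" if "x \<in> carrier A" for x
  proof -
    show c: "?r (q x) \<in> carrier A" using that by (simp add: inv_into_into)
    have "q (?r (q x)) = q x" using that by (simp add: f_inv_into_f)
    then show "?r (q x) \<ominus>\<^bsub>A\<^esub> x \<in> J" using ker[OF c that] by simp
  qed
  have carrier: "carrier ?T = q ` carrier A" and zero: "\<zero>\<^bsub>?T\<^esub> = q \<zero>\<^bsub>A\<^esub>" and one: "\<one>\<^bsub>?T\<^esub> = q \<one>\<^bsub>A\<^esub>"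
    and even: "even_part ?T = q ` even_part A" and odd: "odd_part ?T = q ` odd_part A"
    by (simp_all add: image_superalg_def)
  have add: "q x \<oplus>\<^bsub>?T\<^esub> q y = q (x \<oplus>\<^bsub>A\<^esub> y)" if "x \<in> carrier A" "y \<in> carrier A" for x y
  proof -
    have "(?r (q x) \<oplus>\<^bsub>A\<^esub> ?r (q y)) \<ominus>\<^bsub>A\<^esub> (x \<oplus>\<^bsub>A\<^esub> y)
        = (?r (q x) \<ominus>\<^bsub>A\<^esub> x) \<oplus>\<^bsub>A\<^esub> (?r (q y) \<ominus>\<^bsub>A\<^esub> y)"
      using that r(1) by (simp add: a_minus_def A.A.minus_add A.A.add.m_ac)
    also have "\<dots> \<in> J" using that r(2) by blast
    finally show ?thesis using that r(1) ker by (simp add: image_superalg_def)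
  qed
  have mult: "q x \<otimes>\<^bsub>?T\<^esub> q y = q (x \<otimes>\<^bsub>A\<^esub> y)" if "x \<in> carrier A" "y \<in> carrier A" for x y
  proof -
    define x' y' where "x' = ?r (q x)" and "y' = ?r (q y)"
    have c: "x' \<in> carrier A" "y' \<in> carrier A" and d: "x' \<ominus>\<^bsub>A\<^esub> x \<in> J" "y' \<ominus>\<^bsub>A\<^esub> y \<in> J"
      using r that by (simp_all add: x'_def y'_def)
    have "(x' \<otimes>\<^bsub>A\<^esub> y') \<ominus>\<^bsub>A\<^esub> (x \<otimes>\<^bsub>A\<^esub> y)
        = (x' \<ominus>\<^bsub>A\<^esub> x) \<otimes>\<^bsub>A\<^esub> y' \<oplus>\<^bsub>A\<^esub> x \<otimes>\<^bsub>A\<^esub> (y' \<ominus>\<^bsub>A\<^esub> y)"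
    proof -
      have "(x' \<ominus>\<^bsub>A\<^esub> x) \<otimes>\<^bsub>A\<^esub> y' \<oplus>\<^bsub>A\<^esub> x \<otimes>\<^bsub>A\<^esub> (y' \<ominus>\<^bsub>A\<^esub> y)
        = x' \<otimes>\<^bsub>A\<^esub> y' \<oplus>\<^bsub>A\<^esub> (\<ominus>\<^bsub>A\<^esub> (x \<otimes>\<^bsub>A\<^esub> y') \<oplus>\<^bsub>A\<^esub> (x \<otimes>\<^bsub>A\<^esub> y' \<oplus>\<^bsub>A\<^esub> \<ominus>\<^bsub>A\<^esub> (x \<otimes>\<^bsub>A\<^esub> y)))"
        using that c by (simp add: a_minus_def A.A.l_distr A.A.r_distr A.A.l_minus A.A.r_minus A.A.a_assoc)
      also have "\<dots> = (x' \<otimes>\<^bsub>A\<^esub> y') \<ominus>\<^bsub>A\<^esub> (x \<otimes>\<^bsub>A\<^esub> y)"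
        using that c by (simp add: A.A.r_neg1 a_minus_def)
      finally show ?thesis by simp
    qed
    also have "\<dots> \<in> J" using that c d by (intro J.a_closed J.I_l_closed J.I_r_closed)
    finally show ?thesis using that c ker by (simp add: image_superalg_def x'_def y'_def)
  qed
  have smult: "k \<odot>\<^bsub>?T\<^esub> q x = q (k \<odot>\<^bsub>A\<^esub> x)" if "k \<in> carrier K" "x \<in> carrier A" for k x
  proof -
    have "k \<odot>\<^bsub>A\<^esub> ?r (q x) \<ominus>\<^bsub>A\<^esub> k \<odot>\<^bsub>A\<^esub> x = (k \<odot>\<^bsub>A\<^esub> \<one>\<^bsub>A\<^esub>) \<otimes>\<^bsub>A\<^esub> (?r (q x) \<ominus>\<^bsub>A\<^esub> x)"
      using that r(1) by (simp add: a_minus_def A.smult_mult_left A.smult_r_distr A.smult_r_minus)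
    also have "\<dots> \<in> J" using that r(2) by (intro J.I_l_closed) auto
    finally show ?thesis using that r(1) ker by (simp add: image_superalg_def)
  qed
  have direct: "q y = q \<zero>\<^bsub>A\<^esub>" if y: "y \<in> even_part A" and z: "z \<in> odd_part A" and eq: "q y = q z" for y z
  proof -
    have c: "y \<in> carrier A" "z \<in> carrier A" using y z A.even_in_carrier A.odd_in_carrier by auto
    have "y \<oplus>\<^bsub>A\<^esub> \<ominus>\<^bsub>A\<^esub> z \<in> J" using ker[OF c] eq by (simp add: a_minus_def)
    then have "even_comp A (y \<oplus>\<^bsub>A\<^esub> \<ominus>\<^bsub>A\<^esub> z) \<in> J" using assms(2) by (simp add: superideal_def)
    then have "y \<in> J" using A.comp_sum_eq[OF y A.odd_closed(3)[OF z]] by simp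
    then show ?thesis using ker[of y "\<zero>\<^bsub>A\<^esub>"] c by (simp add: a_minus_def)
  qed
  show "superalgebra K ?T"
    using assms(1) carrier add mult smult zero one even odd direct by (rule superalgebra_image)
  show "restrict q (carrier A) \<in> salg_hom K A ?T"
    by (rule salg_homI)
       (auto simp: carrier add mult smult one even odd A.even_in_carrier A.odd_in_carrier)
  show "restrict q (carrier A) ` carrier A = carrier ?T"
    "restrict q (carrier A) ` even_part A = even_part ?T"
    "restrict q (carrier A) ` odd_part A = odd_part ?T"
    using A.even_in_carrier A.odd_in_carrier by (auto simp: carrier even odd image_iff)
qed

text \<open>Classes are named by chosen representatives, so that the quotient of a superalgebra with carrier in the
  universe again has its carrier in the universe.\<close>

lemma quotient_superalgebra:
  fixes A :: "('k, 'a) superalg"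
  assumes "superalgebra K A" "superideal J A"
  obtains T :: "('k, 'a) superalg" and q where
    "superalgebra K T" "q \<in> salg_hom K A T" "q ` carrier A = carrier T"
    "q ` even_part A = even_part T" "q ` odd_part A = odd_part T"
    "\<forall>x\<in>carrier A. q x = \<zero>\<^bsub>T\<^esub> \<longleftrightarrow> x \<in> J"
proof -
  interpret A: superalgebra K A by fact
  interpret J: ideal J A using assms(2) by (simp add: superideal_def)
  define q where "q x = (SOME y. y \<in> carrier A \<and> y \<ominus>\<^bsub>A\<^esub> x \<in> J)" for x
  have q: "q x \<in> carrier A" "q x \<ominus>\<^bsub>A\<^esub> x \<in> J" if "x \<in> carrier A" for x
  proof -
    have "\<exists>y. y \<in> carrier A \<and> y \<ominus>\<^bsub>A\<^esub> x \<in> J"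
      using that by (intro exI[of _ x]) (simp add: A.A.r_neg a_minus_def)
    then show "q x \<in> carrier A" "q x \<ominus>\<^bsub>A\<^esub> x \<in> J"
      unfolding q_def by (metis (mono_tags, lifting) someI_ex)+
  qed
  have trans: "x \<ominus>\<^bsub>A\<^esub> z \<in> J"
    if "x \<ominus>\<^bsub>A\<^esub> y \<in> J" "y \<ominus>\<^bsub>A\<^esub> z \<in> J" "x \<in> carrier A" "y \<in> carrier A" "z \<in> carrier A" for x y z
  proof -
    have "x \<ominus>\<^bsub>A\<^esub> z = (x \<ominus>\<^bsub>A\<^esub> y) \<oplus>\<^bsub>A\<^esub> (y \<ominus>\<^bsub>A\<^esub> z)"
      using that(3-5) by (simp add: a_minus_def A.A.a_assoc A.A.r_neg1)
    then show ?thesis using that(1,2) by simp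
  qed
  have sym: "y \<ominus>\<^bsub>A\<^esub> x \<in> J" if "x \<ominus>\<^bsub>A\<^esub> y \<in> J" "x \<in> carrier A" "y \<in> carrier A" for x y
  proof -
    have "y \<ominus>\<^bsub>A\<^esub> x = \<ominus>\<^bsub>A\<^esub> (x \<ominus>\<^bsub>A\<^esub> y)"
      using that(2,3) by (simp add: a_minus_def A.A.minus_add A.A.a_comm)
    then show ?thesis using that(1) by simp
  qed
  have ker: "q x = q y \<longleftrightarrow> x \<ominus>\<^bsub>A\<^esub> y \<in> J" if c: "x \<in> carrier A" "y \<in> carrier A" for x y
  proof
    assume "q x = q y"
    then have "q x \<ominus>\<^bsub>A\<^esub> x \<in> J" "q x \<ominus>\<^bsub>A\<^esub> y \<in> J" using q[OF c(1)] q[OF c(2)] by simp_all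
    then show "x \<ominus>\<^bsub>A\<^esub> y \<in> J" using trans[OF sym] q c by blast
  next
    assume J: "x \<ominus>\<^bsub>A\<^esub> y \<in> J"
    have "(w \<in> carrier A \<and> w \<ominus>\<^bsub>A\<^esub> x \<in> J) = (w \<in> carrier A \<and> w \<ominus>\<^bsub>A\<^esub> y \<in> J)" for w
      using trans[of w x y] trans[of w y x] J sym[OF J] c by blast
    then show "q x = q y" unfolding q_def by simp
  qed
  note T = image_superalg[OF assms ker]
  have ker0: "restrict q (carrier A) x = \<zero>\<^bsub>image_superalg A q\<^esub> \<longleftrightarrow> x \<in> J" if "x \<in> carrier A" for x
    using ker[of x "\<zero>\<^bsub>A\<^esub>"] that by (simp add: image_superalg_def a_minus_def)
  show thesis by (rule that[OF T ballI[OF ker0]])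
qed

lemma salg_hom_factor:
  assumes "superalgebra K A" "superalgebra K B" "superalgebra K T"
    and q: "q \<in> salg_hom K A T" "q ` carrier A = carrier T"
      "q ` even_part A = even_part T" "q ` odd_part A = odd_part T"
    and h: "h \<in> salg_hom K A B"
    and ker: "\<And>x. \<lbrakk>x \<in> carrier A; q x = \<zero>\<^bsub>T\<^esub>\<rbrakk> \<Longrightarrow> h x = \<zero>\<^bsub>B\<^esub>"
  shows "\<exists>h'\<in>salg_hom K T B. \<forall>x\<in>carrier A. h' (q x) = h x"
proof -
  interpret A: superalgebra K A by fact
  interpret B: superalgebra K B by fact
  interpret T: superalgebra K T by fact
  note qD = salg_homD[OF q(1)] and hD = salg_homD[OF h]
  have wd: "h x = h y" if "x \<in> carrier A" "y \<in> carrier A" "q x = q y" for x y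
  proof -
    have "q (x \<ominus>\<^bsub>A\<^esub> y) = \<zero>\<^bsub>T\<^esub>"
      using salg_hom_minus(3)[OF assms(1,3) q(1)] that qD(1) by (simp add: a_minus_def T.A.r_neg)
    then have "h x \<ominus>\<^bsub>B\<^esub> h y = \<zero>\<^bsub>B\<^esub>"
      using ker[of "x \<ominus>\<^bsub>A\<^esub> y"] salg_hom_minus(3)[OF assms(1,2) h] that by simp
    then show ?thesis using that hD(1) by simp
  qed
  define h' where "h' = (\<lambda>t\<in>carrier T. h (inv_into (carrier A) q t))"
  have h': "h' (q x) = h x" if "x \<in> carrier A" for x
  proof -
    have "inv_into (carrier A) q (q x) \<in> carrier A" "q (inv_into (carrier A) q (q x)) = q x"
      using that by (auto simp: inv_into_into f_inv_into_f)
    from wd[OF this(1) that this(2)] show ?thesis using qD(1)[OF that] by (simp add: h'_def)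
  qed
  have T: "\<exists>x\<in>carrier A. t = q x" if "t \<in> carrier T" for t using that q(2) by auto
  have "h' \<in> salg_hom K T B"
  proof (rule salg_homI)
    show "h' x \<in> carrier B" if "x \<in> carrier T" for x using T[OF that] h' hD(1) by auto
    show "h' x = undefined" if "x \<notin> carrier T" for x using that by (simp add: h'_def)
    show "h' (x \<oplus>\<^bsub>T\<^esub> y) = h' x \<oplus>\<^bsub>B\<^esub> h' y" if "x \<in> carrier T" "y \<in> carrier T" for x y
      using T[OF that(1)] T[OF that(2)] h' hD by (auto simp flip: qD(3))
    show "h' (x \<otimes>\<^bsub>T\<^esub> y) = h' x \<otimes>\<^bsub>B\<^esub> h' y" if "x \<in> carrier T" "y \<in> carrier T" for x y
      using T[OF that(1)] T[OF that(2)] h' hD by (auto simp flip: qD(4))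
    show "h' \<one>\<^bsub>T\<^esub> = \<one>\<^bsub>B\<^esub>" using h'[of "\<one>\<^bsub>A\<^esub>"] qD(5) hD(5) by simp
    show "h' (k \<odot>\<^bsub>T\<^esub> x) = k \<odot>\<^bsub>B\<^esub> h' x" if "k \<in> carrier K" "x \<in> carrier T" for k x
      using T[OF that(2)] that(1) h' hD by (auto simp flip: qD(6))
    show "h' x \<in> even_part B" if "x \<in> even_part T" for x
      using that h' hD(7) A.even_in_carrier by (auto simp flip: q(3))
    show "h' x \<in> odd_part B" if "x \<in> odd_part T" for x
      using that h' hD(8) A.odd_in_carrier by (auto simp flip: q(4))
  qed
  then show ?thesis using h' by blast
qed

definition subproduct ::
    "('k, 'a) superalg \<Rightarrow> ('k, 'b) superalg \<Rightarrow> ('a \<times> 'b) set \<Rightarrow> ('k, 'a \<times> 'b) superalg" where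
  "subproduct R S B =
    \<lparr>carrier = B, monoid.mult = (\<lambda>x y. (fst x \<otimes>\<^bsub>R\<^esub> fst y, snd x \<otimes>\<^bsub>S\<^esub> snd y)), one = (\<one>\<^bsub>R\<^esub>, \<one>\<^bsub>S\<^esub>),
     ring.zero = (\<zero>\<^bsub>R\<^esub>, \<zero>\<^bsub>S\<^esub>), ring.add = (\<lambda>x y. (fst x \<oplus>\<^bsub>R\<^esub> fst y, snd x \<oplus>\<^bsub>S\<^esub> snd y)),
     smult = (\<lambda>k x. (k \<odot>\<^bsub>R\<^esub> fst x, k \<odot>\<^bsub>S\<^esub> snd x)),
     even_part = B \<inter> even_part R \<times> even_part S, odd_part = B \<inter> odd_part R \<times> odd_part S\<rparr>"

locale subproduct_closed = R: superalgebra K R + S: superalgebra K S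
  for K :: "'k ring" and R :: "('k, 'a) superalg" and S :: "('k, 'b) superalg" +
  fixes B :: "('a \<times> 'b) set"
  assumes subset: "B \<subseteq> carrier R \<times> carrier S"
    and one: "(\<one>\<^bsub>R\<^esub>, \<one>\<^bsub>S\<^esub>) \<in> B"
    and add: "\<lbrakk>(x, y) \<in> B; (x', y') \<in> B\<rbrakk> \<Longrightarrow> (x \<oplus>\<^bsub>R\<^esub> x', y \<oplus>\<^bsub>S\<^esub> y') \<in> B"
    and mult: "\<lbrakk>(x, y) \<in> B; (x', y') \<in> B\<rbrakk> \<Longrightarrow> (x \<otimes>\<^bsub>R\<^esub> x', y \<otimes>\<^bsub>S\<^esub> y') \<in> B"
    and smult: "\<lbrakk>k \<in> carrier K; (x, y) \<in> B\<rbrakk> \<Longrightarrow> (k \<odot>\<^bsub>R\<^esub> x, k \<odot>\<^bsub>S\<^esub> y) \<in> B"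
    and even: "(x, y) \<in> B \<Longrightarrow> (even_comp R x, even_comp S y) \<in> B"
begin

lemma in_carrier:
  assumes "(x, y) \<in> B"
  shows "x \<in> carrier R" "y \<in> carrier S"
  using assms subset by auto

lemma zero: "(\<zero>\<^bsub>R\<^esub>, \<zero>\<^bsub>S\<^esub>) \<in> B"
  using smult[OF _ one, of "\<zero>\<^bsub>K\<^esub>"] by simp

lemma odd:
  assumes "(x, y) \<in> B"
  shows "(odd_comp R x, odd_comp S y) \<in> B"
proof -
  note c = in_carrier[OF assms]
  have "(x \<oplus>\<^bsub>R\<^esub> \<ominus>\<^bsub>R\<^esub> even_comp R x, y \<oplus>\<^bsub>S\<^esub> \<ominus>\<^bsub>S\<^esub> even_comp S y) \<in> B"
    using add[OF assms smult[OF _ even[OF assms], of "\<ominus>\<^bsub>K\<^esub> \<one>\<^bsub>K\<^esub>"]] c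
    by (simp add: R.minus_smult S.minus_smult)
  moreover have "x \<oplus>\<^bsub>R\<^esub> \<ominus>\<^bsub>R\<^esub> even_comp R x = odd_comp R x"
    using R.decomposition(3)[OF c(1)] c R.A.r_neg1[of "even_comp R x" "odd_comp R x"]
    by (metis R.A.a_comm R.A.a_inv_closed R.comp_closed)
  moreover have "y \<oplus>\<^bsub>S\<^esub> \<ominus>\<^bsub>S\<^esub> even_comp S y = odd_comp S y"
    using S.decomposition(3)[OF c(2)] c S.A.r_neg1[of "even_comp S y" "odd_comp S y"]
    by (metis S.A.a_comm S.A.a_inv_closed S.comp_closed)
  ultimately show ?thesis by simp
qed

lemma superalgebra_subproduct: "superalgebra K (subproduct R S B)"
proof (rule superalgebraI)
  show "field K" by (rule R.K.field_axioms)
  show "\<exists>y\<in>even_part (subproduct R S B). \<exists>z\<in>odd_part (subproduct R S B).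
      p = y \<oplus>\<^bsub>subproduct R S B\<^esub> z" if "p \<in> carrier (subproduct R S B)" for p
  proof -
    obtain x y where p: "p = (x, y)" by (cases p)
    then have B: "(x, y) \<in> B" using that by (simp add: subproduct_def)
    note c = in_carrier[OF B]
    show ?thesis
      by (rule bexI[of _ "(even_comp R x, even_comp S y)"], rule bexI[of _ "(odd_comp R x, odd_comp S y)"])
         (use R.decomposition[OF c(1)] S.decomposition[OF c(2)] even[OF B] odd[OF B] p
           in \<open>auto simp: subproduct_def\<close>)
  qed
  show "p = \<zero>\<^bsub>subproduct R S B\<^esub>"
    if "p \<in> even_part (subproduct R S B)" "p \<in> odd_part (subproduct R S B)" for p
    using that R.comp_even(1)[of "fst p"] R.comp_odd(1)[of "fst p"]
      S.comp_even(1)[of "snd p"] S.comp_odd(1)[of "snd p"]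
    by (auto simp: subproduct_def)
  show "p \<otimes>\<^bsub>subproduct R S B\<^esub> p' = p' \<otimes>\<^bsub>subproduct R S B\<^esub> p"
    if "p \<in> even_part (subproduct R S B)" "p' \<in> carrier (subproduct R S B)" for p p'
    using that R.even_central[of "fst p" "fst p'"] S.even_central[of "snd p" "snd p'"]
      in_carrier[of "fst p'" "snd p'"]
    by (auto simp: subproduct_def)
  show "p \<otimes>\<^bsub>subproduct R S B\<^esub> p' =
      (\<ominus>\<^bsub>K\<^esub> \<one>\<^bsub>K\<^esub>) \<odot>\<^bsub>subproduct R S B\<^esub> (p' \<otimes>\<^bsub>subproduct R S B\<^esub> p)"
    if "p \<in> odd_part (subproduct R S B)" "p' \<in> odd_part (subproduct R S B)" for p p'
    using that R.odd_anticomm[of "fst p" "fst p'"] S.odd_anticomm[of "snd p" "snd p'"]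
      R.odd_in_carrier S.odd_in_carrier
    by (auto simp: subproduct_def R.minus_smult S.minus_smult)
qed (use subset in \<open>auto simp: subproduct_def zero one add mult smult in_carrier
    R.even_closed R.odd_closed R.one_even S.even_closed S.odd_closed S.one_even
    R.smult_l_distr R.smult_r_distr R.smult_assoc1 R.A.l_distr R.A.r_distr R.A.m_assoc
    R.A.add.m_ac R.smult_mult_left R.smult_mult_right R.minus_smult R.A.l_neg R.A.r_neg
    S.smult_l_distr S.smult_r_distr S.smult_assoc1 S.A.l_distr S.A.r_distr S.A.m_assoc
    S.A.add.m_ac S.smult_mult_left S.smult_mult_right S.minus_smult S.A.l_neg S.A.r_neg
    R.even_even R.even_odd R.odd_even R.odd_odd S.even_even S.even_odd S.odd_even S.odd_odd\<close>)

end

text \<open>A bijection between the infinite universe and its square brings subalgebras of products back into the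
  universe.\<close>

lemma subproduct_universe:
  fixes R S :: "('k, 'u::infinite) superalg"
  assumes "subproduct_closed K R S B"
  obtains T :: "('k, 'u) superalg" and q p1 p2 where
    "superalgebra K T" "q \<in> salg_hom K (subproduct R S B) T" "q ` B = carrier T"
    "q ` (B \<inter> even_part R \<times> even_part S) = even_part T"
    "q ` (B \<inter> odd_part R \<times> odd_part S) = odd_part T"
    "inj_on q B"
    "p1 \<in> salg_hom K T R" "\<forall>x y. (x, y) \<in> B \<longrightarrow> p1 (q (x, y)) = x"
    "p2 \<in> salg_hom K T S" "\<forall>x y. (x, y) \<in> B \<longrightarrow> p2 (q (x, y)) = y"
proof -
  interpret subproduct_closed K R S B by fact
  let ?P = "subproduct R S B"
  interpret P: superalgebra K ?P by (rule superalgebra_subproduct)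
  obtain e :: "'u \<times> 'u \<Rightarrow> 'u" where "bij_betw e (UNIV \<times> UNIV) UNIV"
    using iffD2[OF card_of_ordIso card_of_Times_same_infinite[OF infinite_UNIV]] by blast
  then have inj: "inj e" by (simp add: bij_betw_def)
  have zero_superideal: "superideal {\<zero>\<^bsub>?P\<^esub>} ?P"
    using P.A.zeroideal P.comp_even[OF P.even_closed(1)] by (simp add: superideal_def)
  have ker: "e x = e y \<longleftrightarrow> x \<ominus>\<^bsub>?P\<^esub> y \<in> {\<zero>\<^bsub>?P\<^esub>}" if "x \<in> carrier ?P" "y \<in> carrier ?P" for x y
    using that by (simp add: inj_eq[OF inj])
  let ?T = "image_superalg ?P e"
  define q where "q = restrict e (carrier ?P)"
  note image = image_superalg[OF superalgebra_subproduct zero_superideal ker, folded q_def]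
  note T = image(1) and q = image(2) and im = image(3-5)
  have q_inj: "inj_on q (carrier ?P)"
    unfolding q_def inj_on_restrict_eq by (rule inj_on_subset[OF inj subset_UNIV])
  have ker0: "x = \<zero>\<^bsub>?P\<^esub>" if "x \<in> carrier ?P" "q x = \<zero>\<^bsub>?T\<^esub>" for x
  proof -
    have "e x = e \<zero>\<^bsub>?P\<^esub>" using that by (simp add: q_def image_superalg_def)
    then show ?thesis by (rule injD[OF inj])
  qed
  have hom1: "restrict fst B \<in> salg_hom K ?P R"
    by (rule salg_homI) (auto simp: subproduct_def in_carrier one add mult smult)
  have k1: "restrict fst B x = \<zero>\<^bsub>R\<^esub>" if "x \<in> carrier ?P" "q x = \<zero>\<^bsub>?T\<^esub>" for x
    using ker0[OF that] zero by (simp add: subproduct_def)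
  obtain p1 where p1: "p1 \<in> salg_hom K ?T R" "\<And>x. x \<in> carrier ?P \<Longrightarrow> p1 (q x) = restrict fst B x"
    using salg_hom_factor[OF superalgebra_subproduct R.superalgebra_axioms T q im hom1 k1] by blast
  have hom2: "restrict snd B \<in> salg_hom K ?P S"
    by (rule salg_homI) (auto simp: subproduct_def in_carrier one add mult smult)
  have k2: "restrict snd B x = \<zero>\<^bsub>S\<^esub>" if "x \<in> carrier ?P" "q x = \<zero>\<^bsub>?T\<^esub>" for x
    using ker0[OF that] zero by (simp add: subproduct_def)
  obtain p2 where p2: "p2 \<in> salg_hom K ?T S" "\<And>x. x \<in> carrier ?P \<Longrightarrow> p2 (q x) = restrict snd B x"
    using salg_hom_factor[OF superalgebra_subproduct S.superalgebra_axioms T q im hom2 k2] by blast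
  show thesis
    by (rule that[OF T q _ _ _ _ p1(1) _ p2(1)]) (use im q_inj p1(2) p2(2) in \<open>auto simp: subproduct_def\<close>)
qed

lemma pair_hom:
  assumes "subproduct_closed K R S B" "f \<in> salg_hom K A R" "g \<in> salg_hom K A S"
    and "superalgebra K A" "\<And>a. a \<in> carrier A \<Longrightarrow> (f a, g a) \<in> B"
  shows "(\<lambda>a\<in>carrier A. (f a, g a)) \<in> salg_hom K A (subproduct R S B)"
proof -
  interpret A: superalgebra K A by fact
  show ?thesis
    by (rule salg_homI)
       (auto simp: subproduct_def assms(5) salg_homD[OF assms(2)] salg_homD[OF assms(3)]
         A.even_in_carrier A.odd_in_carrier)
qed

section \<open>Linear functionals\<close>

definition linear_functional :: "('k, 'l) ring_scheme \<Rightarrow> ('k, 'a, 'm) module_scheme \<Rightarrow> ('a \<Rightarrow> 'k) \<Rightarrow> bool" where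
  "linear_functional K V \<phi> \<longleftrightarrow>
    (\<forall>x\<in>carrier V. \<phi> x \<in> carrier K) \<and>
    (\<forall>x\<in>carrier V. \<forall>y\<in>carrier V. \<phi> (x \<oplus>\<^bsub>V\<^esub> y) = \<phi> x \<oplus>\<^bsub>K\<^esub> \<phi> y) \<and>
    (\<forall>k\<in>carrier K. \<forall>x\<in>carrier V. \<phi> (k \<odot>\<^bsub>V\<^esub> x) = k \<otimes>\<^bsub>K\<^esub> \<phi> x)"

definition linear_map ::
    "('k, 'l) ring_scheme \<Rightarrow> ('k, 'a, 'm) module_scheme \<Rightarrow> ('k, 'b, 'n) module_scheme \<Rightarrow> 'b set \<Rightarrow>
     ('a \<Rightarrow> 'b) \<Rightarrow> bool" where
  "linear_map K V N W f \<longleftrightarrow>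
    (\<forall>x\<in>carrier V. f x \<in> W) \<and>
    (\<forall>x\<in>carrier V. \<forall>y\<in>carrier V. f (x \<oplus>\<^bsub>V\<^esub> y) = f x \<oplus>\<^bsub>N\<^esub> f y) \<and>
    (\<forall>k\<in>carrier K. \<forall>x\<in>carrier V. f (k \<odot>\<^bsub>V\<^esub> x) = k \<odot>\<^bsub>N\<^esub> f x)"

lemma linear_functionalD:
  assumes "linear_functional K V \<phi>"
  shows "x \<in> carrier V \<Longrightarrow> \<phi> x \<in> carrier K"
    "\<lbrakk>x \<in> carrier V; y \<in> carrier V\<rbrakk> \<Longrightarrow> \<phi> (x \<oplus>\<^bsub>V\<^esub> y) = \<phi> x \<oplus>\<^bsub>K\<^esub> \<phi> y"
    "\<lbrakk>k \<in> carrier K; x \<in> carrier V\<rbrakk> \<Longrightarrow> \<phi> (k \<odot>\<^bsub>V\<^esub> x) = k \<otimes>\<^bsub>K\<^esub> \<phi> x"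
  using assms by (auto simp: linear_functional_def)

lemma linear_mapD:
  assumes "linear_map K V N W f"
  shows "x \<in> carrier V \<Longrightarrow> f x \<in> W"
    "\<lbrakk>x \<in> carrier V; y \<in> carrier V\<rbrakk> \<Longrightarrow> f (x \<oplus>\<^bsub>V\<^esub> y) = f x \<oplus>\<^bsub>N\<^esub> f y"
    "\<lbrakk>k \<in> carrier K; x \<in> carrier V\<rbrakk> \<Longrightarrow> f (k \<odot>\<^bsub>V\<^esub> x) = k \<odot>\<^bsub>N\<^esub> f x"
  using assms by (auto simp: linear_map_def)

lemma linear_map_weaken:
  assumes "linear_map K V N W f" "W \<subseteq> W'"
  shows "linear_map K V N W' f"
  using assms by (auto simp: linear_map_def)

lemma submodule_chain_Union:
  assumes "module K V" "C \<noteq> {}" "\<And>U. U \<in> C \<Longrightarrow> submodule U K V" "\<And>U W. \<lbrakk>U \<in> C; W \<in> C\<rbrakk> \<Longrightarrow> U \<subseteq> W \<or> W \<subseteq> U"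
  shows "submodule (\<Union>C) K V"
proof -
  interpret module K V by fact
  note E = submoduleE[OF assms(3)]
  show ?thesis
  proof (rule submoduleI)
    show "\<Union>C \<subseteq> carrier V" using E(1) by blast
    obtain U where "U \<in> C" using assms(2) by blast
    then show "\<zero>\<^bsub>V\<^esub> \<in> \<Union>C"
      using assms(3) subgroup.one_closed[of U "add_monoid V"] by (auto simp: submodule_def)
    show "\<ominus>\<^bsub>V\<^esub> a \<in> \<Union>C" if "a \<in> \<Union>C" for a using that E(3) by blast
    show "k \<odot>\<^bsub>V\<^esub> a \<in> \<Union>C" if "k \<in> carrier K" "a \<in> \<Union>C" for k a using that E(4) by blast
    show "a \<oplus>\<^bsub>V\<^esub> b \<in> \<Union>C" if ab: "a \<in> \<Union>C" "b \<in> \<Union>C" for a b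
    proof -
      obtain U W where "U \<in> C" "W \<in> C" "a \<in> U" "b \<in> W" using ab by blast
      then show ?thesis using assms(4)[of U W] E(5) by blast
    qed
  qed
qed

text \<open>A submodule maximal among those avoiding \<open>v\<close> exists by Zorn, and it is a complement of the line
  through \<open>v\<close>; the functional is the projection to that line.\<close>

lemma separating_functional:
  assumes "field K" "module K V" and v: "v \<in> carrier V" "v \<noteq> \<zero>\<^bsub>V\<^esub>"
  shows "\<exists>\<phi>. linear_functional K V \<phi> \<and> \<phi> v \<noteq> \<zero>\<^bsub>K\<^esub>"
proof -
  interpret K: field K by fact
  interpret V: module K V by fact
  have minus_zero: "\<ominus>\<^bsub>V\<^esub> \<zero>\<^bsub>V\<^esub> = \<zero>\<^bsub>V\<^esub>" using V.M.r_neg[OF V.M.zero_closed] by simp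
  define S where "S = {U. submodule U K V \<and> v \<notin> U}"
  have "submodule {\<zero>\<^bsub>V\<^esub>} K V" by (rule V.submoduleI) auto
  then have "S \<noteq> {}" using v by (auto simp: S_def)
  moreover have "\<Union>C \<in> S" if "C \<noteq> {}" "subset.chain S C" for C
  proof -
    have C: "C \<subseteq> S" "\<And>U W. \<lbrakk>U \<in> C; W \<in> C\<rbrakk> \<Longrightarrow> U \<subseteq> W \<or> W \<subseteq> U"
      using that(2) by (auto simp: subset_chain_def)
    then have "submodule (\<Union>C) K V"
      using submodule_chain_Union[OF assms(2) that(1)] by (auto simp: S_def)
    then show ?thesis using C(1) by (auto simp: S_def)
  qed
  ultimately obtain U where U: "U \<in> S" and max: "\<And>W. \<lbrakk>W \<in> S; U \<subseteq> W\<rbrakk> \<Longrightarrow> W = U"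
    using subset_Zorn_nonempty[of S] by auto
  have sub: "submodule U K V" and vU: "v \<notin> U" using U by (auto simp: S_def)
  note UE = V.submoduleE[OF sub]
  have U0: "\<zero>\<^bsub>V\<^esub> \<in> U" using sub subgroup.one_closed[of U "add_monoid V"] by (auto simp: submodule_def)
  have unique: "k = m"
    if km: "k \<in> carrier K" "m \<in> carrier K" and x: "x \<in> carrier V"
      and "x \<ominus>\<^bsub>V\<^esub> k \<odot>\<^bsub>V\<^esub> v \<in> U" "x \<ominus>\<^bsub>V\<^esub> m \<odot>\<^bsub>V\<^esub> v \<in> U" for k m x
  proof (rule ccontr)
    assume "k \<noteq> m"
    let ?c = "k \<ominus>\<^bsub>K\<^esub> m"
    have c: "?c \<in> Units K" using km \<open>k \<noteq> m\<close> by (simp add: K.field_Units)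
    have "(x \<ominus>\<^bsub>V\<^esub> m \<odot>\<^bsub>V\<^esub> v) \<oplus>\<^bsub>V\<^esub> \<ominus>\<^bsub>V\<^esub> (x \<ominus>\<^bsub>V\<^esub> k \<odot>\<^bsub>V\<^esub> v) \<in> U" using that UE(3,5) by blast
    also have "(x \<ominus>\<^bsub>V\<^esub> m \<odot>\<^bsub>V\<^esub> v) \<oplus>\<^bsub>V\<^esub> \<ominus>\<^bsub>V\<^esub> (x \<ominus>\<^bsub>V\<^esub> k \<odot>\<^bsub>V\<^esub> v) = ?c \<odot>\<^bsub>V\<^esub> v"
    proof -
      have "(x \<ominus>\<^bsub>V\<^esub> m \<odot>\<^bsub>V\<^esub> v) \<oplus>\<^bsub>V\<^esub> \<ominus>\<^bsub>V\<^esub> (x \<ominus>\<^bsub>V\<^esub> k \<odot>\<^bsub>V\<^esub> v) =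
          (x \<oplus>\<^bsub>V\<^esub> \<ominus>\<^bsub>V\<^esub> x) \<oplus>\<^bsub>V\<^esub> (k \<odot>\<^bsub>V\<^esub> v \<oplus>\<^bsub>V\<^esub> \<ominus>\<^bsub>V\<^esub> (m \<odot>\<^bsub>V\<^esub> v))"
        using km x v(1) by (simp add: a_minus_def V.M.minus_add V.M.add.m_ac)
      then show ?thesis
        using km x v(1) by (simp add: a_minus_def V.M.r_neg V.smult_l_distr V.smult_l_minus)
    qed
    finally have "inv\<^bsub>K\<^esub> ?c \<odot>\<^bsub>V\<^esub> (?c \<odot>\<^bsub>V\<^esub> v) \<in> U" using UE(4) c by blast
    moreover have "inv\<^bsub>K\<^esub> ?c \<odot>\<^bsub>V\<^esub> (?c \<odot>\<^bsub>V\<^esub> v) = v"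
      using V.smult_assoc1[of "inv\<^bsub>K\<^esub> ?c" ?c v] c v(1) K.Units_closed[OF c] K.Units_inv_closed[OF c]
        K.Units_l_inv[OF c] by simp
    ultimately show False using vU by simp
  qed
  have ex: "\<exists>k\<in>carrier K. x \<ominus>\<^bsub>V\<^esub> k \<odot>\<^bsub>V\<^esub> v \<in> U" if x: "x \<in> carrier V" for x
  proof -
    \<comment> \<open>If \<open>x\<close> were independent of \<open>v\<close> modulo \<open>U\<close>, then \<open>U\<close> could be enlarged by the line through \<open>x\<close>.\<close>
    define W where "W = {u \<oplus>\<^bsub>V\<^esub> k \<odot>\<^bsub>V\<^esub> x | u k. u \<in> U \<and> k \<in> carrier K}"
    have WI: "y \<in> W" if "u \<in> U" "k \<in> carrier K" "y = u \<oplus>\<^bsub>V\<^esub> k \<odot>\<^bsub>V\<^esub> x" for y u k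
      using that by (auto simp: W_def)
    have Uc: "u \<in> carrier V" if "u \<in> U" for u using that UE(1) by blast
    have "submodule W K V"
    proof (rule V.submoduleI)
      show "W \<subseteq> carrier V" using Uc x by (auto simp: W_def)
      show "\<zero>\<^bsub>V\<^esub> \<in> W" by (rule WI[OF U0 K.zero_closed]) (simp add: x)
      fix a assume "a \<in> W"
      then obtain u k where uk: "u \<in> U" "k \<in> carrier K" "a = u \<oplus>\<^bsub>V\<^esub> k \<odot>\<^bsub>V\<^esub> x" by (auto simp: W_def)
      show "\<ominus>\<^bsub>V\<^esub> a \<in> W"
        by (rule WI[of "\<ominus>\<^bsub>V\<^esub> u" "\<ominus>\<^bsub>K\<^esub> k"])
           (use uk UE(3) Uc x in \<open>auto simp: V.M.minus_add V.smult_l_minus\<close>)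
      show "m \<odot>\<^bsub>V\<^esub> a \<in> W" if "m \<in> carrier K" for m
        by (rule WI[of "m \<odot>\<^bsub>V\<^esub> u" "m \<otimes>\<^bsub>K\<^esub> k"])
           (use that uk UE(4) Uc x in \<open>auto simp: V.smult_r_distr V.smult_assoc1\<close>)
      fix b assume "b \<in> W"
      then obtain u' k' where uk': "u' \<in> U" "k' \<in> carrier K" "b = u' \<oplus>\<^bsub>V\<^esub> k' \<odot>\<^bsub>V\<^esub> x" by (auto simp: W_def)
      show "a \<oplus>\<^bsub>V\<^esub> b \<in> W"
        by (rule WI[of "u \<oplus>\<^bsub>V\<^esub> u'" "k \<oplus>\<^bsub>K\<^esub> k'"])
           (use uk uk' UE(5) Uc x in \<open>auto simp: V.smult_l_distr V.M.add.m_ac\<close>)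
    qed
    moreover have "U \<subseteq> W"
      using Uc x by (auto intro!: WI[OF _ K.zero_closed])
    moreover have xW: "x \<in> W" by (rule WI[OF U0 K.one_closed]) (simp add: x)
    ultimately have "W = U \<or> v \<in> W" using max[of W] by (auto simp: S_def)
    then show ?thesis
    proof
      assume "W = U"
      then show ?thesis using xW x v(1) by (intro bexI[of _ "\<zero>\<^bsub>K\<^esub>"]) (auto simp: a_minus_def minus_zero)
    next
      assume "v \<in> W"
      then obtain u k where uk: "u \<in> U" "k \<in> carrier K" "v = u \<oplus>\<^bsub>V\<^esub> k \<odot>\<^bsub>V\<^esub> x" by (auto simp: W_def)
      have "k \<noteq> \<zero>\<^bsub>K\<^esub>" using uk vU x Uc by auto
      then have k: "k \<in> Units K" using uk(2) by (simp add: K.field_Units)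
      have "x \<oplus>\<^bsub>V\<^esub> \<ominus>\<^bsub>V\<^esub> (inv\<^bsub>K\<^esub> k \<odot>\<^bsub>V\<^esub> v) = \<ominus>\<^bsub>V\<^esub> (inv\<^bsub>K\<^esub> k \<odot>\<^bsub>V\<^esub> u)"
      proof -
        have "inv\<^bsub>K\<^esub> k \<odot>\<^bsub>V\<^esub> v = inv\<^bsub>K\<^esub> k \<odot>\<^bsub>V\<^esub> u \<oplus>\<^bsub>V\<^esub> x"
          using uk k x Uc by (simp add: V.smult_r_distr flip: V.smult_assoc1)
        then have "x \<oplus>\<^bsub>V\<^esub> \<ominus>\<^bsub>V\<^esub> (inv\<^bsub>K\<^esub> k \<odot>\<^bsub>V\<^esub> v) = \<ominus>\<^bsub>V\<^esub> (inv\<^bsub>K\<^esub> k \<odot>\<^bsub>V\<^esub> u) \<oplus>\<^bsub>V\<^esub> (x \<oplus>\<^bsub>V\<^esub> \<ominus>\<^bsub>V\<^esub> x)"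
          using k x Uc[OF uk(1)] by (simp add: V.M.minus_add V.M.add.m_ac)
        then show ?thesis using k x Uc[OF uk(1)] by (simp add: V.M.r_neg)
      qed
      also have "\<dots> \<in> U" using UE(3,4) uk k by blast
      finally show ?thesis using k by (intro bexI[of _ "inv\<^bsub>K\<^esub> k"]) (auto simp: a_minus_def)
    qed
  qed
  define \<phi> where "\<phi> x = (SOME k. k \<in> carrier K \<and> x \<ominus>\<^bsub>V\<^esub> k \<odot>\<^bsub>V\<^esub> v \<in> U)" for x
  have \<phi>: "\<phi> x \<in> carrier K" "x \<ominus>\<^bsub>V\<^esub> \<phi> x \<odot>\<^bsub>V\<^esub> v \<in> U" if "x \<in> carrier V" for x
    using someI_ex[of "\<lambda>k. k \<in> carrier K \<and> x \<ominus>\<^bsub>V\<^esub> k \<odot>\<^bsub>V\<^esub> v \<in> U"] ex[OF that] unfolding \<phi>_def by blast+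
  have "linear_functional K V \<phi>"
    unfolding linear_functional_def
  proof (intro conjI ballI)
    fix x assume x: "x \<in> carrier V"
    show "\<phi> x \<in> carrier K" using \<phi> x by blast
    show "\<phi> (x \<oplus>\<^bsub>V\<^esub> y) = \<phi> x \<oplus>\<^bsub>K\<^esub> \<phi> y" if y: "y \<in> carrier V" for y
    proof (rule unique[of _ _ "x \<oplus>\<^bsub>V\<^esub> y"])
      have "(x \<oplus>\<^bsub>V\<^esub> y) \<ominus>\<^bsub>V\<^esub> (\<phi> x \<oplus>\<^bsub>K\<^esub> \<phi> y) \<odot>\<^bsub>V\<^esub> v = (x \<ominus>\<^bsub>V\<^esub> \<phi> x \<odot>\<^bsub>V\<^esub> v) \<oplus>\<^bsub>V\<^esub> (y \<ominus>\<^bsub>V\<^esub> \<phi> y \<odot>\<^bsub>V\<^esub> v)"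
        using x y v(1) \<phi>(1) by (simp add: a_minus_def V.smult_l_distr V.M.minus_add V.M.add.m_ac)
      then show "(x \<oplus>\<^bsub>V\<^esub> y) \<ominus>\<^bsub>V\<^esub> (\<phi> x \<oplus>\<^bsub>K\<^esub> \<phi> y) \<odot>\<^bsub>V\<^esub> v \<in> U"
        using UE(5) \<phi>(2) x y by simp
    qed (use \<phi> x y in auto)
    show "\<phi> (k \<odot>\<^bsub>V\<^esub> x) = k \<otimes>\<^bsub>K\<^esub> \<phi> x" if k: "k \<in> carrier K" for k
    proof (rule unique[of _ _ "k \<odot>\<^bsub>V\<^esub> x"])
      have "k \<odot>\<^bsub>V\<^esub> x \<ominus>\<^bsub>V\<^esub> (k \<otimes>\<^bsub>K\<^esub> \<phi> x) \<odot>\<^bsub>V\<^esub> v = k \<odot>\<^bsub>V\<^esub> (x \<ominus>\<^bsub>V\<^esub> \<phi> x \<odot>\<^bsub>V\<^esub> v)"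
        using x k v(1) \<phi>(1) by (simp add: a_minus_def V.smult_r_distr V.smult_assoc1 V.smult_r_minus)
      then show "k \<odot>\<^bsub>V\<^esub> x \<ominus>\<^bsub>V\<^esub> (k \<otimes>\<^bsub>K\<^esub> \<phi> x) \<odot>\<^bsub>V\<^esub> v \<in> U"
        using UE(4) \<phi>(2) x k by simp
    qed (use \<phi> x k in auto)
  qed
  moreover have "\<phi> v \<noteq> \<zero>\<^bsub>K\<^esub>"
  proof
    assume "\<phi> v = \<zero>\<^bsub>K\<^esub>"
    then show False using \<phi>(2)[OF v(1)] v(1) vU by (simp add: a_minus_def minus_zero)
  qed
  ultimately show ?thesis by blast
qed

text \<open>Induction on the list. If the first functional takes the value 1 at a point \<open>a\<close> of the common kernel of the
  others, then its coefficient must be \<open>d a\<close>, and subtracting that term leaves a map that vanishes on the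
  common kernel of the others. If it vanishes on that kernel, it can be given the coefficient 0.\<close>

lemma functional_expansion:
  assumes "field K" "module K V" "module K N" "submodule W K N"
    and "\<And>i. i \<in> set is \<Longrightarrow> linear_functional K V (f i)" "distinct is"
    and "linear_map K V N W d"
    and "\<And>x. \<lbrakk>x \<in> carrier V; \<forall>i\<in>set is. f i x = \<zero>\<^bsub>K\<^esub>\<rbrakk> \<Longrightarrow> d x = \<zero>\<^bsub>N\<^esub>"
  shows "\<exists>j. (\<forall>i. j i \<in> W) \<and>
    (\<forall>x\<in>carrier V. d x = foldr (\<lambda>i s. f i x \<odot>\<^bsub>N\<^esub> j i \<oplus>\<^bsub>N\<^esub> s) is \<zero>\<^bsub>N\<^esub>)"
proof -
  interpret K: field K by fact
  interpret V: module K V by fact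
  interpret N: module K N by fact
  note W = N.submoduleE[OF assms(4)]
  have W0: "\<zero>\<^bsub>N\<^esub> \<in> W" using assms(4) subgroup.one_closed[of W "add_monoid N"] by (auto simp: submodule_def)
  have Wc: "w \<in> carrier N" if "w \<in> W" for w using that W(1) by blast
  from assms(5-8) show ?thesis
  proof (induction "is" arbitrary: d)
    case Nil
    then show ?case using W0 by auto
  next
    case (Cons i "is")
    note fi = linear_functionalD[OF Cons.prems(1)[of i]]
    note f = linear_functionalD[OF Cons.prems(1)]
    note d = linear_mapD[OF Cons.prems(3)]
    have fcong: "foldr (\<lambda>i s. f i x \<odot>\<^bsub>N\<^esub> (j(i' := w)) i \<oplus>\<^bsub>N\<^esub> s) is \<zero>\<^bsub>N\<^esub> =
        foldr (\<lambda>i s. f i x \<odot>\<^bsub>N\<^esub> j i \<oplus>\<^bsub>N\<^esub> s) is \<zero>\<^bsub>N\<^esub>" if "i' \<notin> set is" for j i' w x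
      using that by (intro foldr_cong) auto
    have i: "i \<notin> set is" using Cons.prems(2) by simp
    show ?case
    proof (cases "\<forall>x\<in>carrier V. (\<forall>i\<in>set is. f i x = \<zero>\<^bsub>K\<^esub>) \<longrightarrow> f i x = \<zero>\<^bsub>K\<^esub>")
      case True
      have "\<exists>j. (\<forall>i. j i \<in> W) \<and> (\<forall>x\<in>carrier V. d x = foldr (\<lambda>i s. f i x \<odot>\<^bsub>N\<^esub> j i \<oplus>\<^bsub>N\<^esub> s) is \<zero>\<^bsub>N\<^esub>)"
        using True by (intro Cons.IH) (use Cons.prems in auto)
      then obtain j where j: "\<forall>i. j i \<in> W"
        "\<forall>x\<in>carrier V. d x = foldr (\<lambda>i s. f i x \<odot>\<^bsub>N\<^esub> j i \<oplus>\<^bsub>N\<^esub> s) is \<zero>\<^bsub>N\<^esub>" by blast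
      have "d x = foldr (\<lambda>i' s. f i' x \<odot>\<^bsub>N\<^esub> (j(i := \<zero>\<^bsub>N\<^esub>)) i' \<oplus>\<^bsub>N\<^esub> s) (i # is) \<zero>\<^bsub>N\<^esub>"
        if x: "x \<in> carrier V" for x
        using j(2)[rule_format, OF x] d(1)[OF x] Wc fi(1)[OF _ x] fcong[OF i] by simp
      then show ?thesis using j(1) W0 by (intro exI[of _ "j(i := \<zero>\<^bsub>N\<^esub>)"]) auto
    next
      case False
      then obtain a0 where a0: "a0 \<in> carrier V" "\<forall>i\<in>set is. f i a0 = \<zero>\<^bsub>K\<^esub>" "f i a0 \<noteq> \<zero>\<^bsub>K\<^esub>" by blast
      have un: "f i a0 \<in> Units K" using a0 fi(1) by (simp add: K.field_Units)
      define a where "a = inv\<^bsub>K\<^esub> (f i a0) \<odot>\<^bsub>V\<^esub> a0"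
      have a: "a \<in> carrier V" "\<forall>i\<in>set is. f i a = \<zero>\<^bsub>K\<^esub>" "f i a = \<one>\<^bsub>K\<^esub>"
        using a0 un f(3) by (auto simp: a_def)
      define d' where "d' x = d x \<oplus>\<^bsub>N\<^esub> \<ominus>\<^bsub>N\<^esub> (f i x \<odot>\<^bsub>N\<^esub> d a)" for x
      have fi': "f i x \<in> carrier K" if "x \<in> carrier V" for x using fi(1) that by simp
      note c = Wc[OF d(1)] Wc[OF d(1)[OF a(1)]]
      have "linear_map K V N W d'"
        unfolding linear_map_def
      proof (intro conjI ballI)
        fix x assume x: "x \<in> carrier V"
        show "d' x \<in> W" using x d(1) a(1) W fi' by (simp add: d'_def)
        show "d' (x \<oplus>\<^bsub>V\<^esub> y) = d' x \<oplus>\<^bsub>N\<^esub> d' y" if "y \<in> carrier V" for y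
          using x that c fi' by (simp add: d'_def d(2) fi(2) N.smult_l_distr N.M.minus_add N.M.add.m_ac)
        show "d' (k \<odot>\<^bsub>V\<^esub> x) = k \<odot>\<^bsub>N\<^esub> d' x" if "k \<in> carrier K" for k
          using x that c fi' by (simp add: d'_def d(3) fi(3) N.smult_r_distr N.smult_assoc1 N.smult_r_minus)
      qed
      moreover have "d' x = \<zero>\<^bsub>N\<^esub>" if x: "x \<in> carrier V" "\<forall>i\<in>set is. f i x = \<zero>\<^bsub>K\<^esub>" for x
      proof -
        let ?y = "x \<oplus>\<^bsub>V\<^esub> (\<ominus>\<^bsub>K\<^esub> (f i x)) \<odot>\<^bsub>V\<^esub> a"
        have "f i' ?y = \<zero>\<^bsub>K\<^esub>" if "i' \<in> set (i # is)" for i'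
          using that a x f(2,3)[OF that] fi' by (auto simp: K.r_neg)
        then have "d ?y = \<zero>\<^bsub>N\<^esub>" using Cons.prems(4)[of ?y] x a fi' by simp
        then show ?thesis using x a fi' d(2,3) c by (simp add: d'_def N.smult_l_minus)
      qed
      ultimately have "\<exists>j. (\<forall>i. j i \<in> W) \<and> (\<forall>x\<in>carrier V. d' x = foldr (\<lambda>i s. f i x \<odot>\<^bsub>N\<^esub> j i \<oplus>\<^bsub>N\<^esub> s) is \<zero>\<^bsub>N\<^esub>)"
        by (intro Cons.IH) (use Cons.prems in auto)
      then obtain j where j: "\<forall>i. j i \<in> W"
        "\<forall>x\<in>carrier V. d' x = foldr (\<lambda>i s. f i x \<odot>\<^bsub>N\<^esub> j i \<oplus>\<^bsub>N\<^esub> s) is \<zero>\<^bsub>N\<^esub>" by blast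
      have "d x = foldr (\<lambda>i' s. f i' x \<odot>\<^bsub>N\<^esub> (j(i := d a)) i' \<oplus>\<^bsub>N\<^esub> s) (i # is) \<zero>\<^bsub>N\<^esub>"
        if x: "x \<in> carrier V" for x
      proof -
        have "d x = f i x \<odot>\<^bsub>N\<^esub> d a \<oplus>\<^bsub>N\<^esub> d' x"
          using x c fi' by (simp add: d'_def N.M.a_lcomm[of "f i x \<odot>\<^bsub>N\<^esub> d a" "d x"] N.M.r_neg)
        then show ?thesis using j(2)[rule_format, OF x] fcong[OF i] by simp
      qed
      then show ?thesis using j(1) d(1)[OF a(1)] by (intro exI[of _ "j(i := d a)"]) auto
    qed
  qed
qed

section \<open>The topology of A and the groups of continuous morphisms\<close>

locale pro_represented_group =
  group_functor K X + strictly_pro_represented K X A \<epsilon> \<theta>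
  for K :: "'u::infinite ring" and X :: "('u, 'x) k_group_functor"
    and A :: "('u, 'a) superalg" and \<epsilon> :: "'a \<Rightarrow> 'u"
    and \<theta> :: "('u, 'u) superalg \<Rightarrow> 'x \<Rightarrow> 'a \<Rightarrow> 'u"
begin

abbreviation G :: "('u, 'u) superalg" where "G \<equiv> ground_superalg K"
abbreviation Mpow :: "nat \<Rightarrow> 'a set" where "Mpow \<equiv> ideal_power A (\<MM> A)"
abbreviation H :: "('u, 'u) superalg \<Rightarrow> ('a \<Rightarrow> 'u) set" where "H \<equiv> continuous_salg_hom K A"

lemma superalgebra_A: "superalgebra K A" ..

lemma superalgebra_G: "superalgebra K G"
  by (rule superalgebra_ground) (rule K.field_axioms)

lemma eps [simp]:
  "x \<in> carrier A \<Longrightarrow> \<epsilon> x \<in> carrier K"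
  "\<lbrakk>x \<in> carrier A; y \<in> carrier A\<rbrakk> \<Longrightarrow> \<epsilon> (x \<oplus>\<^bsub>A\<^esub> y) = \<epsilon> x \<oplus>\<^bsub>K\<^esub> \<epsilon> y"
  "\<lbrakk>x \<in> carrier A; y \<in> carrier A\<rbrakk> \<Longrightarrow> \<epsilon> (x \<otimes>\<^bsub>A\<^esub> y) = \<epsilon> x \<otimes>\<^bsub>K\<^esub> \<epsilon> y"
  "\<lbrakk>k \<in> carrier K; x \<in> carrier A\<rbrakk> \<Longrightarrow> \<epsilon> (k \<odot>\<^bsub>A\<^esub> x) = k \<otimes>\<^bsub>K\<^esub> \<epsilon> x"
  "\<epsilon> \<one>\<^bsub>A\<^esub> = \<one>\<^bsub>K\<^esub>" "\<epsilon> \<zero>\<^bsub>A\<^esub> = \<zero>\<^bsub>K\<^esub>"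
  "x \<in> odd_part A \<Longrightarrow> \<epsilon> x = \<zero>\<^bsub>K\<^esub>"
  using salg_homD[OF augmentation_hom] salg_hom_minus(1)[OF superalgebra_A superalgebra_G augmentation_hom]
  by auto

lemma M_iff: "a \<in> \<MM> A \<longleftrightarrow> a \<in> carrier A \<and> \<epsilon> a = \<zero>\<^bsub>K\<^esub>"
  using augmentation_kernel by (auto simp: a_kernel_def')

lemma ideal_M: "ideal (\<MM> A) A"
proof -
  interpret G: superalgebra K G by (rule superalgebra_G)
  have "ring_hom_ring A G \<epsilon>"
    using augmentation_hom
    by (intro ring_hom_ringI2 A.ring_axioms G.A.ring_axioms) (simp add: salg_hom_def)
  then show ?thesis
    using ring_hom_ring.kernel_is_ideal augmentation_kernel by metis
qed

lemma Mpow_ideal: "ideal (Mpow n) A"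
  by (rule ideal_power_ideal[OF A.ring_axioms ideal_M])

lemma Mpow_carrier: "a \<in> Mpow n \<Longrightarrow> a \<in> carrier A"
  using ideal.Icarr[OF Mpow_ideal] .

lemma Mpow_le_M:
  assumes "n \<ge> 1" "a \<in> Mpow n"
  shows "a \<in> \<MM> A"
proof -
  have "Mpow n \<subseteq> Mpow 1" using ideal_power_antimono[OF A.ring_axioms ideal_M assms(1)] .
  also have "\<dots> \<subseteq> \<MM> A" using A.ideal_prod_inter[OF A.oneideal ideal_M] by simp
  finally show ?thesis using assms(2) by blast
qed

lemma minus_eps_in_M:
  assumes "a \<in> carrier A"
  shows "a \<ominus>\<^bsub>A\<^esub> \<epsilon> a \<odot>\<^bsub>A\<^esub> \<one>\<^bsub>A\<^esub> \<in> \<MM> A"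
proof -
  let ?m = "a \<ominus>\<^bsub>A\<^esub> \<epsilon> a \<odot>\<^bsub>A\<^esub> \<one>\<^bsub>A\<^esub>"
  have m: "?m \<in> carrier A" using assms by simp
  have "?m \<oplus>\<^bsub>A\<^esub> \<epsilon> a \<odot>\<^bsub>A\<^esub> \<one>\<^bsub>A\<^esub> = a"
    using assms by (simp add: a_minus_def A.a_assoc A.l_neg)
  then have "\<epsilon> ?m \<oplus>\<^bsub>K\<^esub> \<epsilon> a = \<epsilon> a"
    using eps(2)[OF m, of "\<epsilon> a \<odot>\<^bsub>A\<^esub> \<one>\<^bsub>A\<^esub>"] assms by simp
  then show ?thesis using m assms by (simp add: M_iff)
qed

text \<open>A continuous additive map to a discrete group pulls back the zero to an open set, which contains a power
  of \<open>\<MM>\<close>; conversely, the fibres are unions of cosets of such a power.\<close>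

lemma continuous_iff:
  assumes B: "abelian_group B" and f: "\<And>x. x \<in> carrier A \<Longrightarrow> f x \<in> carrier B"
    and add: "\<And>x y. \<lbrakk>x \<in> carrier A; y \<in> carrier A\<rbrakk> \<Longrightarrow> f (x \<oplus>\<^bsub>A\<^esub> y) = f x \<oplus>\<^bsub>B\<^esub> f y"
  shows "continuous_map (max_adic A) (discrete_topology (carrier B)) f \<longleftrightarrow>
    (\<exists>n. \<forall>y\<in>Mpow n. f y = \<zero>\<^bsub>B\<^esub>)"
proof -
  interpret B: abelian_group B by (rule B)
  note opn = openin_adic_topology[OF A.ring_axioms ideal_M]
  have space: "topspace (max_adic A) = carrier A"
  proof
    have "openin (max_adic A) (carrier A)"
      unfolding opn using Mpow_carrier by auto
    then show "carrier A \<subseteq> topspace (max_adic A)" by (rule openin_subset)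
    show "topspace (max_adic A) \<subseteq> carrier A"
      using openin_topspace[of "max_adic A"] unfolding opn by blast
  qed
  have f0: "f \<zero>\<^bsub>A\<^esub> = \<zero>\<^bsub>B\<^esub>"
    using add[of "\<zero>\<^bsub>A\<^esub>" "\<zero>\<^bsub>A\<^esub>"] f[of "\<zero>\<^bsub>A\<^esub>"] by simp
  show ?thesis
  proof
    assume "continuous_map (max_adic A) (discrete_topology (carrier B)) f"
    then have "openin (max_adic A) {x \<in> carrier A. f x \<in> {\<zero>\<^bsub>B\<^esub>}}"
      unfolding continuous_map_def space by (elim conjE allE[of _ "{\<zero>\<^bsub>B\<^esub>}"]) simp
    then obtain n where "\<forall>y\<in>Mpow n. \<zero>\<^bsub>A\<^esub> \<oplus>\<^bsub>A\<^esub> y \<in> {x \<in> carrier A. f x \<in> {\<zero>\<^bsub>B\<^esub>}}"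
      unfolding opn using f0 by auto
    then show "\<exists>n. \<forall>y\<in>Mpow n. f y = \<zero>\<^bsub>B\<^esub>"
      using Mpow_carrier by (intro exI[of _ n]) auto
  next
    assume "\<exists>n. \<forall>y\<in>Mpow n. f y = \<zero>\<^bsub>B\<^esub>"
    then obtain n where n: "\<forall>y\<in>Mpow n. f y = \<zero>\<^bsub>B\<^esub>" ..
    have "openin (max_adic A) {x \<in> carrier A. f x \<in> U}" for U
      unfolding opn
    proof (intro conjI ballI exI[of _ n])
      fix x y assume "x \<in> {x \<in> carrier A. f x \<in> U}" "y \<in> Mpow n"
      then show "x \<oplus>\<^bsub>A\<^esub> y \<in> {x \<in> carrier A. f x \<in> U}"
        using n f by (simp add: Mpow_carrier add)
    qed auto
    then show "continuous_map (max_adic A) (discrete_topology (carrier B)) f"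
      unfolding continuous_map_def space using f by simp
  qed
qed

lemma H_iff:
  assumes "superalgebra K R"
  shows "f \<in> H R \<longleftrightarrow> f \<in> salg_hom K A R \<and> (\<exists>n. \<forall>y\<in>Mpow n. f y = \<zero>\<^bsub>R\<^esub>)"
proof -
  interpret R: superalgebra K R by fact
  have "continuous_map (max_adic A) (discrete_topology (carrier R)) f \<longleftrightarrow>
      (\<exists>n. \<forall>y\<in>Mpow n. f y = \<zero>\<^bsub>R\<^esub>)" if "f \<in> salg_hom K A R"
    using salg_homD(1,3)[OF that] by (rule continuous_iff[OF R.A.is_abelian_group])
  then show ?thesis
    unfolding continuous_salg_hom_def by blast
qed

lemma H_hom: "f \<in> H R \<Longrightarrow> f \<in> salg_hom K A R"
  by (simp add: continuous_salg_hom_def)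

lemma H_compose:
  assumes "superalgebra K R" "superalgebra K S" "f \<in> H R" "h \<in> salg_hom K R S"
  shows "compose (carrier A) h f \<in> H S"
proof -
  obtain n where f: "f \<in> salg_hom K A R" and n: "\<forall>y\<in>Mpow n. f y = \<zero>\<^bsub>R\<^esub>"
    using assms(3) by (auto simp: H_iff[OF assms(1)])
  have "\<forall>y\<in>Mpow n. compose (carrier A) h f y = \<zero>\<^bsub>S\<^esub>"
    using n salg_hom_minus(1)[OF assms(1,2,4)] by (simp add: compose_def Mpow_carrier)
  then show ?thesis
    using salg_hom_compose[OF superalgebra_A f assms(4)] H_iff[OF assms(2)] by blast
qed

text \<open>A continuous morphism to the field \<open>K\<close> kills \<open>\<MM>\<close>: an element of \<open>\<MM>\<close> with nonzero value could be scaled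
  to value 1, and its powers would have value 1 in every \<open>\<MM>\<^sup>k\<close>. Since \<open>A = K + \<MM>\<close>, the morphism is \<open>\<epsilon>\<close>.\<close>

lemma augmentation_unique:
  assumes "f \<in> H G"
  shows "f = \<epsilon>"
proof -
  have f: "f \<in> salg_hom K A G" using assms by (rule H_hom)
  note fD = salg_homD[OF f, simplified]
  obtain n where n: "\<forall>y\<in>Mpow n. f y = \<zero>\<^bsub>K\<^esub>"
    using assms superalgebra_G by (auto simp: H_iff)
  have M: "f m = \<zero>\<^bsub>K\<^esub>" if m: "m \<in> \<MM> A" for m
  proof (rule ccontr)
    assume nz: "f m \<noteq> \<zero>\<^bsub>K\<^esub>"
    have mA: "m \<in> carrier A" using m by (simp add: M_iff)
    have unit: "f m \<in> Units K" using nz fD(1)[OF mA] by (simp add: K.field_Units)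
    define w where "w = inv\<^bsub>K\<^esub> (f m) \<odot>\<^bsub>A\<^esub> m"
    have w: "w \<in> \<MM> A" "f w = \<one>\<^bsub>K\<^esub>" "w \<in> carrier A"
      using m mA unit fD(6)[of "inv\<^bsub>K\<^esub> (f m)" m] by (simp_all add: w_def M_iff)
    have "\<exists>y\<in>Mpow k. f y = \<one>\<^bsub>K\<^esub>" for k
    proof (induction k)
      case 0
      then show ?case using fD(5) by auto
    next
      case (Suc k)
      then obtain y where y: "y \<in> Mpow k" "f y = \<one>\<^bsub>K\<^esub>" by blast
      have "y \<otimes>\<^bsub>A\<^esub> w \<in> Mpow (Suc k)" using y w by (auto intro: ideal_prod.prod)
      moreover have "f (y \<otimes>\<^bsub>A\<^esub> w) = \<one>\<^bsub>K\<^esub>"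
        using fD(4)[OF Mpow_carrier[OF y(1)] w(3)] y w by simp
      ultimately show ?case by blast
    qed
    then show False using n by fastforce
  qed
  show ?thesis
  proof (rule salg_hom_eqI[OF f augmentation_hom])
    fix a assume a: "a \<in> carrier A"
    let ?m = "a \<ominus>\<^bsub>A\<^esub> \<epsilon> a \<odot>\<^bsub>A\<^esub> \<one>\<^bsub>A\<^esub>"
    have m: "?m \<in> \<MM> A" using a by (rule minus_eps_in_M)
    have "a = ?m \<oplus>\<^bsub>A\<^esub> \<epsilon> a \<odot>\<^bsub>A\<^esub> \<one>\<^bsub>A\<^esub>"
      using a by (simp add: a_minus_def A.a_assoc A.l_neg)
    then have "f a = f ?m \<oplus>\<^bsub>K\<^esub> f (\<epsilon> a \<odot>\<^bsub>A\<^esub> \<one>\<^bsub>A\<^esub>)"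
      using fD(3)[of ?m "\<epsilon> a \<odot>\<^bsub>A\<^esub> \<one>\<^bsub>A\<^esub>"] m a by (simp add: M_iff)
    also have "\<dots> = \<epsilon> a" using M[OF m] fD(6)[of "\<epsilon> a" "\<one>\<^bsub>A\<^esub>"] fD(5) a by simp
    finally show "f a = \<epsilon> a" .
  qed
qed

lemma M_Mpow1: "m \<in> \<MM> A \<Longrightarrow> m \<in> Mpow 1"
  using ideal_prod.prod[of "\<one>\<^bsub>A\<^esub>" "carrier A" m "\<MM> A" A] by (simp add: M_iff)

text \<open>Subtracting the scalar parts reduces the Leibniz rule to elements of \<open>\<MM>\<close>, where both sides vanish.\<close>

lemma derivation_mult:
  assumes "module K N" "linear_map K A N (carrier N) d" "d \<one>\<^bsub>A\<^esub> = \<zero>\<^bsub>N\<^esub>"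
    and kills: "\<And>a b. \<lbrakk>a \<in> \<MM> A; b \<in> \<MM> A\<rbrakk> \<Longrightarrow> d (a \<otimes>\<^bsub>A\<^esub> b) = \<zero>\<^bsub>N\<^esub>"
    and ab: "a \<in> carrier A" "b \<in> carrier A"
  shows "d (a \<otimes>\<^bsub>A\<^esub> b) = \<epsilon> a \<odot>\<^bsub>N\<^esub> d b \<oplus>\<^bsub>N\<^esub> \<epsilon> b \<odot>\<^bsub>N\<^esub> d a"
proof -
  interpret N: module K N by fact
  note d = linear_mapD[OF assms(2)] assms(3) kills
  define m where "m c = c \<ominus>\<^bsub>A\<^esub> \<epsilon> c \<odot>\<^bsub>A\<^esub> \<one>\<^bsub>A\<^esub>" for c
  have m: "m c \<in> \<MM> A" "m c \<in> carrier A" "c = m c \<oplus>\<^bsub>A\<^esub> \<epsilon> c \<odot>\<^bsub>A\<^esub> \<one>\<^bsub>A\<^esub>" "d c = d (m c)"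
    if "c \<in> carrier A" for c
  proof -
    show 1: "m c \<in> \<MM> A" unfolding m_def using that by (rule minus_eps_in_M)
    then show 2: "m c \<in> carrier A" by (simp add: M_iff)
    show 3: "c = m c \<oplus>\<^bsub>A\<^esub> \<epsilon> c \<odot>\<^bsub>A\<^esub> \<one>\<^bsub>A\<^esub>"
      using that by (simp add: m_def a_minus_def A.a_assoc A.l_neg)
    have "d c = d (m c \<oplus>\<^bsub>A\<^esub> \<epsilon> c \<odot>\<^bsub>A\<^esub> \<one>\<^bsub>A\<^esub>)" using 3 by simp
    then show "d c = d (m c)" using that 2 d(1)[OF 2] d(2,3,4) by simp
  qed
  note ma = m[OF ab(1)] and mb = m[OF ab(2)]
  have "\<epsilon> b \<odot>\<^bsub>A\<^esub> (\<epsilon> a \<odot>\<^bsub>A\<^esub> \<one>\<^bsub>A\<^esub>) = \<epsilon> a \<odot>\<^bsub>A\<^esub> (\<epsilon> b \<odot>\<^bsub>A\<^esub> \<one>\<^bsub>A\<^esub>)"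
    using ab by (simp flip: smult_assoc1 add: K.m_comm)
  note scalars = this
  have "a \<otimes>\<^bsub>A\<^esub> b = (m a \<oplus>\<^bsub>A\<^esub> \<epsilon> a \<odot>\<^bsub>A\<^esub> \<one>\<^bsub>A\<^esub>) \<otimes>\<^bsub>A\<^esub> (m b \<oplus>\<^bsub>A\<^esub> \<epsilon> b \<odot>\<^bsub>A\<^esub> \<one>\<^bsub>A\<^esub>)"
    using ma(3) mb(3) by simp
  also have "\<dots> = m a \<otimes>\<^bsub>A\<^esub> m b \<oplus>\<^bsub>A\<^esub> (\<epsilon> b \<odot>\<^bsub>A\<^esub> m a \<oplus>\<^bsub>A\<^esub> (\<epsilon> a \<odot>\<^bsub>A\<^esub> m b \<oplus>\<^bsub>A\<^esub> \<epsilon> a \<odot>\<^bsub>A\<^esub> (\<epsilon> b \<odot>\<^bsub>A\<^esub> \<one>\<^bsub>A\<^esub>)))"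
    using ma(2) mb(2) ab
    by (simp add: A.l_distr A.r_distr smult_mult_left smult_mult_right smult_r_distr A.add.m_ac scalars)
  finally have "d (a \<otimes>\<^bsub>A\<^esub> b) = \<epsilon> b \<odot>\<^bsub>N\<^esub> d (m a) \<oplus>\<^bsub>N\<^esub> \<epsilon> a \<odot>\<^bsub>N\<^esub> d (m b)"
    using ma(1,2) mb(1,2) ab d(1)[OF ma(2)] d(1)[OF mb(2)] by (simp add: d(2-5))
  then show ?thesis
    using ma(2,4) mb(2,4) ab d(1)[OF ma(2)] d(1)[OF mb(2)] by (simp add: N.M.a_comm)
qed

lemma derivation_Mpow2:
  assumes "module K N" "linear_map K A N (carrier N) d" "d \<one>\<^bsub>A\<^esub> = \<zero>\<^bsub>N\<^esub>"
    and kills: "\<And>a b. \<lbrakk>a \<in> \<MM> A; b \<in> \<MM> A\<rbrakk> \<Longrightarrow> d (a \<otimes>\<^bsub>A\<^esub> b) = \<zero>\<^bsub>N\<^esub>"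
    and y: "y \<in> Mpow (Suc 1)"
  shows "d y = \<zero>\<^bsub>N\<^esub>"
proof -
  interpret N: module K N by fact
  have "d y = \<zero>\<^bsub>N\<^esub>" if "y \<in> ideal_prod A (Mpow 1) (\<MM> A)" for y
    using that
  proof (induction y rule: ideal_prod.induct)
    case (prod i j)
    then show ?case using kills Mpow_le_M[of 1 i] by auto
  next
    case (sum s1 s2)
    have "s1 \<in> carrier A" "s2 \<in> carrier A"
      using sum Mpow_carrier[of _ "Suc 1"] by simp_all
    then show ?case using sum linear_mapD(2)[OF assms(2)] by simp
  qed
  then show ?thesis using y by simp
qed

definition pt :: "('u, 'u) superalg \<Rightarrow> ('a \<Rightarrow> 'u) \<Rightarrow> 'x" where
  "pt R = inv_into (carrier (points X R)) (\<theta> R)"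

text \<open>The group law of \<open>X(R)\<close>, carried over to morphisms: the convolution product of the Hopf structure of \<open>A\<close>.\<close>

definition conv :: "('u, 'u) superalg \<Rightarrow> ('a \<Rightarrow> 'u) \<Rightarrow> ('a \<Rightarrow> 'u) \<Rightarrow> 'a \<Rightarrow> 'u" where
  "conv R f g = \<theta> R (pt R f \<otimes>\<^bsub>points X R\<^esub> pt R g)"

definition unit :: "('u, 'u) superalg \<Rightarrow> 'a \<Rightarrow> 'u" where
  "unit R = (\<lambda>a\<in>carrier A. \<epsilon> a \<odot>\<^bsub>R\<^esub> \<one>\<^bsub>R\<^esub>)"

lemma pt:
  assumes "superalgebra K R"
  shows "f \<in> H R \<Longrightarrow> pt R f \<in> carrier (points X R)"
    and "f \<in> H R \<Longrightarrow> \<theta> R (pt R f) = f"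
    and "x \<in> carrier (points X R) \<Longrightarrow> pt R (\<theta> R x) = x"
    and "x \<in> carrier (points X R) \<Longrightarrow> \<theta> R x \<in> H R"
  using theta_bij[OF assms] unfolding pt_def
  by (auto simp: bij_betw_def inv_into_into f_inv_into_f inv_into_f_f)

lemma conv_closed:
  assumes "superalgebra K R" "f \<in> H R" "g \<in> H R"
  shows "conv R f g \<in> H R" "pt R (conv R f g) = pt R f \<otimes>\<^bsub>points X R\<^esub> pt R g"
proof -
  interpret group "points X R" by (rule group_points[OF assms(1)])
  show "conv R f g \<in> H R" "pt R (conv R f g) = pt R f \<otimes>\<^bsub>points X R\<^esub> pt R g"
    using pt[OF assms(1)] assms by (simp_all add: conv_def)
qed

lemma conv_assoc:
  assumes "superalgebra K R" "f \<in> H R" "g \<in> H R" "h \<in> H R"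
  shows "conv R (conv R f g) h = conv R f (conv R g h)"
proof -
  interpret group "points X R" by (rule group_points[OF assms(1)])
  have "pt R f \<otimes>\<^bsub>points X R\<^esub> pt R g \<otimes>\<^bsub>points X R\<^esub> pt R h =
      pt R f \<otimes>\<^bsub>points X R\<^esub> (pt R g \<otimes>\<^bsub>points X R\<^esub> pt R h)"
    using assms pt(1)[OF assms(1)] by (intro m_assoc)
  then show ?thesis
    using assms conv_closed(2) by (simp add: conv_def[of R "conv R f g"] conv_def[of R f "conv R g h"])
qed

lemma conv_natural:
  assumes "superalgebra K R" "superalgebra K S" "h \<in> salg_hom K R S" "f \<in> H R" "g \<in> H R"
  shows "compose (carrier A) h (conv R f g) = conv S (compose (carrier A) h f) (compose (carrier A) h g)"
proof -
  interpret R: group "points X R" by (rule group_points[OF assms(1)])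
  interpret S: group "points X S" by (rule group_points[OF assms(2)])
  note ind = induced_hom[OF assms(1-3)]
  have c: "pt R f \<in> carrier (points X R)" "pt R g \<in> carrier (points X R)"
    using pt(1)[OF assms(1)] assms by auto
  have i: "induced X R S h x \<in> carrier (points X S)"
    "pt S (compose (carrier A) h (\<theta> R x)) = induced X R S h x" if "x \<in> carrier (points X R)" for x
    using hom_in_carrier[OF ind that] pt(3)[OF assms(2)] theta_natural[OF assms(1-3) that] by metis+
  have "compose (carrier A) h (conv R f g) = \<theta> S (induced X R S h (pt R f \<otimes>\<^bsub>points X R\<^esub> pt R g))"
    using theta_natural[OF assms(1-3)] c by (simp add: conv_def)
  also have "\<dots> = \<theta> S (induced X R S h (pt R f) \<otimes>\<^bsub>points X S\<^esub> induced X R S h (pt R g))"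
    using hom_mult[OF ind c] by simp
  also have "\<dots> = conv S (compose (carrier A) h f) (compose (carrier A) h g)"
    using i(2)[OF c(1)] i(2)[OF c(2)] pt(2)[OF assms(1)] assms(4,5) by (simp add: conv_def)
  finally show ?thesis .
qed

text \<open>The unit point comes from \<open>X(K)\<close>, and \<open>\<epsilon>\<close> is the only element of \<open>X(K)\<close>.\<close>

lemma theta_one:
  assumes "superalgebra K R"
  shows "\<theta> R \<one>\<^bsub>points X R\<^esub> = unit R"
proof -
  interpret R: superalgebra K R by fact
  interpret GG: group "points X G" by (rule group_points[OF superalgebra_G])
  interpret RR: group "points X R" by (rule group_points[OF assms])
  have eps: "\<theta> G \<one>\<^bsub>points X G\<^esub> = \<epsilon>"
    using pt(4)[OF superalgebra_G] augmentation_unique by simp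
  have "\<one>\<^bsub>points X R\<^esub> = induced X G R (\<lambda>k\<in>carrier K. k \<odot>\<^bsub>R\<^esub> \<one>\<^bsub>R\<^esub>) \<one>\<^bsub>points X G\<^esub>"
    using hom_one[OF induced_hom[OF superalgebra_G assms R.unit_hom] GG.is_group RR.is_group] by simp
  then have "\<theta> R \<one>\<^bsub>points X R\<^esub> = compose (carrier A) (\<lambda>k\<in>carrier K. k \<odot>\<^bsub>R\<^esub> \<one>\<^bsub>R\<^esub>) \<epsilon>"
    using theta_natural[OF superalgebra_G assms R.unit_hom] eps by simp
  then show ?thesis by (simp add: compose_def unit_def cong: restrict_cong)
qed

lemma unit:
  assumes "superalgebra K R"
  shows "unit R \<in> H R" "pt R (unit R) = \<one>\<^bsub>points X R\<^esub>"
proof -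
  interpret RR: group "points X R" by (rule group_points[OF assms])
  show "unit R \<in> H R" "pt R (unit R) = \<one>\<^bsub>points X R\<^esub>"
    unfolding theta_one[OF assms, symmetric] using pt[OF assms] by simp_all
qed

lemma conv_unit:
  assumes "superalgebra K R" "f \<in> H R"
  shows "conv R f (unit R) = f" "conv R (unit R) f = f"
proof -
  interpret RR: group "points X R" by (rule group_points[OF assms(1)])
  show "conv R f (unit R) = f" "conv R (unit R) f = f"
    using unit pt assms by (simp_all add: conv_def)
qed

lemma conv_inverse:
  assumes "superalgebra K R" "f \<in> H R"
  obtains f' where "f' \<in> H R" "conv R f f' = unit R" "conv R f' f = unit R"
proof -
  interpret RR: group "points X R" by (rule group_points[OF assms(1)])
  have c: "pt R f \<in> carrier (points X R)" using pt(1) assms by auto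
  show thesis
    by (rule that[of "\<theta> R (inv\<^bsub>points X R\<^esub> pt R f)"])
       (use c pt[OF assms(1)] assms(2) theta_one[OF assms(1)] in \<open>simp_all add: conv_def\<close>)
qed

end

section \<open>Points close to the unit\<close>

text \<open>The last two assumptions say that \<open>J\<close> lies in the socle of \<open>R\<close>, so that the points \<open>\<epsilon> + d\<close> with \<open>d\<close>
  valued in \<open>J\<close> form a central subgroup of \<open>X(R)\<close>.\<close>

locale augmented_with_socle =
  pro_represented_group K X A \<epsilon> \<theta> + R: superalgebra K R
  for K :: "'u::infinite ring" and X :: "('u, 'x) k_group_functor"
    and A :: "('u, 'a) superalg" and \<epsilon> :: "'a \<Rightarrow> 'u"
    and \<theta> :: "('u, 'u) superalg \<Rightarrow> 'x \<Rightarrow> 'a \<Rightarrow> 'u"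
    and R :: "('u, 'u) superalg" (structure) +
  fixes \<eta> :: "'u \<Rightarrow> 'u" and J :: "'u set"
  assumes eta_hom: "\<eta> \<in> salg_hom K R (ground_superalg K)"
    and J_superideal: "superideal J R"
    and eta_J: "j \<in> J \<Longrightarrow> \<eta> j = \<zero>\<^bsub>K\<^esub>"
    and J_annihilates: "\<lbrakk>j \<in> J; r \<in> carrier R; \<eta> r = \<zero>\<^bsub>K\<^esub>\<rbrakk> \<Longrightarrow> j \<otimes> r = \<zero> \<and> r \<otimes> j = \<zero>"
begin

lemma superalgebra_R: "superalgebra K R" ..

lemma J_ideal: "ideal J R"
  using J_superideal by (simp add: superideal_def)

lemma J_closed [simp]:
  "j \<in> J \<Longrightarrow> j \<in> carrier R" "\<zero> \<in> J" "\<lbrakk>j \<in> J; i \<in> J\<rbrakk> \<Longrightarrow> j \<oplus> i \<in> J" "j \<in> J \<Longrightarrow> \<ominus> j \<in> J"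
  "j \<in> J \<Longrightarrow> even_comp R j \<in> J" "j \<in> J \<Longrightarrow> odd_comp R j \<in> J"
proof -
  interpret J: ideal J R by (rule J_ideal)
  show "j \<in> J \<Longrightarrow> j \<in> carrier R" "\<zero> \<in> J" "\<lbrakk>j \<in> J; i \<in> J\<rbrakk> \<Longrightarrow> j \<oplus> i \<in> J"
    "j \<in> J \<Longrightarrow> \<ominus> j \<in> J" by auto
  show "j \<in> J \<Longrightarrow> even_comp R j \<in> J" "j \<in> J \<Longrightarrow> odd_comp R j \<in> J"
    using J_superideal by (auto simp: superideal_def)
qed

lemma J_smult [simp]:
  assumes "k \<in> carrier K" "j \<in> J"
  shows "k \<odot> j \<in> J"
proof -
  have "k \<odot> j = (k \<odot> \<one>) \<otimes> j" using assms by (simp add: R.smult_mult_left)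
  also have "\<dots> \<in> J" using ideal.I_l_closed[OF J_ideal assms(2)] assms(1) by simp
  finally show ?thesis .
qed

lemma eta [simp]:
  "x \<in> carrier R \<Longrightarrow> \<eta> x \<in> carrier K"
  "\<lbrakk>x \<in> carrier R; y \<in> carrier R\<rbrakk> \<Longrightarrow> \<eta> (x \<oplus> y) = \<eta> x \<oplus>\<^bsub>K\<^esub> \<eta> y"
  "\<lbrakk>x \<in> carrier R; y \<in> carrier R\<rbrakk> \<Longrightarrow> \<eta> (x \<otimes> y) = \<eta> x \<otimes>\<^bsub>K\<^esub> \<eta> y"
  "\<lbrakk>k \<in> carrier K; x \<in> carrier R\<rbrakk> \<Longrightarrow> \<eta> (k \<odot> x) = k \<otimes>\<^bsub>K\<^esub> \<eta> x"
  "\<eta> \<one> = \<one>\<^bsub>K\<^esub>" "\<eta> \<zero> = \<zero>\<^bsub>K\<^esub>"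
  "x \<in> odd_part R \<Longrightarrow> \<eta> x = \<zero>\<^bsub>K\<^esub>"
  using salg_homD[OF eta_hom] salg_hom_minus(1)[OF superalgebra_R superalgebra_G eta_hom]
  by auto

lemma eta_even_comp:
  assumes "x \<in> carrier R"
  shows "\<eta> (even_comp R x) = \<eta> x"
  using assms eta(2)[of "even_comp R x" "odd_comp R x"] R.decomposition[OF assms] by simp

lemma eta_H: "g \<in> H R \<Longrightarrow> a \<in> carrier A \<Longrightarrow> \<eta> (g a) = \<epsilon> a"
  using augmentation_unique[OF H_compose[OF superalgebra_R superalgebra_G _ eta_hom, of g]]
  by (metis compose_eq)

text \<open>Write \<open>r = \<eta>(r) + m\<close> with \<open>m\<close> in the augmentation ideal, which annihilates \<open>J\<close>.\<close>

lemma J_mult: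
  assumes "j \<in> J" "r \<in> carrier R"
  shows "r \<otimes> j = \<eta> r \<odot> j" "j \<otimes> r = \<eta> r \<odot> j"
proof -
  let ?m = "r \<oplus> \<ominus> (\<eta> r \<odot> \<one>)"
  have m: "?m \<in> carrier R" using assms by simp
  have r: "r = ?m \<oplus> \<eta> r \<odot> \<one>"
    using assms by (simp add: R.A.a_assoc R.A.l_neg)
  have "\<eta> r = \<eta> ?m \<oplus>\<^bsub>K\<^esub> \<eta> r"
    using arg_cong[OF r, of \<eta>] m assms eta(2)[OF m, of "\<eta> r \<odot> \<one>"] by simp
  then have "\<eta> ?m = \<zero>\<^bsub>K\<^esub>" using assms m by simp
  then have z: "j \<otimes> ?m = \<zero>" "?m \<otimes> j = \<zero>"
    using J_annihilates[OF assms(1) m] by auto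
  have "r \<otimes> j = ?m \<otimes> j \<oplus> (\<eta> r \<odot> \<one>) \<otimes> j"
    using m assms by (subst r) (rule R.A.l_distr; simp)
  then show "r \<otimes> j = \<eta> r \<odot> j" using z assms by (simp add: R.smult_mult_left)
  have "j \<otimes> r = j \<otimes> ?m \<oplus> j \<otimes> (\<eta> r \<odot> \<one>)"
    using m assms by (subst r) (rule R.A.r_distr; simp)
  then show "j \<otimes> r = \<eta> r \<odot> j" using z assms by (simp add: R.smult_mult_right)
qed

lemma perturbed_mult:
  assumes "r \<in> carrier R" "r' \<in> carrier R" "j \<in> J" "j' \<in> J"
  shows "(r \<oplus> j) \<otimes> (r' \<oplus> j') = r \<otimes> r' \<oplus> (\<eta> r \<odot> j' \<oplus> \<eta> r' \<odot> j)"
proof -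
  have "(r \<oplus> j) \<otimes> (r' \<oplus> j') =
      r \<otimes> r' \<oplus> (r \<otimes> j' \<oplus> (j \<otimes> r' \<oplus> j \<otimes> j'))"
    using assms by (simp add: R.A.l_distr R.A.r_distr R.A.add.m_ac)
  then show ?thesis using assms by (simp add: J_mult eta_J)
qed

text \<open>Tangent vectors of \<open>X\<close> at the unit with values in \<open>J\<close>. These maps are automatically continuous, as
  they vanish on \<open>\<MM>\<^sup>2\<close>.\<close>

definition tangent :: "('a \<Rightarrow> 'u) \<Rightarrow> bool" where
  "tangent d \<longleftrightarrow> linear_map K A R J d \<and>
    d \<one>\<^bsub>A\<^esub> = \<zero> \<and>
    (\<forall>a\<in>\<MM> A. \<forall>b\<in>\<MM> A. d (a \<otimes>\<^bsub>A\<^esub> b) = \<zero>) \<and>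
    (\<forall>a\<in>even_part A. d a \<in> even_part R) \<and> (\<forall>a\<in>odd_part A. d a \<in> odd_part R)"

definition perturb :: "('a \<Rightarrow> 'u) \<Rightarrow> ('a \<Rightarrow> 'u) \<Rightarrow> 'a \<Rightarrow> 'u" where
  "perturb f d = (\<lambda>a\<in>carrier A. f a \<oplus> d a)"

lemma tangentD:
  assumes "tangent d"
  shows "a \<in> carrier A \<Longrightarrow> d a \<in> J"
    and "\<lbrakk>a \<in> carrier A; b \<in> carrier A\<rbrakk> \<Longrightarrow> d (a \<oplus>\<^bsub>A\<^esub> b) = d a \<oplus> d b"
    and "\<lbrakk>k \<in> carrier K; a \<in> carrier A\<rbrakk> \<Longrightarrow> d (k \<odot>\<^bsub>A\<^esub> a) = k \<odot> d a"
    and "d \<one>\<^bsub>A\<^esub> = \<zero>"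
    and "\<lbrakk>a \<in> \<MM> A; b \<in> \<MM> A\<rbrakk> \<Longrightarrow> d (a \<otimes>\<^bsub>A\<^esub> b) = \<zero>"
    and "a \<in> even_part A \<Longrightarrow> d a \<in> even_part R"
    and "a \<in> odd_part A \<Longrightarrow> d a \<in> odd_part R"
  using assms by (auto simp: tangent_def dest: linear_mapD)

lemma tangent_linear: "tangent d \<Longrightarrow> linear_map K A R (carrier R) d"
  by (rule linear_map_weaken[of _ _ _ J]) (auto simp: tangent_def)

lemma tangent_mult:
  assumes "tangent d" "a \<in> carrier A" "b \<in> carrier A"
  shows "d (a \<otimes>\<^bsub>A\<^esub> b) = \<epsilon> a \<odot> d b \<oplus> \<epsilon> b \<odot> d a"
  by (rule derivation_mult[OF R.module_axioms tangent_linear[OF assms(1)] tangentD(4)[OF assms(1)]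
    tangentD(5)[OF assms(1)] assms(2,3)])

lemma tangent_Mpow2:
  assumes "tangent d" "y \<in> Mpow (Suc 1)"
  shows "d y = \<zero>"
  by (rule derivation_Mpow2[OF R.module_axioms tangent_linear[OF assms(1)] tangentD(4)[OF assms(1)]
    tangentD(5)[OF assms(1)] assms(2)])

text \<open>A tangent map is an \<open>\<epsilon>\<close>-derivation and products in \<open>J\<close> vanish, so \<open>\<epsilon> + d\<close> is multiplicative.\<close>

lemma perturb_unit:
  assumes "tangent d"
  shows "perturb (unit R) d \<in> H R"
proof -
  note d = tangentD[OF assms]
  have u: "perturb (unit R) d a = \<epsilon> a \<odot> \<one> \<oplus> d a" if "a \<in> carrier A" for a
    using that by (simp add: perturb_def unit_def)
  have hom: "perturb (unit R) d \<in> salg_hom K A R"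
  proof (rule salg_homI)
    show "perturb (unit R) d x = undefined" if "x \<notin> carrier A" for x
      using that by (simp add: perturb_def)
    show "perturb (unit R) d (x \<otimes>\<^bsub>A\<^esub> y) = perturb (unit R) d x \<otimes> perturb (unit R) d y"
      if "x \<in> carrier A" "y \<in> carrier A" for x y
    proof -
      have "perturb (unit R) d x \<otimes> perturb (unit R) d y =
         (\<epsilon> x \<odot> \<one>) \<otimes> (\<epsilon> y \<odot> \<one>) \<oplus> (\<epsilon> x \<odot> d y \<oplus> \<epsilon> y \<odot> d x)"
        using that d(1) by (simp add: u perturbed_mult)
      then show ?thesis
        using that by (simp add: u tangent_mult[OF assms] R.smult_mult_left R.smult_assoc1)
    qed
    show "perturb (unit R) d (x \<oplus>\<^bsub>A\<^esub> y) = perturb (unit R) d x \<oplus> perturb (unit R) d y"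
      if "x \<in> carrier A" "y \<in> carrier A" for x y
      using that d(1) by (simp add: u d(2) R.smult_l_distr R.A.add.m_ac)
    show "perturb (unit R) d (k \<odot>\<^bsub>A\<^esub> x) = k \<odot> perturb (unit R) d x"
      if "k \<in> carrier K" "x \<in> carrier A" for k x
      using that d(1) by (simp add: u d(3) R.smult_r_distr R.smult_assoc1)
    show "perturb (unit R) d x \<in> even_part R" if "x \<in> even_part A" for x
      using that even_in_carrier[OF that] d(6) by (simp add: u R.even_closed R.one_even)
    show "perturb (unit R) d x \<in> odd_part R" if "x \<in> odd_part A" for x
      using that odd_in_carrier[OF that] d(7)[OF that] R.odd_in_carrier[OF d(7)[OF that]]
      by (simp add: u R.odd_closed)
  qed (use d(1,4) in \<open>simp_all add: u\<close>)
  have "\<forall>y\<in>Mpow (Suc 1). d y = \<zero>" using tangent_Mpow2[OF assms] by blast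
  moreover have "\<epsilon> y = \<zero>\<^bsub>K\<^esub>" if "y \<in> Mpow (Suc 1)" for y
    using Mpow_le_M[OF _ that] by (simp add: M_iff)
  ultimately have "\<forall>y\<in>Mpow (Suc 1). perturb (unit R) d y = \<zero>"
    using Mpow_carrier by (simp add: u del: ideal_power.simps)
  then show ?thesis using hom unfolding H_iff[OF superalgebra_R] by blast
qed

end

context augmented_with_socle
begin

text \<open>The fibre product of \<open>R\<close> and \<open>K + J\<close> over \<open>K\<close>, as a subset of \<open>R \<times> R\<close>.\<close>

definition fibre_product :: "('u \<times> 'u) set" where
  "fibre_product = {(r, \<eta> r \<odot> \<one> \<oplus> j) | r j. r \<in> carrier R \<and> j \<in> J}"

lemma fibre_productI: "\<lbrakk>r \<in> carrier R; j \<in> J; s = \<eta> r \<odot> \<one> \<oplus> j\<rbrakk> \<Longrightarrow> (r, s) \<in> fibre_product"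
  by (auto simp: fibre_product_def)

lemma fibre_productE:
  assumes "p \<in> fibre_product"
  obtains r j where "r \<in> carrier R" "j \<in> J" "p = (r, \<eta> r \<odot> \<one> \<oplus> j)"
  using assms by (auto simp: fibre_product_def)

lemma scalar_add: "\<lbrakk>k \<in> carrier K; m \<in> carrier K; i \<in> J; j \<in> J\<rbrakk> \<Longrightarrow>
    (k \<odot> \<one> \<oplus> i) \<oplus> (m \<odot> \<one> \<oplus> j) = (k \<oplus>\<^bsub>K\<^esub> m) \<odot> \<one> \<oplus> (i \<oplus> j)"
  by (simp add: R.smult_l_distr R.A.add.m_ac)

lemma scalar_mult: "\<lbrakk>k \<in> carrier K; m \<in> carrier K; i \<in> J; j \<in> J\<rbrakk> \<Longrightarrow>
    (k \<odot> \<one> \<oplus> i) \<otimes> (m \<odot> \<one> \<oplus> j) =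
    (k \<otimes>\<^bsub>K\<^esub> m) \<odot> \<one> \<oplus> (k \<odot> j \<oplus> m \<odot> i)"
  by (simp add: perturbed_mult R.smult_mult_left R.smult_assoc1)

lemma scalar_smult: "\<lbrakk>k \<in> carrier K; m \<in> carrier K; j \<in> J\<rbrakk> \<Longrightarrow>
    k \<odot> (m \<odot> \<one> \<oplus> j) = (k \<otimes>\<^bsub>K\<^esub> m) \<odot> \<one> \<oplus> k \<odot> j"
  by (simp add: R.smult_r_distr R.smult_assoc1)

lemma scalar_even_comp: "\<lbrakk>k \<in> carrier K; j \<in> J\<rbrakk> \<Longrightarrow>
    even_comp R (k \<odot> \<one> \<oplus> j) = k \<odot> \<one> \<oplus> even_comp R j"
  by (simp add: R.comp_add R.comp_even(1)[OF R.even_closed(4)[OF _ R.one_even]])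

lemma scalar_odd_comp: "\<lbrakk>k \<in> carrier K; j \<in> J\<rbrakk> \<Longrightarrow>
    odd_comp R (k \<odot> \<one> \<oplus> j) = odd_comp R j"
  by (simp add: R.comp_add R.comp_even(2)[OF R.even_closed(4)[OF _ R.one_even]])

lemma subproduct_fibre_product: "subproduct_closed K R R fibre_product"
proof (rule subproduct_closed.intro[OF superalgebra_R superalgebra_R], unfold_locales)
  show "fibre_product \<subseteq> carrier R \<times> carrier R" by (auto elim!: fibre_productE)
  show "(\<one>, \<one>) \<in> fibre_product" by (rule fibre_productI[of _ "\<zero>"]) simp_all
  fix x y assume xy: "(x, y) \<in> fibre_product"
  then obtain i where i: "x \<in> carrier R" "i \<in> J" "y = \<eta> x \<odot> \<one> \<oplus> i" by (auto elim: fibre_productE)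
  show "(k \<odot> x, k \<odot> y) \<in> fibre_product" if "k \<in> carrier K" for k
    using i that by (intro fibre_productI[of _ "k \<odot> i"]) (simp_all add: scalar_smult)
  show "(even_comp R x, even_comp R y) \<in> fibre_product"
    using i by (intro fibre_productI[of _ "even_comp R i"]) (simp_all add: scalar_even_comp eta_even_comp)
  fix x' y' assume xy: "(x', y') \<in> fibre_product"
  then obtain j where j: "x' \<in> carrier R" "j \<in> J" "y' = \<eta> x' \<odot> \<one> \<oplus> j" by (auto elim: fibre_productE)
  show "(x \<oplus> x', y \<oplus> y') \<in> fibre_product"
    using i j by (intro fibre_productI[of _ "i \<oplus> j"]) (simp_all add: scalar_add)
  show "(x \<otimes> x', y \<otimes> y') \<in> fibre_product"
    using i j by (intro fibre_productI[of _ "\<eta> x \<odot> j \<oplus> \<eta> x' \<odot> i"]) (simp_all add: scalar_mult)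
qed

text \<open>The map \<open>(r, k + j) \<mapsto> r + j\<close> from the fibre product to \<open>R\<close>. It is multiplicative because
  \<open>r j\<close> is \<open>\<eta>(r) j\<close> for every \<open>r\<close>.\<close>

definition merge :: "'u \<times> 'u \<Rightarrow> 'u" where
  "merge = (\<lambda>p\<in>fibre_product. fst p \<oplus> (\<ominus> (\<eta> (fst p) \<odot> \<one>) \<oplus> snd p))"

lemma merge:
  assumes "r \<in> carrier R" "j \<in> J"
  shows "merge (r, \<eta> r \<odot> \<one> \<oplus> j) = r \<oplus> j"
  using assms fibre_productI[OF assms refl] by (simp add: merge_def R.A.r_neg1)

lemma merge_hom: "merge \<in> salg_hom K (subproduct R R fibre_product) R"
proof -
  let ?P = "subproduct R R fibre_product"
  interpret subproduct_closed K R R fibre_product by (rule subproduct_fibre_product)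
  show ?thesis
  proof (rule salg_homI)
    show "merge p \<in> carrier R" if "p \<in> carrier (?P)" for p
      using that by (auto simp: subproduct_def merge elim!: fibre_productE)
    show "merge p = undefined" if "p \<notin> carrier (?P)" for p
      using that by (simp add: subproduct_def merge_def)
    show "merge \<one>\<^bsub>?P\<^esub> = \<one>"
      using merge[of "\<one>" "\<zero>"] by (simp add: subproduct_def)
    show "merge (k \<odot>\<^bsub>?P\<^esub> p) = k \<odot> merge p"
      if k: "k \<in> carrier K" and p: "p \<in> carrier (?P)" for k p
    proof -
      obtain r j where rj: "r \<in> carrier R" "j \<in> J" "p = (r, \<eta> r \<odot> \<one> \<oplus> j)"
        using p by (auto simp: subproduct_def elim: fibre_productE)
      then show ?thesis
        using merge[of "k \<odot> r" "k \<odot> j"] k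
        by (simp add: subproduct_def scalar_smult merge R.smult_assoc1 R.smult_r_distr)
    qed
    fix p p' assume p: "p \<in> carrier (?P)" and p': "p' \<in> carrier (?P)"
    obtain r j where rj: "r \<in> carrier R" "j \<in> J" "p = (r, \<eta> r \<odot> \<one> \<oplus> j)"
      using p by (auto simp: subproduct_def elim: fibre_productE)
    obtain r' j' where rj': "r' \<in> carrier R" "j' \<in> J" "p' = (r', \<eta> r' \<odot> \<one> \<oplus> j')"
      using p' by (auto simp: subproduct_def elim: fibre_productE)
    show "merge (p \<oplus>\<^bsub>?P\<^esub> p') = merge p \<oplus> merge p'"
    proof -
      have "(r \<oplus> r') \<oplus> (j \<oplus> j') = (r \<oplus> j) \<oplus> (r' \<oplus> j')"
        using rj rj' by (simp add: R.A.add.m_ac)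
      then show ?thesis
        using rj rj' merge[of "r \<oplus> r'" "j \<oplus> j'"]
        by (simp add: subproduct_def scalar_add merge)
    qed
    show "merge (p \<otimes>\<^bsub>?P\<^esub> p') = merge p \<otimes> merge p'"
      using rj rj' merge[of "r \<otimes> r'" "\<eta> r \<odot> j' \<oplus> \<eta> r' \<odot> j"]
      by (simp add: subproduct_def scalar_mult merge perturbed_mult R.smult_mult_left R.smult_assoc1)
  next
    fix p assume "p \<in> even_part (?P)"
    then obtain r j where rj: "r \<in> carrier R" "j \<in> J" "p = (r, \<eta> r \<odot> \<one> \<oplus> j)"
      "r \<in> even_part R" "\<eta> r \<odot> \<one> \<oplus> j \<in> even_part R"
      by (auto simp: subproduct_def elim: fibre_productE)
    have "odd_comp R j = \<zero>" using R.comp_even(2)[OF rj(5)] rj(1,2) by (simp add: scalar_odd_comp)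
    then have "j \<in> even_part R" using R.decomposition[of j] rj(2) R.even_in_carrier by (metis J_closed(1) R.A.r_zero)
    then show "merge p \<in> even_part R" using rj by (simp add: merge R.even_closed)
  next
    fix p assume "p \<in> odd_part (?P)"
    then obtain r j where rj: "r \<in> carrier R" "j \<in> J" "p = (r, \<eta> r \<odot> \<one> \<oplus> j)"
      "r \<in> odd_part R" "\<eta> r \<odot> \<one> \<oplus> j \<in> odd_part R"
      by (auto simp: subproduct_def elim: fibre_productE)
    then have "j \<in> odd_part R" by simp
    moreover have "merge p = r \<oplus> j" unfolding rj(3) using rj(1,2) by (rule merge)
    ultimately show "merge p \<in> odd_part R" using rj(4) by (simp add: R.odd_closed)
  qed
qed

text \<open>A product of points is determined by its images under morphisms. In the fibre product the projections
  identify the product of \<open>(g, \<epsilon>)\<close> and \<open>(\<epsilon>, \<epsilon> + d)\<close>, in either order, with \<open>(g, \<epsilon> + d)\<close>; the morphism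
  \<open>merge\<close> sends the three points to \<open>g\<close>, \<open>\<epsilon> + d\<close> and \<open>g + d\<close>.\<close>

lemma perturb_conv:
  assumes "tangent d" "g \<in> H R"
  shows "perturb g d \<in> H R"
    and "conv R g (perturb (unit R) d) = perturb g d"
    and "conv R (perturb (unit R) d) g = perturb g d"
proof -
  interpret P: subproduct_closed K R R fibre_product by (rule subproduct_fibre_product)
  let ?P = "subproduct R R fibre_product"
  let ?u = "perturb (unit R) d"
  note SP = P.superalgebra_subproduct
  note SR = superalgebra_R
  obtain T :: "('u, 'u) superalg" and q p1 p2 where T: "superalgebra K T" and q: "q \<in> salg_hom K ?P T" "q ` fibre_product = carrier T"
    "q ` (fibre_product \<inter> even_part R \<times> even_part R) = even_part T"
    "q ` (fibre_product \<inter> odd_part R \<times> odd_part R) = odd_part T"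
    and q_inj: "inj_on q fibre_product"
    and p1: "p1 \<in> salg_hom K T R" "\<forall>x y. (x, y) \<in> fibre_product \<longrightarrow> p1 (q (x, y)) = x"
    and p2: "p2 \<in> salg_hom K T R" "\<forall>x y. (x, y) \<in> fibre_product \<longrightarrow> p2 (q (x, y)) = y"
    by (rule subproduct_universe[OF subproduct_fibre_product])
  have carrier_P: "carrier ?P = fibre_product" and parts_P: "even_part ?P = fibre_product \<inter> even_part R \<times> even_part R"
    "odd_part ?P = fibre_product \<inter> odd_part R \<times> odd_part R"
    by (simp_all add: subproduct_def)
  have qP: "q \<in> salg_hom K ?P T" "q ` carrier ?P = carrier T"
    "q ` even_part ?P = even_part T" "q ` odd_part ?P = odd_part T"
    unfolding carrier_P parts_P by (fact q)+
  have ker: "merge x = \<zero>" if "x \<in> carrier ?P" "q x = \<zero>\<^bsub>T\<^esub>" for x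
  proof -
    interpret PP: superalgebra K ?P by (rule SP)
    have "q x = q \<zero>\<^bsub>?P\<^esub>" using that salg_hom_minus(1)[OF SP T qP(1)] by simp
    then have "x = \<zero>\<^bsub>?P\<^esub>" using that inj_onD[OF q_inj] PP.A.zero_closed unfolding carrier_P by blast
    then show ?thesis using salg_hom_minus(1)[OF SP SR merge_hom] by simp
  qed
  obtain \<sigma> where \<sigma>: "\<sigma> \<in> salg_hom K T R" "\<And>x. x \<in> fibre_product \<Longrightarrow> \<sigma> (q x) = merge x"
    using salg_hom_factor[OF SP SR T qP merge_hom ker] unfolding carrier_P by blast
  define pair where "pair f h = compose (carrier A) q (\<lambda>a\<in>carrier A. (f a, h a))" for f h :: "'a \<Rightarrow> 'u"
  have pair: "pair f h \<in> H T" "compose (carrier A) p1 (pair f h) = f"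
    "compose (carrier A) p2 (pair f h) = h"
    "compose (carrier A) \<sigma> (pair f h) = (\<lambda>a\<in>carrier A. merge (f a, h a))"
    if f: "f \<in> H R" and h: "h \<in> H R" and fh: "\<forall>a\<in>carrier A. (f a, h a) \<in> fibre_product" for f h
  proof -
    obtain n where n: "\<forall>y\<in>Mpow n. f y = \<zero>" using f by (auto simp: H_iff[OF SR])
    obtain m where m: "\<forall>y\<in>Mpow m. h y = \<zero>" using h by (auto simp: H_iff[OF SR])
    have "Mpow (max n m) \<subseteq> Mpow n" "Mpow (max n m) \<subseteq> Mpow m"
      using ideal_power_antimono[OF A.ring_axioms ideal_M] by auto
    then have "\<forall>y\<in>Mpow (max n m). (f y, h y) = \<zero>\<^bsub>?P\<^esub>"
      using n m by (auto simp: subproduct_def)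
    then have "\<forall>y\<in>Mpow (max n m). pair f h y = \<zero>\<^bsub>T\<^esub>"
      using salg_hom_minus(1)[OF SP T qP(1)] Mpow_carrier by (simp add: pair_def compose_def)
    moreover have "pair f h \<in> salg_hom K A T"
      unfolding pair_def
      using salg_hom_compose[OF superalgebra_A pair_hom[OF subproduct_fibre_product H_hom[OF f] H_hom[OF h] superalgebra_A fh[rule_format]] qP(1)] .
    ultimately show "pair f h \<in> H T" unfolding H_iff[OF T] by blast
    show "compose (carrier A) p1 (pair f h) = f" "compose (carrier A) p2 (pair f h) = h"
      using fh p1(2) p2(2) salg_homD(2)[OF H_hom[OF f]] salg_homD(2)[OF H_hom[OF h]]
      by (auto simp: compose_def pair_def fun_eq_iff)
    show "compose (carrier A) \<sigma> (pair f h) = (\<lambda>a\<in>carrier A. merge (f a, h a))"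
      using fh \<sigma>(2) by (auto simp: compose_def pair_def fun_eq_iff)
  qed
  \<comment> \<open>A point of the fibre product is determined by its two projections.\<close>
  have eq: "F = F'" if F: "F \<in> H T" "F' \<in> H T"
    and 1: "compose (carrier A) p1 F = compose (carrier A) p1 F'"
    and 2: "compose (carrier A) p2 F = compose (carrier A) p2 F'" for F F'
  proof (rule salg_hom_eqI[OF H_hom[OF F(1)] H_hom[OF F(2)]])
    fix a assume a: "a \<in> carrier A"
    have "F a \<in> q ` fibre_product" "F' a \<in> q ` fibre_product"
      using salg_homD(1)[OF H_hom] F a q(2) by blast+
    moreover have "p1 (F a) = p1 (F' a)" "p2 (F a) = p2 (F' a)"
      using fun_cong[OF 1, of a] fun_cong[OF 2, of a] a by (simp_all add: compose_def)
    ultimately show "F a = F' a" using p1(2) p2(2) by auto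
  qed
  note d = tangentD[OF assms(1)]
  note g = H_hom[OF assms(2)]
  note u = unit(1)[OF SR] and ud = perturb_unit[OF assms(1)]
  have ga: "g a \<in> carrier R" "\<eta> (g a) = \<epsilon> a" "d a \<in> J" "\<epsilon> a \<in> carrier K" if "a \<in> carrier A" for a
    using salg_homD(1)[OF g that] eta_H[OF assms(2) that] d(1)[OF that] that by auto
  have c1: "(g a, unit R a) \<in> fibre_product" if "a \<in> carrier A" for a
    using ga[OF that] that by (intro fibre_productI[of _ "\<zero>"]) (simp_all add: unit_def)
  have c2: "(unit R a, ?u a) \<in> fibre_product" if "a \<in> carrier A" for a
    using ga[OF that] that by (intro fibre_productI[of _ "d a"]) (simp_all add: unit_def perturb_def)
  have c3: "(g a, ?u a) \<in> fibre_product" if "a \<in> carrier A" for a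
    using ga[OF that] that by (intro fibre_productI[of _ "d a"]) (simp_all add: unit_def perturb_def)
  have c: "\<forall>a\<in>carrier A. (g a, unit R a) \<in> fibre_product" "\<forall>a\<in>carrier A. (unit R a, ?u a) \<in> fibre_product"
    "\<forall>a\<in>carrier A. (g a, ?u a) \<in> fibre_product"
    using c1 c2 c3 by blast+
  note F1 = pair[OF assms(2) u c(1)] and F2 = pair[OF u ud c(2)] and F3 = pair[OF assms(2) ud c(3)]
  have s1: "compose (carrier A) \<sigma> (pair g (unit R)) = g"
  proof -
    have "merge (g a, unit R a) = g a" if "a \<in> carrier A" for a
      using merge[of "g a" "\<zero>"] ga[OF that] that by (simp add: unit_def)
    then show ?thesis using F1(4) salg_homD(2)[OF g] by (auto simp: fun_eq_iff)
  qed
  have s2: "compose (carrier A) \<sigma> (pair (unit R) ?u) = ?u"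
  proof -
    have "merge (unit R a, ?u a) = ?u a" if "a \<in> carrier A" for a
      using merge[of "unit R a" "d a"] ga[OF that] that by (simp add: unit_def perturb_def)
    then show ?thesis
      unfolding F2(4) using salg_homD(2)[OF H_hom[OF ud]] by (auto simp: restrict_def fun_eq_iff)
  qed
  have s3: "compose (carrier A) \<sigma> (pair g ?u) = perturb g d"
  proof -
    have "merge (g a, ?u a) = g a \<oplus> d a" if "a \<in> carrier A" for a
      using merge[of "g a" "d a"] ga[OF that] that by (simp add: unit_def perturb_def)
    then show ?thesis unfolding F3(4) perturb_def[of g] by (rule restrict_ext)
  qed
  have "conv T (pair g (unit R)) (pair (unit R) ?u) = pair g ?u"
    by (rule eq[OF conv_closed(1)[OF T F1(1) F2(1)] F3(1)])
       (simp_all add: conv_natural[OF T SR p1(1) F1(1) F2(1)] conv_natural[OF T SR p2(1) F1(1) F2(1)]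
         conv_unit[OF SR assms(2)] conv_unit[OF SR ud] F1 F2 F3)
  then show "conv R g ?u = perturb g d"
    using conv_natural[OF T SR \<sigma>(1) F1(1) F2(1)] s1 s2 s3 by simp
  have "conv T (pair (unit R) ?u) (pair g (unit R)) = pair g ?u"
    by (rule eq[OF conv_closed(1)[OF T F2(1) F1(1)] F3(1)])
       (simp_all add: conv_natural[OF T SR p1(1) F2(1) F1(1)] conv_natural[OF T SR p2(1) F2(1) F1(1)]
         conv_unit[OF SR assms(2)] conv_unit[OF SR ud] F1 F2 F3)
  then show "conv R ?u g = perturb g d"
    using conv_natural[OF T SR \<sigma>(1) F2(1) F1(1)] s1 s2 s3 by simp
  show "perturb g d \<in> H R"
    using H_compose[OF T SR F3(1) \<sigma>(1)] s3 by simp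
qed

text \<open>The points \<open>\<epsilon> + d\<close> are central, so they can be collected on one side.\<close>

lemma conv_perturb:
  assumes f: "f \<in> H R" and h: "h \<in> H R" and d: "tangent d" and d': "tangent d'"
  shows "conv R (perturb f d) (perturb h d') = perturb (conv R f h) (\<lambda>a. d a \<oplus> d' a)"
proof -
  note SR = superalgebra_R
  note ud = perturb_unit[OF d] and ud' = perturb_unit[OF d']
  have fh: "conv R f h \<in> H R" using conv_closed(1)[OF SR f h] .
  have "conv R (perturb f d) (perturb h d') =
      conv R (conv R (perturb (unit R) d) f) (conv R h (perturb (unit R) d'))"
    using perturb_conv[OF d f] perturb_conv[OF d' h] by simp
  also have "\<dots> = conv R (perturb (unit R) d) (conv R (conv R f h) (perturb (unit R) d'))"
    using f h ud ud' fh by (simp add: conv_assoc[OF SR] conv_closed(1)[OF SR])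
  also have "\<dots> = perturb (perturb (conv R f h) d') d"
    using perturb_conv[OF d' fh] perturb_conv[OF d] by simp
  also have "\<dots> = perturb (conv R f h) (\<lambda>a. d a \<oplus> d' a)"
    using salg_homD(1)[OF H_hom[OF fh]] tangentD(1)[OF d] tangentD(1)[OF d']
    by (auto simp: perturb_def fun_eq_iff R.A.add.m_ac)
  finally show ?thesis .
qed

end

section \<open>The dual space and the points e(a, v)\<close>

context pro_represented_group
begin

lemma hyp_simps [simp]:
  "\<zero>\<^bsub>hyp K A\<^esub> = (\<lambda>x\<in>carrier A. \<zero>\<^bsub>K\<^esub>)"
  "\<phi> \<oplus>\<^bsub>hyp K A\<^esub> \<psi> = (\<lambda>x\<in>carrier A. \<phi> x \<oplus>\<^bsub>K\<^esub> \<psi> x)"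
  "k \<odot>\<^bsub>hyp K A\<^esub> \<phi> = (\<lambda>x\<in>carrier A. k \<otimes>\<^bsub>K\<^esub> \<phi> x)"
  by (simp_all add: hyp_def)

lemma hyp_iff:
  "\<phi> \<in> carrier (hyp K A) \<longleftrightarrow> \<phi> \<in> extensional (carrier A) \<and> linear_functional K A \<phi> \<and>
    (\<exists>n. \<forall>y\<in>Mpow n. \<phi> y = \<zero>\<^bsub>K\<^esub>)"
proof -
  have "continuous_map (max_adic A) (discrete_topology (carrier K)) \<phi> \<longleftrightarrow>
      (\<exists>n. \<forall>y\<in>Mpow n. \<phi> y = \<zero>\<^bsub>K\<^esub>)" if "linear_functional K A \<phi>"
    using linear_functionalD(1,2)[OF that] by (rule continuous_iff[OF K.is_abelian_group])
  then show ?thesis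
    by (auto simp: hyp_def linear_functional_def PiE_iff)
qed

lemma hyp_add_closed:
  assumes "\<phi> \<in> carrier (hyp K A)" "\<psi> \<in> carrier (hyp K A)"
  shows "\<phi> \<oplus>\<^bsub>hyp K A\<^esub> \<psi> \<in> carrier (hyp K A)"
proof -
  obtain n m where nm: "\<forall>y\<in>Mpow n. \<phi> y = \<zero>\<^bsub>K\<^esub>" "\<forall>y\<in>Mpow m. \<psi> y = \<zero>\<^bsub>K\<^esub>"
    using assms by (auto simp: hyp_iff)
  have "Mpow (max n m) \<subseteq> Mpow n" "Mpow (max n m) \<subseteq> Mpow m"
    using ideal_power_antimono[OF A.ring_axioms ideal_M] by auto
  then have "\<forall>y\<in>Mpow (max n m). (\<phi> \<oplus>\<^bsub>hyp K A\<^esub> \<psi>) y = \<zero>\<^bsub>K\<^esub>"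
    using nm Mpow_carrier by (auto simp: subset_iff)
  moreover have "linear_functional K A (\<phi> \<oplus>\<^bsub>hyp K A\<^esub> \<psi>)"
    using assms by (auto simp: hyp_iff linear_functional_def K.add.m_ac K.r_distr)
  moreover have "\<phi> \<oplus>\<^bsub>hyp K A\<^esub> \<psi> \<in> extensional (carrier A)" by simp
  ultimately show ?thesis unfolding hyp_iff by blast
qed

lemma hyp_smult_closed:
  assumes "k \<in> carrier K" "\<phi> \<in> carrier (hyp K A)"
  shows "k \<odot>\<^bsub>hyp K A\<^esub> \<phi> \<in> carrier (hyp K A)"
proof -
  obtain n where "\<forall>y\<in>Mpow n. \<phi> y = \<zero>\<^bsub>K\<^esub>" using assms by (auto simp: hyp_iff)
  then have "\<forall>y\<in>Mpow n. (k \<odot>\<^bsub>hyp K A\<^esub> \<phi>) y = \<zero>\<^bsub>K\<^esub>"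
    using assms(1) Mpow_carrier by auto
  moreover have "linear_functional K A (k \<odot>\<^bsub>hyp K A\<^esub> \<phi>)"
    using assms by (auto simp: hyp_iff linear_functional_def K.r_distr K.m_ac)
  moreover have "k \<odot>\<^bsub>hyp K A\<^esub> \<phi> \<in> extensional (carrier A)" by simp
  ultimately show ?thesis unfolding hyp_iff by blast
qed

lemma abelian_monoid_hyp: "abelian_monoid (hyp K A)"
proof (rule abelian_monoidI)
  have "linear_functional K A (\<lambda>x\<in>carrier A. \<zero>\<^bsub>K\<^esub>)" by (simp add: linear_functional_def)
  then show "\<zero>\<^bsub>hyp K A\<^esub> \<in> carrier (hyp K A)"
    using Mpow_carrier by (auto simp: hyp_iff)
  show "\<phi> \<oplus>\<^bsub>hyp K A\<^esub> \<psi> \<in> carrier (hyp K A)"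
    if "\<phi> \<in> carrier (hyp K A)" "\<psi> \<in> carrier (hyp K A)" for \<phi> \<psi>
    using hyp_add_closed[OF that] .
  fix \<phi> assume \<phi>: "\<phi> \<in> carrier (hyp K A)"
  then have \<phi>K: "\<phi> x \<in> carrier K" if "x \<in> carrier A" for x
    using linear_functionalD(1)[of K A] that by (simp add: hyp_iff)
  show "\<zero>\<^bsub>hyp K A\<^esub> \<oplus>\<^bsub>hyp K A\<^esub> \<phi> = \<phi>"
    using \<phi> \<phi>K by (auto simp: hyp_iff extensional_def fun_eq_iff)
  fix \<psi> assume \<psi>: "\<psi> \<in> carrier (hyp K A)"
  then have \<psi>K: "\<psi> x \<in> carrier K" if "x \<in> carrier A" for x
    using linear_functionalD(1)[of K A] that by (simp add: hyp_iff)
  show "\<phi> \<oplus>\<^bsub>hyp K A\<^esub> \<psi> = \<psi> \<oplus>\<^bsub>hyp K A\<^esub> \<phi>"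
    using \<phi>K \<psi>K by (auto simp: fun_eq_iff K.add.m_comm)
  fix \<chi> assume \<chi>: "\<chi> \<in> carrier (hyp K A)"
  then have \<chi>K: "\<chi> x \<in> carrier K" if "x \<in> carrier A" for x
    using linear_functionalD(1)[of K A] that by (simp add: hyp_iff)
  show "\<phi> \<oplus>\<^bsub>hyp K A\<^esub> \<psi> \<oplus>\<^bsub>hyp K A\<^esub> \<chi> = \<phi> \<oplus>\<^bsub>hyp K A\<^esub> (\<psi> \<oplus>\<^bsub>hyp K A\<^esub> \<chi>)"
    using \<phi>K \<psi>K \<chi>K by (auto simp: fun_eq_iff K.add.m_assoc)
qed

lemma finsum_hyp_zero:
  assumes "finite S" "x \<in> carrier A" "\<And>i. i \<in> S \<Longrightarrow> f i \<in> carrier (hyp K A)"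
    and "\<And>i. i \<in> S \<Longrightarrow> f i x = \<zero>\<^bsub>K\<^esub>"
  shows "finsum (hyp K A) f S x = \<zero>\<^bsub>K\<^esub>"
proof -
  interpret V: abelian_monoid "hyp K A" by (rule abelian_monoid_hyp)
  from assms(1,3,4) show ?thesis
  proof (induction S)
    case empty
    then show ?case using assms(2) by simp
  next
    case (insert i S)
    then have "finsum (hyp K A) f (insert i S) = f i \<oplus>\<^bsub>hyp K A\<^esub> finsum (hyp K A) f S"
      by (intro V.finsum_insert) auto
    then show ?case using insert assms(2) by simp
  qed
qed

text \<open>An element of the span is a sum of multiples of basis functionals, all of which vanish at \<open>x\<close>.\<close>

lemma basis_separates:
  assumes "is_basis K (hyp K A) W l b" "W \<subseteq> carrier (hyp K A)" "w \<in> W" "x \<in> carrier A"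
    and "\<And>i. i \<in> {1..l} \<Longrightarrow> b i x = \<zero>\<^bsub>K\<^esub>"
  shows "w x = \<zero>\<^bsub>K\<^esub>"
proof -
  have "\<exists>!c. c \<in> {1..l} \<rightarrow>\<^sub>E carrier K \<and> w = (\<Oplus>\<^bsub>hyp K A\<^esub>i\<in>{1..l}. c i \<odot>\<^bsub>hyp K A\<^esub> b i)"
    using assms(1,3) unfolding is_basis_def by blast
  then obtain c where c: "c \<in> {1..l} \<rightarrow>\<^sub>E carrier K"
    "w = (\<Oplus>\<^bsub>hyp K A\<^esub>i\<in>{1..l}. c i \<odot>\<^bsub>hyp K A\<^esub> b i)"
    by blast
  have b: "b i \<in> carrier (hyp K A)" if "i \<in> {1..l}" for i
    using assms(1,2) that unfolding is_basis_def by blast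
  show ?thesis
    unfolding c(2)
  proof (rule finsum_hyp_zero[OF _ assms(4)])
    fix i assume i: "i \<in> {1..l}"
    then have ci: "c i \<in> carrier K" using c(1) by auto
    show "c i \<odot>\<^bsub>hyp K A\<^esub> b i \<in> carrier (hyp K A)" using hyp_smult_closed[OF ci b[OF i]] .
    show "(c i \<odot>\<^bsub>hyp K A\<^esub> b i) x = \<zero>\<^bsub>K\<^esub>" using assms(4,5) i ci by simp
  qed simp
qed

lemma Lie_oddD:
  assumes "v \<in> Lie_odd K A"
  shows "v \<in> carrier (hyp K A)" "linear_functional K A v" "v \<one>\<^bsub>A\<^esub> = \<zero>\<^bsub>K\<^esub>"
    "y \<in> Mpow (Suc 1) \<Longrightarrow> v y = \<zero>\<^bsub>K\<^esub>" "x \<in> even_part A \<Longrightarrow> v x = \<zero>\<^bsub>K\<^esub>"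
    "\<lbrakk>m \<in> \<MM> A; m' \<in> \<MM> A\<rbrakk> \<Longrightarrow> v (m \<otimes>\<^bsub>A\<^esub> m') = \<zero>\<^bsub>K\<^esub>"
proof -
  show "v \<in> carrier (hyp K A)" "v \<one>\<^bsub>A\<^esub> = \<zero>\<^bsub>K\<^esub>" "x \<in> even_part A \<Longrightarrow> v x = \<zero>\<^bsub>K\<^esub>"
    using assms by (auto simp: Lie_odd_def Lie_def)
  then show "linear_functional K A v" by (simp add: hyp_iff)
  have 2: "\<forall>y\<in>Mpow (Suc 1). v y = \<zero>\<^bsub>K\<^esub>"
    using assms unfolding Lie_odd_def Lie_def numeral_2_eq_2 One_nat_def by blast
  then show "y \<in> Mpow (Suc 1) \<Longrightarrow> v y = \<zero>\<^bsub>K\<^esub>" by blast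
  show "v (m \<otimes>\<^bsub>A\<^esub> m') = \<zero>\<^bsub>K\<^esub>" if "m \<in> \<MM> A" "m' \<in> \<MM> A"
    using 2 ideal_prod.prod[OF M_Mpow1[OF that(1)] that(2), of A] by simp
qed

text \<open>Such a \<open>v\<close> kills \<open>1\<close> and \<open>\<MM>\<^sup>2\<close>, so it is an \<open>\<epsilon>\<close>-derivation.\<close>

lemma Lie_odd_mult:
  assumes "v \<in> Lie_odd K A" "a \<in> carrier A" "b \<in> carrier A"
  shows "v (a \<otimes>\<^bsub>A\<^esub> b) = \<epsilon> a \<otimes>\<^bsub>K\<^esub> v b \<oplus>\<^bsub>K\<^esub> \<epsilon> b \<otimes>\<^bsub>K\<^esub> v a"
proof -
  interpret G: superalgebra K G by (rule superalgebra_G)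
  note v = Lie_oddD[OF assms(1)]
  have "linear_map K A G (carrier G) v"
    using v(2) by (simp add: linear_map_def linear_functional_def)
  from derivation_mult[OF G.module_axioms this _ _ assms(2,3)] show ?thesis
    using v(3,6) by simp
qed

text \<open>The pairing evaluates \<open>v \<otimes> a\<close> on an odd \<open>x\<close> with the sign \<open>-1\<close>, and \<open>v\<close> ignores the even component.\<close>

lemma e_hom_apply:
  assumes "superalgebra K R" "v \<in> Lie_odd K A" "a \<in> odd_part R" "x \<in> carrier A"
  shows "e_hom A \<epsilon> R a v x = \<epsilon> x \<odot>\<^bsub>R\<^esub> \<one>\<^bsub>R\<^esub> \<oplus>\<^bsub>R\<^esub> (\<ominus>\<^bsub>K\<^esub> v x) \<odot>\<^bsub>R\<^esub> a"
proof -
  interpret R: superalgebra K R by fact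
  note v = Lie_oddD[OF assms(2)]
  note lin = linear_functionalD[OF v(2)]
  note x = decomposition[OF assms(4)]
  note c = comp_closed[OF assms(4)]
  have a: "a \<in> carrier R" using assms(3) by (rule R.odd_in_carrier)
  have "\<epsilon> x = \<epsilon> (even_comp A x)" using eps(2)[OF c] eps(7)[OF x(2)] c x(3) by simp
  then have e: "\<epsilon> (even_comp A x) = \<epsilon> x" "\<epsilon> (odd_comp A x) = \<zero>\<^bsub>K\<^esub>" using eps(7)[OF x(2)] by simp_all
  have "v x = v (odd_comp A x)" using lin(2)[OF c] v(5)[OF x(1)] lin(1) c x(3) by simp
  then have w: "v (odd_comp A x) = v x" "v (even_comp A x) = \<zero>\<^bsub>K\<^esub>" using v(5)[OF x(1)] by simp_all
  show ?thesis
    using assms(4) a lin(1)[OF assms(4)]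
    by (simp add: e_hom_def pairing_def e w R.comp_even[OF R.one_even] R.comp_odd[OF assms(3)]
        a_minus_def R.smult_l_minus)
qed

text \<open>Multiplicativity is the Leibniz rule for \<open>v\<close> together with \<open>a\<^sup>2 = 0\<close>.\<close>

lemma e_hom_H:
  assumes two: "\<one>\<^bsub>K\<^esub> \<oplus>\<^bsub>K\<^esub> \<one>\<^bsub>K\<^esub> \<noteq> \<zero>\<^bsub>K\<^esub>"
    and R: "superalgebra K R" and v: "v \<in> Lie_odd K A" and a: "a \<in> odd_part R"
  shows "e_hom A \<epsilon> R a v \<in> H R"
proof -
  interpret R: superalgebra K R by fact
  note vD = Lie_oddD[OF v]
  note lin = linear_functionalD[OF vD(2)]
  note e = e_hom_apply[OF R v a]
  have aR: "a \<in> carrier R" using a by (rule R.odd_in_carrier)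
  have aa: "a \<otimes>\<^bsub>R\<^esub> a = \<zero>\<^bsub>R\<^esub>" using R.odd_square_zero[OF two a] .
  have "e_hom A \<epsilon> R a v \<in> salg_hom K A R"
  proof (rule salg_homI)
    show "e_hom A \<epsilon> R a v x = undefined" if "x \<notin> carrier A" for x
      using that by (simp add: e_hom_def)
    fix x assume x: "x \<in> carrier A"
    show "e_hom A \<epsilon> R a v x \<in> carrier R" using x lin(1) aR by (simp add: e)
    show "e_hom A \<epsilon> R a v (k \<odot>\<^bsub>A\<^esub> x) = k \<odot>\<^bsub>R\<^esub> e_hom A \<epsilon> R a v x" if "k \<in> carrier K" for k
      using that x lin(1) aR
      by (simp add: e lin(3) R.smult_r_distr R.smult_assoc1 R.smult_l_minus R.smult_r_minus)
    fix y assume y: "y \<in> carrier A"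
    show "e_hom A \<epsilon> R a v (x \<oplus>\<^bsub>A\<^esub> y) = e_hom A \<epsilon> R a v x \<oplus>\<^bsub>R\<^esub> e_hom A \<epsilon> R a v y"
      using x y lin(1) aR
      by (simp add: e lin(2) R.smult_l_distr R.smult_l_minus R.A.minus_add R.A.add.m_ac)
    show "e_hom A \<epsilon> R a v (x \<otimes>\<^bsub>A\<^esub> y) = e_hom A \<epsilon> R a v x \<otimes>\<^bsub>R\<^esub> e_hom A \<epsilon> R a v y"
    proof -
      let ?p = "\<ominus>\<^bsub>K\<^esub> v x" and ?q = "\<ominus>\<^bsub>K\<^esub> v y"
      have c: "?p \<in> carrier K" "?q \<in> carrier K" "v x \<in> carrier K" "v y \<in> carrier K"
        "\<epsilon> x \<in> carrier K" "\<epsilon> y \<in> carrier K"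
        using lin(1) x y by auto
      have "e_hom A \<epsilon> R a v x \<otimes>\<^bsub>R\<^esub> e_hom A \<epsilon> R a v y =
          (\<epsilon> x \<odot>\<^bsub>R\<^esub> \<one>\<^bsub>R\<^esub> \<oplus>\<^bsub>R\<^esub> ?p \<odot>\<^bsub>R\<^esub> a) \<otimes>\<^bsub>R\<^esub> (\<epsilon> y \<odot>\<^bsub>R\<^esub> \<one>\<^bsub>R\<^esub> \<oplus>\<^bsub>R\<^esub> ?q \<odot>\<^bsub>R\<^esub> a)"
        using x y by (simp add: e)
      also have "\<dots> = (\<epsilon> x \<otimes>\<^bsub>K\<^esub> \<epsilon> y) \<odot>\<^bsub>R\<^esub> \<one>\<^bsub>R\<^esub> \<oplus>\<^bsub>R\<^esub> (\<epsilon> x \<otimes>\<^bsub>K\<^esub> ?q \<oplus>\<^bsub>K\<^esub> \<epsilon> y \<otimes>\<^bsub>K\<^esub> ?p) \<odot>\<^bsub>R\<^esub> a"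
        using c aR aa by (intro R.dual_number_mult)
      also have "\<epsilon> x \<otimes>\<^bsub>K\<^esub> ?q \<oplus>\<^bsub>K\<^esub> \<epsilon> y \<otimes>\<^bsub>K\<^esub> ?p = \<ominus>\<^bsub>K\<^esub> v (x \<otimes>\<^bsub>A\<^esub> y)"
        using c by (simp add: Lie_odd_mult[OF v x y] K.minus_add K.r_minus)
      finally show ?thesis using x y by (simp add: e)
    qed
  next
    show "e_hom A \<epsilon> R a v \<one>\<^bsub>A\<^esub> = \<one>\<^bsub>R\<^esub>" using aR vD(3) by (simp add: e)
    show "e_hom A \<epsilon> R a v x \<in> even_part R" if "x \<in> even_part A" for x
      using that even_in_carrier[OF that] aR by (simp add: e vD(5) R.even_closed R.one_even)
    show "e_hom A \<epsilon> R a v x \<in> odd_part R" if "x \<in> odd_part A" for x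
      using that odd_in_carrier[OF that] aR lin(1) a by (simp add: e R.odd_closed)
  qed
  moreover have "e_hom A \<epsilon> R a v y = \<zero>\<^bsub>R\<^esub>" if "y \<in> Mpow (Suc 1)" for y
    using Mpow_carrier[OF that] vD(4)[OF that] Mpow_le_M[OF _ that] aR by (simp add: e M_iff)
  ultimately show ?thesis unfolding H_iff[OF R] by blast
qed

lemma e_hom_natural:
  assumes "superalgebra K R" "superalgebra K S" "h \<in> salg_hom K R S" "v \<in> Lie_odd K A" "a \<in> odd_part R"
  shows "compose (carrier A) h (e_hom A \<epsilon> R a v) = e_hom A \<epsilon> S (h a) v"
proof -
  interpret R: superalgebra K R by fact
  note h = salg_homD[OF assms(3)]
  note lin = linear_functionalD[OF Lie_oddD(2)[OF assms(4)]]
  have "h (e_hom A \<epsilon> R a v x) = e_hom A \<epsilon> S (h a) v x" if "x \<in> carrier A" for x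
    using that lin(1)[OF that] R.odd_in_carrier[OF assms(5)]
    by (simp add: e_hom_apply[OF assms(1,4,5)] e_hom_apply[OF assms(2,4) h(8)[OF assms(5)]] h(3,5,6))
  then show ?thesis by (auto simp: compose_def e_hom_def fun_eq_iff)
qed

lemma e_hom_zero:
  assumes "superalgebra K R" "v \<in> Lie_odd K A"
  shows "e_hom A \<epsilon> R \<zero>\<^bsub>R\<^esub> v = unit R"
proof -
  interpret R: superalgebra K R by fact
  have "e_hom A \<epsilon> R \<zero>\<^bsub>R\<^esub> v x = unit R x" if "x \<in> carrier A" for x
    using e_hom_apply[OF assms R.odd_closed(1) that] linear_functionalD(1)[OF Lie_oddD(2)[OF assms(2)] that] that
    by (simp add: unit_def)
  then show ?thesis by (auto simp: e_hom_def unit_def fun_eq_iff)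
qed

text \<open>An arbitrary list of indices in place of \<open>1, ..., l\<close> makes list induction available.\<close>

definition E_prod :: "(nat \<Rightarrow> 'a \<Rightarrow> 'u) \<Rightarrow> ('u, 'u) superalg \<Rightarrow> (nat \<Rightarrow> 'u) \<Rightarrow> nat list \<Rightarrow> 'a \<Rightarrow> 'u" where
  "E_prod \<gamma> R a is = foldr (conv R) (map (\<lambda>i. e_hom A \<epsilon> R (a i) (\<gamma> i)) is) (unit R)"

lemma E_prod_simps [simp]:
  "E_prod \<gamma> R a [] = unit R"
  "E_prod \<gamma> R a (i # is) = conv R (e_hom A \<epsilon> R (a i) (\<gamma> i)) (E_prod \<gamma> R a is)"
  by (simp_all add: E_prod_def)

lemma E_prod_H:
  assumes "\<one>\<^bsub>K\<^esub> \<oplus>\<^bsub>K\<^esub> \<one>\<^bsub>K\<^esub> \<noteq> \<zero>\<^bsub>K\<^esub>" "superalgebra K R"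
    "\<And>i. i \<in> set is \<Longrightarrow> \<gamma> i \<in> Lie_odd K A" "\<And>i. i \<in> set is \<Longrightarrow> a i \<in> odd_part R"
  shows "E_prod \<gamma> R a is \<in> H R"
  using assms(3,4)
  by (induction "is") (auto intro!: unit(1) conv_closed(1) e_hom_H assms(1,2))

lemma unit_natural:
  assumes "superalgebra K R" "superalgebra K S" "h \<in> salg_hom K R S"
  shows "compose (carrier A) h (unit R) = unit S"
proof -
  interpret R: superalgebra K R by fact
  show ?thesis
    using salg_homD(5,6)[OF assms(3)] by (auto simp: compose_def unit_def fun_eq_iff)
qed

lemma E_prod_natural:
  assumes "\<one>\<^bsub>K\<^esub> \<oplus>\<^bsub>K\<^esub> \<one>\<^bsub>K\<^esub> \<noteq> \<zero>\<^bsub>K\<^esub>" "superalgebra K R" "superalgebra K S" "h \<in> salg_hom K R S"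
    "\<And>i. i \<in> set is \<Longrightarrow> \<gamma> i \<in> Lie_odd K A" "\<And>i. i \<in> set is \<Longrightarrow> a i \<in> odd_part R"
  shows "compose (carrier A) h (E_prod \<gamma> R a is) = E_prod \<gamma> S (\<lambda>i. h (a i)) is"
  using assms(5,6)
  by (induction "is")
     (simp_all add: unit_natural[OF assms(2-4)] conv_natural[OF assms(2-4)] e_hom_H[OF assms(1,2)]
        E_prod_H[OF assms(1,2)] e_hom_natural[OF assms(2-4)])

lemma E_prod_zero:
  assumes "superalgebra K R" "\<And>i. i \<in> set is \<Longrightarrow> \<gamma> i \<in> Lie_odd K A"
  shows "E_prod \<gamma> R (\<lambda>_. \<zero>\<^bsub>R\<^esub>) is = unit R"
  using assms(2) by (induction "is") (auto simp: e_hom_zero[OF assms(1)] conv_unit unit(1) assms(1))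

end

section \<open>Odd tangent maps and the subfunctor E\<close>

context augmented_with_socle
begin

lemma e_tangent:
  assumes v: "v \<in> Lie_odd K A" and j: "j \<in> J" "j \<in> odd_part R"
  shows "tangent (\<lambda>x. (\<ominus>\<^bsub>K\<^esub> v x) \<odot> j)"
proof -
  note vD = Lie_oddD[OF v]
  note lin = linear_functionalD[OF vD(2)]
  have "linear_map K A R J (\<lambda>x. (\<ominus>\<^bsub>K\<^esub> v x) \<odot> j)"
    unfolding linear_map_def using lin j(1)
    by (simp add: K.minus_add R.smult_l_distr R.smult_assoc1 flip: K.r_minus)
  then show ?thesis
    unfolding tangent_def using vD(3,5,6) lin(1) j odd_in_carrier
    by (simp add: R.even_closed R.odd_closed)
qed

lemma tangent_add:
  assumes "tangent d" "tangent d'"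
  shows "tangent (\<lambda>x. d x \<oplus> d' x)"
proof -
  note d = tangentD[OF assms(1)] and d' = tangentD[OF assms(2)]
  have "linear_map K A R J (\<lambda>x. d x \<oplus> d' x)"
    unfolding linear_map_def using d(1) d'(1)
    by (simp add: d(2,3) d'(2,3) R.smult_r_distr R.A.add.m_ac)
  then show ?thesis
    unfolding tangent_def by (simp add: d(4-7) d'(4-7) R.even_closed R.odd_closed)
qed

lemma tangent_zero: "tangent (\<lambda>x. \<zero>)"
  by (simp add: tangent_def linear_map_def R.even_closed R.odd_closed)

lemma tangent_minus:
  assumes "tangent d"
  shows "tangent (\<lambda>x. \<ominus> d x)"
proof -
  note d = tangentD[OF assms]
  have "linear_map K A R J (\<lambda>x. \<ominus> d x)"
    unfolding linear_map_def using d(1)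
    by (simp add: d(2,3) R.smult_r_minus R.A.minus_add)
  then show ?thesis
    unfolding tangent_def by (simp add: d(4-7) R.even_closed R.odd_closed)
qed

lemma e_hom_perturb:
  assumes v: "v \<in> Lie_odd K A" and a: "a \<in> odd_part R" and j: "j \<in> J" "j \<in> odd_part R"
  shows "e_hom A \<epsilon> R (a \<oplus> j) v = perturb (e_hom A \<epsilon> R a v) (\<lambda>x. (\<ominus>\<^bsub>K\<^esub> v x) \<odot> j)"
proof -
  note lin = linear_functionalD[OF Lie_oddD(2)[OF v]]
  have "e_hom A \<epsilon> R (a \<oplus> j) v x = e_hom A \<epsilon> R a v x \<oplus> (\<ominus>\<^bsub>K\<^esub> v x) \<odot> j"
    if x: "x \<in> carrier A" for x
    using x lin(1) R.odd_in_carrier[OF a] j(1)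
    by (simp add: e_hom_apply[OF superalgebra_R v a x] R.smult_r_distr R.A.a_assoc
        e_hom_apply[OF superalgebra_R v R.odd_closed(2)[OF a j(2)] x])
  then show ?thesis by (auto simp: perturb_def e_hom_def fun_eq_iff)
qed

text \<open>Shifting a parameter by an odd \<open>j\<close> in \<open>J\<close> multiplies its factor by a central point \<open>\<epsilon> + d\<close>, and the
  tangent maps of central points add up.\<close>

lemma E_prod_perturb:
  assumes two: "\<one>\<^bsub>K\<^esub> \<oplus>\<^bsub>K\<^esub> \<one>\<^bsub>K\<^esub> \<noteq> \<zero>\<^bsub>K\<^esub>"
    and "\<And>i. i \<in> set is \<Longrightarrow> \<gamma> i \<in> Lie_odd K A" "\<And>i. i \<in> set is \<Longrightarrow> a i \<in> odd_part R"
    and "\<And>i. i \<in> set is \<Longrightarrow> j i \<in> J \<inter> odd_part R"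
  defines "d \<equiv> (\<lambda>is x. foldr (\<lambda>i s. (\<ominus>\<^bsub>K\<^esub> \<gamma> i x) \<odot> j i \<oplus> s) is \<zero>)"
  shows "tangent (d is) \<and> E_prod \<gamma> R (\<lambda>i. a i \<oplus> j i) is = perturb (E_prod \<gamma> R a is) (d is)"
  using assms(2-4)
proof (induction "is")
  case Nil
  have "perturb (unit R) (\<lambda>x. \<zero>) = unit R"
    using salg_homD(1,2)[OF H_hom[OF unit(1)[OF superalgebra_R]]] by (auto simp: perturb_def fun_eq_iff)
  then show ?case using tangent_zero by (simp add: d_def)
next
  case (Cons i "is")
  let ?\<delta> = "\<lambda>x. (\<ominus>\<^bsub>K\<^esub> \<gamma> i x) \<odot> j i"
  have IH: "tangent (d is)" "E_prod \<gamma> R (\<lambda>i. a i \<oplus> j i) is = perturb (E_prod \<gamma> R a is) (d is)"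
    using Cons by simp_all
  have i: "\<gamma> i \<in> Lie_odd K A" "a i \<in> odd_part R" "j i \<in> J" "j i \<in> odd_part R" using Cons.prems by auto
  have d_Cons: "d (i # is) = (\<lambda>x. ?\<delta> x \<oplus> d is x)" by (simp add: d_def)
  have \<delta>: "tangent ?\<delta>" using e_tangent[OF i(1,3,4)] .
  have "E_prod \<gamma> R a is \<in> H R" using Cons.prems by (intro E_prod_H[OF two superalgebra_R]) auto
  then have "conv R (perturb (e_hom A \<epsilon> R (a i) (\<gamma> i)) ?\<delta>) (perturb (E_prod \<gamma> R a is) (d is)) =
      perturb (conv R (e_hom A \<epsilon> R (a i) (\<gamma> i)) (E_prod \<gamma> R a is)) (\<lambda>x. ?\<delta> x \<oplus> d is x)"
    using conv_perturb[OF e_hom_H[OF two superalgebra_R i(1,2)] _ \<delta> IH(1)] by simp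
  then show ?case
    using tangent_add[OF \<delta> IH(1)] IH(2) e_hom_perturb[OF i] by (simp add: d_Cons)
qed

text \<open>The common kernel of the \<open>\<gamma> i\<close> must kill \<open>d\<close>: otherwise composing \<open>d\<close> with a functional on \<open>R\<close> that is
  nonzero on the offending value would give an odd element of the Lie superalgebra outside their span.\<close>

lemma odd_tangent_expansion:
  assumes d: "tangent d" and d_even: "\<And>x. x \<in> even_part A \<Longrightarrow> d x = \<zero>"
    and \<gamma>: "\<And>i. i \<in> set is \<Longrightarrow> \<gamma> i \<in> Lie_odd K A" "distinct is"
    and separates: "\<forall>w\<in>Lie_odd K A. \<forall>x\<in>carrier A. (\<forall>i\<in>set is. \<gamma> i x = \<zero>\<^bsub>K\<^esub>) \<longrightarrow> w x = \<zero>\<^bsub>K\<^esub>"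
  shows "\<exists>j. (\<forall>i. j i \<in> J \<inter> odd_part R) \<and>
    (\<forall>x\<in>carrier A. d x = foldr (\<lambda>i s. (\<ominus>\<^bsub>K\<^esub> \<gamma> i x) \<odot> j i \<oplus> s) is \<zero>)"
proof (rule functional_expansion[OF K.field_axioms module_axioms R.module_axioms])
  note dD = tangentD[OF d]
  have d_odd: "d x \<in> odd_part R" if "x \<in> carrier A" for x
  proof -
    have "d x = d (even_comp A x) \<oplus> d (odd_comp A x)"
      using dD(2)[of "even_comp A x" "odd_comp A x"] decomposition(3)[OF that] that by simp
    then show ?thesis
      using dD(7) d_even decomposition[OF that] R.odd_in_carrier by simp
  qed
  show "submodule (J \<inter> odd_part R) K R"
    by (rule R.submoduleI) (use R.odd_closed in auto)
  show "linear_functional K A (\<lambda>x. \<ominus>\<^bsub>K\<^esub> \<gamma> i x)" if "i \<in> set is" for i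
    using linear_functionalD[OF Lie_oddD(2)[OF \<gamma>(1)[OF that]]]
    by (simp add: linear_functional_def K.minus_add K.r_minus)
  show "linear_map K A R (J \<inter> odd_part R) d"
    using dD(1,2,3) d_odd by (simp add: linear_map_def)
  fix x assume x: "x \<in> carrier A" and z: "\<forall>i\<in>set is. \<ominus>\<^bsub>K\<^esub> \<gamma> i x = \<zero>\<^bsub>K\<^esub>"
  have \<gamma>x: "\<forall>i\<in>set is. \<gamma> i x = \<zero>\<^bsub>K\<^esub>"
  proof
    fix i assume i: "i \<in> set is"
    have "\<gamma> i x \<in> carrier K" using linear_functionalD(1)[OF Lie_oddD(2)[OF \<gamma>(1)[OF i]] x] .
    then show "\<gamma> i x = \<zero>\<^bsub>K\<^esub>" using z i K.minus_minus K.minus_zero by metis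
  qed
  show "d x = \<zero>"
  proof (rule ccontr)
    assume "d x \<noteq> \<zero>"
    then obtain \<phi> where \<phi>: "linear_functional K R \<phi>" "\<phi> (d x) \<noteq> \<zero>\<^bsub>K\<^esub>"
      using separating_functional[OF K.field_axioms R.module_axioms, of "d x"] dD(1)[OF x] by auto
    note lin = linear_functionalD[OF \<phi>(1)]
    have \<phi>0: "\<phi> \<zero> = \<zero>\<^bsub>K\<^esub>" using lin(3)[of "\<zero>\<^bsub>K\<^esub>" "\<zero>"] lin(1) by simp
    define w where "w = (\<lambda>a\<in>carrier A. \<phi> (d a))"
    have w2: "\<forall>y\<in>Mpow (Suc 1). w y = \<zero>\<^bsub>K\<^esub>"
      using tangent_Mpow2[OF d] Mpow_carrier[of _ "Suc 1"] \<phi>0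
      by (simp add: w_def del: ideal_power.simps)
    have "linear_functional K A w"
      using dD(1) by (simp add: linear_functional_def w_def lin dD(2,3))
    moreover have "w \<in> extensional (carrier A)" by (simp add: w_def)
    ultimately have "w \<in> carrier (hyp K A)" using w2 unfolding hyp_iff by blast
    then have "w \<in> Lie_odd K A"
      using w2 \<phi>0 dD(4) d_even even_in_carrier
      unfolding Lie_odd_def Lie_def numeral_2_eq_2 One_nat_def by (simp add: w_def)
    then have "w x = \<zero>\<^bsub>K\<^esub>" using separates x \<gamma>x by blast
    then show False using \<phi>(2) x by (simp add: w_def)
  qed
qed (fact \<gamma>(2))

text \<open>The map \<open>d\<close> is \<open>x'\<close> on the odd part and zero on the even part. It kills \<open>\<MM>\<^sup>2\<close> because the odd part
  of a product of elements of \<open>\<MM>\<close> has one odd factor, with value in \<open>J\<close>, and one even factor in \<open>\<MM>\<close>.\<close>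

lemma even_times_unipotent:
  assumes "x' \<in> H R" "\<And>a. a \<in> odd_part A \<Longrightarrow> x' a \<in> J"
  obtains x d where "x \<in> H R" "\<And>a. a \<in> odd_part A \<Longrightarrow> x a = \<zero>"
    "tangent d" "\<And>a. a \<in> even_part A \<Longrightarrow> d a = \<zero>" "conv R x (perturb (unit R) d) = x'"
proof -
  note h = salg_homD[OF H_hom[OF assms(1)]]
  have h0: "x' \<zero>\<^bsub>A\<^esub> = \<zero>"
    using salg_hom_minus(1)[OF superalgebra_A superalgebra_R H_hom[OF assms(1)]] .
  define d where "d a = x' (odd_comp A a)" for a
  have dJ: "d a \<in> J" if "a \<in> carrier A" for a
    using assms(2) decomposition(2)[OF that] by (simp add: d_def)
  have "tangent d"
    unfolding tangent_def
  proof (intro conjI ballI)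
    show "linear_map K A R J d"
      using dJ by (simp add: linear_map_def) (simp add: d_def comp_add comp_smult h)
    show "d \<one>\<^bsub>A\<^esub> = \<zero>" by (simp add: d_def comp_even[OF one_even] h0)
    show "d (a \<otimes>\<^bsub>A\<^esub> b) = \<zero>" if "a \<in> \<MM> A" "b \<in> \<MM> A" for a b
    proof -
      have c: "a \<in> carrier A" "b \<in> carrier A" and e: "\<epsilon> a = \<zero>\<^bsub>K\<^esub>" "\<epsilon> b = \<zero>\<^bsub>K\<^esub>"
        using that by (auto simp: M_iff)
      have ee: "\<epsilon> (even_comp A a) = \<epsilon> a" if "a \<in> carrier A" for a
        using eps(2)[of "even_comp A a" "odd_comp A a"] eps(7) decomposition[OF that] that by simp
      have "d (a \<otimes>\<^bsub>A\<^esub> b) = x' (even_comp A a) \<otimes> d b \<oplus> d a \<otimes> x' (even_comp A b)"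
        using c by (simp add: d_def odd_comp_mult h)
      then show ?thesis
        using c dJ h(1) by (simp add: J_mult eta_H[OF assms(1)] ee e)
    qed
    show "d a \<in> even_part R" if "a \<in> even_part A" for a
      using that by (simp add: d_def comp_even h0 R.even_closed)
    show "d a \<in> odd_part R" if "a \<in> odd_part A" for a
      using that by (simp add: d_def comp_odd h)
  qed
  note d = this
  let ?x = "perturb x' (\<lambda>a. \<ominus> d a)"
  have x: "?x \<in> H R" using perturb_conv(1)[OF tangent_minus[OF d] assms(1)] .
  show thesis
  proof (rule that[OF x _ d])
    show "?x a = \<zero>" if "a \<in> odd_part A" for a
      using that odd_in_carrier[OF that] h(1) by (simp add: perturb_def d_def comp_odd R.A.r_neg)
    show "d a = \<zero>" if "a \<in> even_part A" for a
      using that by (simp add: d_def comp_even h0)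
    have "perturb ?x d = x'"
    proof (rule ext)
      fix a show "perturb ?x d a = x' a"
        using h(1,2) dJ by (cases "a \<in> carrier A") (simp_all add: perturb_def R.A.a_assoc R.A.l_neg)
    qed
    then show "conv R ?x (perturb (unit R) d) = x'"
      using perturb_conv(2)[OF d x] by simp
  qed
qed

end

section \<open>The socle of an augmented superalgebra\<close>

text \<open>The annihilator of the augmentation ideal inside that ideal. For a local superalgebra with nilpotent
  maximal ideal, other than its residue field, this is the socle; for the ground field it is zero.\<close>

definition socle :: "'k ring \<Rightarrow> ('k, 'b) superalg \<Rightarrow> ('b \<Rightarrow> 'k) \<Rightarrow> 'b set" where
  "socle K R \<eta> = {r \<in> carrier R. \<eta> r = \<zero>\<^bsub>K\<^esub> \<and>
     (\<forall>s\<in>carrier R. \<eta> s = \<zero>\<^bsub>K\<^esub> \<longrightarrow> r \<otimes>\<^bsub>R\<^esub> s = \<zero>\<^bsub>R\<^esub>)}"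

lemma socleD:
  assumes "r \<in> socle K R \<eta>"
  shows "r \<in> carrier R" "\<eta> r = \<zero>\<^bsub>K\<^esub>" "\<lbrakk>s \<in> carrier R; \<eta> s = \<zero>\<^bsub>K\<^esub>\<rbrakk> \<Longrightarrow> r \<otimes>\<^bsub>R\<^esub> s = \<zero>\<^bsub>R\<^esub>"
  using assms by (auto simp: socle_def)

context
  fixes K :: "'k ring" and R :: "('k, 'b) superalg" and \<eta>
  assumes R: "superalgebra K R" and eta: "\<eta> \<in> salg_hom K R (ground_superalg K)"
begin

interpretation R: superalgebra K R by (rule R)

lemma augmentation_comp:
  assumes "x \<in> carrier R"
  shows "\<eta> (even_comp R x) = \<eta> x" "\<eta> (odd_comp R x) = \<zero>\<^bsub>K\<^esub>"
  using salg_homD(3)[OF eta, of "even_comp R x" "odd_comp R x"] salg_homD(1,8)[OF eta]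
    R.decomposition[OF assms] assms by auto

text \<open>The augmentation ideal is graded, so it suffices to multiply by a homogeneous \<open>s\<close>; then the products of
  \<open>s\<close> with the two components of \<open>r\<close> have different parities, and both vanish when their sum does.\<close>

lemma socle_graded:
  assumes "r \<in> socle K R \<eta>"
  shows "even_comp R r \<in> socle K R \<eta>" "odd_comp R r \<in> socle K R \<eta>"
proof -
  note r = socleD[OF assms]
  note c = R.comp_closed[OF r(1)] and p = R.decomposition[OF r(1)]
  have hom: "even_comp R r \<otimes>\<^bsub>R\<^esub> s = \<zero>\<^bsub>R\<^esub> \<and> odd_comp R r \<otimes>\<^bsub>R\<^esub> s = \<zero>\<^bsub>R\<^esub>"
    if s: "s \<in> even_part R \<or> s \<in> odd_part R" "\<eta> s = \<zero>\<^bsub>K\<^esub>" for s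
  proof -
    have sc: "s \<in> carrier R" using s R.even_in_carrier R.odd_in_carrier by blast
    have sum: "even_comp R r \<otimes>\<^bsub>R\<^esub> s \<oplus>\<^bsub>R\<^esub> odd_comp R r \<otimes>\<^bsub>R\<^esub> s = \<zero>\<^bsub>R\<^esub>"
      using r(3)[OF sc s(2)] p(3) R.A.l_distr[OF c sc] by simp
    then have sum': "odd_comp R r \<otimes>\<^bsub>R\<^esub> s \<oplus>\<^bsub>R\<^esub> even_comp R r \<otimes>\<^bsub>R\<^esub> s = \<zero>\<^bsub>R\<^esub>"
      using c sc by (simp add: R.A.a_comm)
    show ?thesis
      using s(1)
    proof
      assume "s \<in> even_part R"
      then show ?thesis
        using R.decomposition_unique[OF R.even_even[OF p(1)] R.odd_even[OF p(2)] R.even_closed(1) R.odd_closed(1)]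
          sum by simp
    next
      assume "s \<in> odd_part R"
      then show ?thesis
        using R.decomposition_unique[OF R.odd_odd[OF p(2)] R.even_odd[OF p(1)] R.even_closed(1) R.odd_closed(1)]
          sum' by simp
    qed
  qed
  have all: "even_comp R r \<otimes>\<^bsub>R\<^esub> s = \<zero>\<^bsub>R\<^esub> \<and> odd_comp R r \<otimes>\<^bsub>R\<^esub> s = \<zero>\<^bsub>R\<^esub>"
    if s: "s \<in> carrier R" "\<eta> s = \<zero>\<^bsub>K\<^esub>" for s
  proof -
    note q = R.decomposition[OF s(1)] and qc = R.comp_closed[OF s(1)]
    have e: "\<eta> (even_comp R s) = \<zero>\<^bsub>K\<^esub>" "\<eta> (odd_comp R s) = \<zero>\<^bsub>K\<^esub>"
      using augmentation_comp[OF s(1)] s(2) by simp_all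
    show ?thesis
      using hom[OF disjI1[OF q(1)] e(1)] hom[OF disjI2[OF q(2)] e(2)]
        R.A.r_distr[OF qc c(1)] R.A.r_distr[OF qc c(2)] q(3) by simp
  qed
  show "even_comp R r \<in> socle K R \<eta>" "odd_comp R r \<in> socle K R \<eta>"
    using all augmentation_comp[OF r(1)] r(2) c by (auto simp: socle_def)
qed

lemma socle_superideal: "superideal (socle K R \<eta>) R"
proof -
  have G: "superalgebra K (ground_superalg K)" by (rule superalgebra_ground[OF R.K.field_axioms])
  note h = salg_homD[OF eta, simplified] and h0 = salg_hom_minus[OF R G eta, simplified]
  have neg: "\<eta> (\<ominus>\<^bsub>R\<^esub> x) = \<zero>\<^bsub>K\<^esub>" if "x \<in> carrier R" "\<eta> x = \<zero>\<^bsub>K\<^esub>" for x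
    using h(6)[of "\<ominus>\<^bsub>K\<^esub> \<one>\<^bsub>K\<^esub>" x] that by (simp add: R.minus_smult)
  have mult: "\<eta> (x \<otimes>\<^bsub>R\<^esub> s) = \<zero>\<^bsub>K\<^esub>" "\<eta> (s \<otimes>\<^bsub>R\<^esub> x) = \<zero>\<^bsub>K\<^esub>"
    if "x \<in> carrier R" "s \<in> carrier R" "\<eta> s = \<zero>\<^bsub>K\<^esub>" for x s
    using that h(1) by (simp_all add: h(4))
  have "ideal (socle K R \<eta>) R"
  proof (rule idealI)
    show "ring R" ..
    show "subgroup (socle K R \<eta>) (add_monoid R)"
    proof (rule R.A.add.subgroupI)
      show "socle K R \<eta> \<subseteq> carrier R" by (auto dest: socleD(1))
      have "\<zero>\<^bsub>R\<^esub> \<in> socle K R \<eta>" by (simp add: socle_def h0)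
      then show "socle K R \<eta> \<noteq> {}" by blast
      show "\<ominus>\<^bsub>R\<^esub> r \<in> socle K R \<eta>" if "r \<in> socle K R \<eta>" for r
        using socleD[OF that] by (simp add: socle_def neg R.A.l_minus)
      show "r \<oplus>\<^bsub>R\<^esub> r' \<in> socle K R \<eta>" if "r \<in> socle K R \<eta>" "r' \<in> socle K R \<eta>" for r r'
        using socleD[OF that(1)] socleD[OF that(2)] by (simp add: socle_def h(3) R.A.l_distr)
    qed
    fix r x assume r: "r \<in> socle K R \<eta>" and x: "x \<in> carrier R"
    show "x \<otimes>\<^bsub>R\<^esub> r \<in> socle K R \<eta>" "r \<otimes>\<^bsub>R\<^esub> x \<in> socle K R \<eta>"
      using socleD[OF r] x by (simp_all add: socle_def mult R.A.m_assoc)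
  qed
  then show ?thesis using socle_graded by (simp add: superideal_def)
qed

text \<open>Homogeneous elements commute up to sign, so the left annihilator is also the right annihilator.\<close>

lemma socle_annihilates:
  assumes "r \<in> socle K R \<eta>" "s \<in> carrier R" "\<eta> s = \<zero>\<^bsub>K\<^esub>"
  shows "r \<otimes>\<^bsub>R\<^esub> s = \<zero>\<^bsub>R\<^esub> \<and> s \<otimes>\<^bsub>R\<^esub> r = \<zero>\<^bsub>R\<^esub>"
proof
  show "r \<otimes>\<^bsub>R\<^esub> s = \<zero>\<^bsub>R\<^esub>" using socleD(3) assms .
  note r = R.decomposition[OF socleD(1)[OF assms(1)]] and s = R.decomposition[OF assms(2)]
  note rc = R.comp_closed[OF socleD(1)[OF assms(1)]] and sc = R.comp_closed[OF assms(2)]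
  have "\<eta> (odd_comp R s) = \<zero>\<^bsub>K\<^esub>" "\<eta> (even_comp R s) = \<zero>\<^bsub>K\<^esub>"
    using augmentation_comp[OF assms(2)] assms(3) by simp_all
  then have z: "odd_comp R r \<otimes>\<^bsub>R\<^esub> odd_comp R s = \<zero>\<^bsub>R\<^esub>" "odd_comp R r \<otimes>\<^bsub>R\<^esub> even_comp R s = \<zero>\<^bsub>R\<^esub>"
    "even_comp R r \<otimes>\<^bsub>R\<^esub> s = \<zero>\<^bsub>R\<^esub>"
    using socleD(3)[OF socle_graded(1)[OF assms(1)]] socleD(3)[OF socle_graded(2)[OF assms(1)]] assms sc
    by auto
  have "even_comp R s \<otimes>\<^bsub>R\<^esub> odd_comp R r = \<zero>\<^bsub>R\<^esub>"
    using R.even_central[OF s(1) rc(2)] z(2) by simp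
  moreover have "odd_comp R s \<otimes>\<^bsub>R\<^esub> odd_comp R r = \<zero>\<^bsub>R\<^esub>"
    using R.odd_anticomm[OF s(2) r(2)] z(1) by simp
  moreover have "s \<otimes>\<^bsub>R\<^esub> odd_comp R r =
      even_comp R s \<otimes>\<^bsub>R\<^esub> odd_comp R r \<oplus>\<^bsub>R\<^esub> odd_comp R s \<otimes>\<^bsub>R\<^esub> odd_comp R r"
    using R.A.l_distr[OF sc rc(2)] s(3) by simp
  ultimately have "s \<otimes>\<^bsub>R\<^esub> odd_comp R r = \<zero>\<^bsub>R\<^esub>" by simp
  moreover have "s \<otimes>\<^bsub>R\<^esub> even_comp R r = \<zero>\<^bsub>R\<^esub>"
    using R.even_central[OF r(1) assms(2)] z(3) by simp
  ultimately show "s \<otimes>\<^bsub>R\<^esub> r = \<zero>\<^bsub>R\<^esub>"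
    using R.A.r_distr[OF rc assms(2)] r(3) by simp
qed

end

section \<open>The factorization\<close>

context pro_represented_group
begin

text \<open>Induction on the order of nilpotency of the augmentation ideal \<open>g(\<MM>)\<close>, dividing by the socle \<open>J\<close> in each
  step. The induction starts at 1, where \<open>R = K\<close> and there is nothing odd; for \<open>n \<ge> 1\<close> the image of \<open>\<MM>\<^sup>n\<close>
  lies in the augmentation ideal, as membership in \<open>J\<close> requires. Surjectivity of \<open>g\<close> makes all elements of the
  augmentation ideal come from \<open>\<MM>\<close>.\<close>

lemma factorization_surjective:
  assumes two: "\<one>\<^bsub>K\<^esub> \<oplus>\<^bsub>K\<^esub> \<one>\<^bsub>K\<^esub> \<noteq> \<zero>\<^bsub>K\<^esub>"
    and \<gamma>: "\<And>i. i \<in> set is \<Longrightarrow> \<gamma> i \<in> Lie_odd K A" "distinct is"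
    and separates: "\<forall>w\<in>Lie_odd K A. \<forall>x\<in>carrier A. (\<forall>i\<in>set is. \<gamma> i x = \<zero>\<^bsub>K\<^esub>) \<longrightarrow> w x = \<zero>\<^bsub>K\<^esub>"
    and "n \<ge> 1"
    and "superalgebra K R" "\<eta> \<in> salg_hom K R G" "g \<in> H R" "g ` carrier A = carrier R"
      "\<forall>y\<in>Mpow n. g y = \<zero>\<^bsub>R\<^esub>"
  shows "\<exists>x\<in>H R. (\<forall>a\<in>odd_part A. x a = \<zero>\<^bsub>R\<^esub>) \<and>
    (\<exists>a. (\<forall>i. a i \<in> odd_part R) \<and> g = conv R x (E_prod \<gamma> R a is))"
  using assms(5-)
proof (induction n arbitrary: R \<eta> g rule: nat_induct_at_least)
  case base
  note R = base(1) and eta = base(2) and g = base(3) and surj = base(4) and van = base(5)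
  interpret R: superalgebra K R by (rule R)
  have \<eta>g: "\<eta> (g a) = \<epsilon> a" if "a \<in> carrier A" for a
    using augmentation_unique[OF H_compose[OF R superalgebra_G g eta]] compose_eq[OF that, of \<eta> g] by simp
  have odd: "r = \<zero>\<^bsub>R\<^esub>" if r: "r \<in> odd_part R" for r
  proof -
    obtain a where a: "a \<in> carrier A" "r = g a" using surj R.odd_in_carrier[OF r] by blast
    have "\<epsilon> a = \<zero>\<^bsub>K\<^esub>" using \<eta>g[OF a(1)] a(2) salg_homD(8)[OF eta r] by simp
    then show ?thesis using a van M_Mpow1 by (simp add: M_iff del: ideal_power.simps One_nat_def)
  qed
  have "g = conv R g (E_prod \<gamma> R (\<lambda>_. \<zero>\<^bsub>R\<^esub>) is)"
    using conv_unit(1)[OF R g] E_prod_zero[OF R \<gamma>(1)] by simp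
  moreover have "\<forall>a\<in>odd_part A. g a = \<zero>\<^bsub>R\<^esub>" using odd salg_homD(8)[OF H_hom[OF g]] by blast
  moreover have "\<forall>i::nat. \<zero>\<^bsub>R\<^esub> \<in> odd_part R" using R.odd_closed(1) by simp
  ultimately show ?case by (intro bexI[OF _ g] conjI exI[of _ "\<lambda>_. \<zero>\<^bsub>R\<^esub>"])
next
  case (Suc n)
  note R = Suc.prems(1) and eta = Suc.prems(2) and g = Suc.prems(3) and surj = Suc.prems(4)
    and van = Suc.prems(5)
  define J where "J = socle K R \<eta>"
  have J: "superideal J R" unfolding J_def by (rule socle_superideal[OF R eta])
  interpret augmented_with_socle K X A \<epsilon> \<theta> R \<eta> J
    by (intro augmented_with_socle.intro augmented_with_socle_axioms.intro pro_represented_group_axioms R eta J)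
       (use socleD(2) socle_annihilates[OF R eta] in \<open>auto simp: J_def\<close>)
  obtain T :: "('u, 'u) superalg" and q where T: "superalgebra K T" and q: "q \<in> salg_hom K R T"
    "q ` carrier R = carrier T" "q ` even_part R = even_part T" "q ` odd_part R = odd_part T"
    and q0: "\<forall>x\<in>carrier R. q x = \<zero>\<^bsub>T\<^esub> \<longleftrightarrow> x \<in> J"
    by (rule quotient_superalgebra[OF R J])
  have "\<exists>\<eta>'\<in>salg_hom K T G. \<forall>x\<in>carrier R. \<eta>' (q x) = \<eta> x"
    by (rule salg_hom_factor[OF R superalgebra_G T q eta_hom]) (use q0 eta_J in auto)
  then obtain \<eta>' where \<eta>': "\<eta>' \<in> salg_hom K T G" by blast
  let ?g = "compose (carrier A) q g"
  have gR: "g a \<in> carrier R" if "a \<in> carrier A" for a using salg_homD(1)[OF H_hom[OF g] that] .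
  have g_in_J: "g y \<in> J" if y: "y \<in> Mpow n" for y
    unfolding J_def socle_def
  proof (intro CollectI conjI ballI impI)
    have yM: "y \<in> \<MM> A" using Mpow_le_M[OF \<open>1 \<le> n\<close> y] .
    show "g y \<in> carrier R" using gR Mpow_carrier[OF y] .
    show "\<eta> (g y) = \<zero>\<^bsub>K\<^esub>" using eta_H[OF g] yM by (simp add: M_iff)
    fix s assume "s \<in> carrier R" "\<eta> s = \<zero>\<^bsub>K\<^esub>"
    then obtain m where m: "m \<in> carrier A" "s = g m" using surj by blast
    then have mM: "m \<in> \<MM> A" using eta_H[OF g] \<open>\<eta> s = \<zero>\<^bsub>K\<^esub>\<close> by (simp add: M_iff)
    have ym: "y \<otimes>\<^bsub>A\<^esub> m \<in> Mpow (Suc n)" using y mM by (auto intro: ideal_prod.prod)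
    show "g y \<otimes>\<^bsub>R\<^esub> s = \<zero>\<^bsub>R\<^esub>"
      using van ym salg_homD(4)[OF H_hom[OF g] Mpow_carrier[OF y] m(1)] m(2) by simp
  qed
  have "\<exists>x\<in>H T. (\<forall>a\<in>odd_part A. x a = \<zero>\<^bsub>T\<^esub>) \<and>
      (\<exists>a. (\<forall>i. a i \<in> odd_part T) \<and> ?g = conv T x (E_prod \<gamma> T a is))"
  proof (rule Suc.IH[OF T \<eta>' H_compose[OF R T g q(1)]])
    show "?g ` carrier A = carrier T"
    proof -
      have "?g ` carrier A = q ` (g ` carrier A)" by (auto simp: compose_def)
      then show ?thesis using surj q(2) by simp
    qed
    show "\<forall>y\<in>Mpow n. ?g y = \<zero>\<^bsub>T\<^esub>"
      using g_in_J q0 gR Mpow_carrier by (simp add: compose_def)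
  qed
  then obtain xT aT where xT: "xT \<in> H T" "\<forall>a\<in>odd_part A. xT a = \<zero>\<^bsub>T\<^esub>"
    and aT: "\<forall>i. aT i \<in> odd_part T" "?g = conv T xT (E_prod \<gamma> T aT is)" by blast
  have "\<forall>i. \<exists>r\<in>odd_part R. q r = aT i" using aT(1) q(4) by (metis imageE)
  then obtain a where a: "\<And>i. a i \<in> odd_part R" "\<And>i. q (a i) = aT i" by metis
  define E where "E = E_prod \<gamma> R a is"
  have E: "E \<in> H R" unfolding E_def by (rule E_prod_H[OF two R]) (use \<gamma> a in auto)
  have qE: "compose (carrier A) q E = E_prod \<gamma> T aT is"
    unfolding E_def using E_prod_natural[OF two R T q(1), of "is" \<gamma> a] \<gamma>(1) a by simp
  have ET: "E_prod \<gamma> T aT is \<in> H T" by (rule E_prod_H[OF two T]) (use \<gamma> aT in auto)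
  \<comment> \<open>The even factor over \<open>R/J\<close> need not lift; dividing \<open>g\<close> by the lifted \<open>E\<close> replaces lifting it.\<close>
  obtain E' where E': "E' \<in> H R" "conv R E E' = unit R" "conv R E' E = unit R"
    by (rule conv_inverse[OF R E])
  define x' where "x' = conv R g E'"
  have x': "x' \<in> H R" unfolding x'_def by (rule conv_closed(1)[OF R g E'(1)])
  have g_eq: "g = conv R x' E"
    using conv_assoc[OF R g E'(1) E] E'(3) conv_unit(1)[OF R g] by (simp add: x'_def)
  have "compose (carrier A) q x' = xT"
  proof -
    let ?E' = "compose (carrier A) q E'"
    have E'T: "?E' \<in> H T" by (rule H_compose[OF R T E'(1) q(1)])
    have "compose (carrier A) q x' = conv T (conv T xT (E_prod \<gamma> T aT is)) ?E'"
      unfolding x'_def by (simp add: conv_natural[OF R T q(1) g E'(1)] aT(2))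
    also have "\<dots> = conv T xT (conv T (compose (carrier A) q E) ?E')"
      by (simp add: conv_assoc[OF T xT(1) ET E'T] qE)
    also have "conv T (compose (carrier A) q E) ?E' = unit T"
      using conv_natural[OF R T q(1) E E'(1)] E'(2) unit_natural[OF R T q(1)] by simp
    finally show ?thesis using conv_unit(1)[OF T xT(1)] by simp
  qed
  then have x'J: "x' b \<in> J" if "b \<in> odd_part A" for b
    using xT(2) that q0 salg_homD(1)[OF H_hom[OF x']] odd_in_carrier[OF that]
    by (metis compose_eq)
  obtain x d where x: "x \<in> H R" "\<And>a. a \<in> odd_part A \<Longrightarrow> x a = \<zero>\<^bsub>R\<^esub>"
    and d: "tangent d" "\<And>a. a \<in> even_part A \<Longrightarrow> d a = \<zero>\<^bsub>R\<^esub>" and xd: "conv R x (perturb (unit R) d) = x'"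
    by (rule even_times_unipotent[OF x' x'J]) blast+
  obtain j where j: "\<And>i. j i \<in> J \<inter> odd_part R"
    "\<forall>x\<in>carrier A. d x = foldr (\<lambda>i s. (\<ominus>\<^bsub>K\<^esub> \<gamma> i x) \<odot>\<^bsub>R\<^esub> j i \<oplus>\<^bsub>R\<^esub> s) is \<zero>\<^bsub>R\<^esub>"
    using odd_tangent_expansion[OF d \<gamma> separates] by blast
  have "conv R (perturb (unit R) d) E = perturb E d" using perturb_conv(3)[OF d(1) E] .
  also have "\<dots> = E_prod \<gamma> R (\<lambda>i. a i \<oplus>\<^bsub>R\<^esub> j i) is"
  proof -
    have "E_prod \<gamma> R (\<lambda>i. a i \<oplus>\<^bsub>R\<^esub> j i) is =
        perturb E (\<lambda>x. foldr (\<lambda>i s. (\<ominus>\<^bsub>K\<^esub> \<gamma> i x) \<odot>\<^bsub>R\<^esub> j i \<oplus>\<^bsub>R\<^esub> s) is \<zero>\<^bsub>R\<^esub>)"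
      using E_prod_perturb[OF two, of "is" \<gamma> a j] \<gamma>(1) a(1) j(1) unfolding E_def by simp
    also have "\<dots> = perturb E d"
      unfolding perturb_def using j(2) by (intro restrict_ext) simp
    finally show ?thesis by simp
  qed
  finally have "g = conv R x (E_prod \<gamma> R (\<lambda>i. a i \<oplus>\<^bsub>R\<^esub> j i) is)"
    using g_eq xd conv_assoc[OF R x(1) perturb_unit[OF d(1)] E] by simp
  moreover have "\<forall>i. a i \<oplus>\<^bsub>R\<^esub> j i \<in> odd_part R" using a(1) j(1) R.odd_closed(2) by blast
  moreover have "\<forall>b\<in>odd_part A. x b = \<zero>\<^bsub>R\<^esub>" using x(2) by blast
  ultimately show ?case by (intro bexI[OF _ x(1)] conjI exI[of _ "\<lambda>i. a i \<oplus>\<^bsub>R\<^esub> j i"])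
qed

text \<open>Passing to the image of \<open>(g, \<epsilon>)\<close> in \<open>R \<times> K\<close> makes the morphism surjective onto an augmented
  superalgebra; the factorization there is pushed forward to \<open>R\<close> by the first projection. Taking the second
  coordinate along keeps the augmentation well defined even when \<open>R\<close> is zero.\<close>

lemma factorization:
  assumes two: "\<one>\<^bsub>K\<^esub> \<oplus>\<^bsub>K\<^esub> \<one>\<^bsub>K\<^esub> \<noteq> \<zero>\<^bsub>K\<^esub>"
    and \<gamma>: "\<And>i. i \<in> set is \<Longrightarrow> \<gamma> i \<in> Lie_odd K A" "distinct is"
    and separates: "\<forall>w\<in>Lie_odd K A. \<forall>x\<in>carrier A. (\<forall>i\<in>set is. \<gamma> i x = \<zero>\<^bsub>K\<^esub>) \<longrightarrow> w x = \<zero>\<^bsub>K\<^esub>"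
    and R: "superalgebra K R" and g: "g \<in> H R"
  shows "\<exists>x\<in>H R. (\<forall>a\<in>odd_part A. x a = \<zero>\<^bsub>R\<^esub>) \<and>
    (\<exists>a. (\<forall>i. a i \<in> odd_part R) \<and> g = conv R x (E_prod \<gamma> R a is))"
proof -
  interpret R: superalgebra K R by (rule R)
  interpret G: superalgebra K G by (rule superalgebra_G)
  define B where "B = (\<lambda>a. (g a, \<epsilon> a)) ` carrier A"
  note h = salg_homD[OF H_hom[OF g]]
  have BI: "(x, y) \<in> B" if "a \<in> carrier A" "x = g a" "y = \<epsilon> a" for a x y
    using that by (auto simp: B_def)
  have sub: "subproduct_closed K R G B"
  proof (rule subproduct_closed.intro[OF R superalgebra_G], unfold_locales)
    show "B \<subseteq> carrier R \<times> carrier G" using h(1) by (auto simp: B_def)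
    show "(\<one>\<^bsub>R\<^esub>, \<one>\<^bsub>G\<^esub>) \<in> B" by (rule BI[of "\<one>\<^bsub>A\<^esub>"]) (simp_all add: h)
    fix x y assume "(x, y) \<in> B"
    then obtain a where a: "a \<in> carrier A" "x = g a" "y = \<epsilon> a" by (auto simp: B_def)
    show "(k \<odot>\<^bsub>R\<^esub> x, k \<odot>\<^bsub>G\<^esub> y) \<in> B" if "k \<in> carrier K" for k
      by (rule BI[of "k \<odot>\<^bsub>A\<^esub> a"]) (use a that in \<open>simp_all add: h\<close>)
    show "(even_comp R x, even_comp G y) \<in> B"
      by (rule BI[of "even_comp A a"])
         (use a salg_hom_comp(1)[OF superalgebra_A R H_hom[OF g] a(1)]
           salg_hom_comp(1)[OF superalgebra_A superalgebra_G augmentation_hom a(1)] in simp_all)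
    fix x' y' assume "(x', y') \<in> B"
    then obtain b where b: "b \<in> carrier A" "x' = g b" "y' = \<epsilon> b" by (auto simp: B_def)
    show "(x \<oplus>\<^bsub>R\<^esub> x', y \<oplus>\<^bsub>G\<^esub> y') \<in> B" by (rule BI[of "a \<oplus>\<^bsub>A\<^esub> b"]) (use a b in \<open>simp_all add: h\<close>)
    show "(x \<otimes>\<^bsub>R\<^esub> x', y \<otimes>\<^bsub>G\<^esub> y') \<in> B" by (rule BI[of "a \<otimes>\<^bsub>A\<^esub> b"]) (use a b in \<open>simp_all add: h\<close>)
  qed
  interpret P: subproduct_closed K R G B by (rule sub)
  obtain T :: "('u, 'u) superalg" and q p1 p2 where T: "superalgebra K T"
    and q: "q \<in> salg_hom K (subproduct R G B) T" "q ` B = carrier T"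
    "q ` (B \<inter> even_part R \<times> even_part G) = even_part T"
    "q ` (B \<inter> odd_part R \<times> odd_part G) = odd_part T" "inj_on q B"
    and p1: "p1 \<in> salg_hom K T R" "\<forall>x y. (x, y) \<in> B \<longrightarrow> p1 (q (x, y)) = x"
    and p2: "p2 \<in> salg_hom K T G" "\<forall>x y. (x, y) \<in> B \<longrightarrow> p2 (q (x, y)) = y"
    by (rule subproduct_universe[OF sub])
  define f where "f = compose (carrier A) q (\<lambda>a\<in>carrier A. (g a, \<epsilon> a))"
  have f_hom: "f \<in> salg_hom K A T"
    unfolding f_def
    by (rule salg_hom_compose[OF superalgebra_A pair_hom[OF sub H_hom[OF g] augmentation_hom superalgebra_A] q(1)])
       (rule BI; simp)
  obtain m where m: "\<forall>y\<in>Mpow m. g y = \<zero>\<^bsub>R\<^esub>" using g by (auto simp: H_iff[OF R])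
  \<comment> \<open>The exponent is raised by one since \<open>\<epsilon>\<close> vanishes on \<open>\<MM>\<^sup>k\<close> only for \<open>k \<ge> 1\<close>.\<close>
  have van: "\<forall>y\<in>Mpow (Suc m). f y = \<zero>\<^bsub>T\<^esub>"
  proof
    fix y assume y: "y \<in> Mpow (Suc m)"
    have "y \<in> Mpow m" using y ideal_power_antimono[OF A.ring_axioms ideal_M, of m "Suc m"] by auto
    then have "g y = \<zero>\<^bsub>R\<^esub>" using m by blast
    moreover have "\<epsilon> y = \<zero>\<^bsub>K\<^esub>" using Mpow_le_M[OF _ y] by (simp add: M_iff)
    ultimately show "f y = \<zero>\<^bsub>T\<^esub>"
      using salg_hom_minus(1)[OF P.superalgebra_subproduct T q(1)] Mpow_carrier[OF y]
      by (simp add: f_def compose_def subproduct_def)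
  qed
  have f: "f \<in> H T" using f_hom van unfolding H_iff[OF T] by blast
  have surj: "f ` carrier A = carrier T"
  proof -
    have "f ` carrier A = q ` B" by (auto simp: f_def B_def compose_def)
    then show ?thesis using q(2) by simp
  qed
  have p1f: "compose (carrier A) p1 f = g"
    using p1(2) h(2) BI by (auto simp: f_def compose_def fun_eq_iff)
  have le: "1 \<le> Suc m" by simp
  obtain x a where x: "x \<in> H T" "\<forall>b\<in>odd_part A. x b = \<zero>\<^bsub>T\<^esub>"
    and a: "\<forall>i. a i \<in> odd_part T" "f = conv T x (E_prod \<gamma> T a is)"
    using factorization_surjective[OF two \<gamma> separates le T p2(1) f surj van] by blast
  have ET: "E_prod \<gamma> T a is \<in> H T" by (rule E_prod_H[OF two T]) (use \<gamma> a in auto)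
  have "g = conv R (compose (carrier A) p1 x) (E_prod \<gamma> R (\<lambda>i. p1 (a i)) is)"
    using conv_natural[OF T R p1(1) x(1) ET] E_prod_natural[OF two T R p1(1), of "is" \<gamma> a] \<gamma>(1) a p1f
    by simp
  moreover have "\<forall>b\<in>odd_part A. compose (carrier A) p1 x b = \<zero>\<^bsub>R\<^esub>"
    using x(2) salg_hom_minus(1)[OF T R p1(1)] odd_in_carrier by (simp add: compose_def)
  moreover have "\<forall>i. p1 (a i) \<in> odd_part R" using a(1) salg_homD(8)[OF p1(1)] by blast
  ultimately show ?thesis
    by (intro bexI[OF _ H_compose[OF T R x(1) p1(1)]] conjI exI[of _ "\<lambda>i. p1 (a i)"])
qed

end

text \<open>If \<open>1 + 1 = 0\<close> then the characteristic divides 2, and being neither 0 nor 2 it is 1, which is impossible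
  in a field.\<close>

lemma odd_characteristic_two_nonzero:
  assumes "field K" "ring_characteristic K = 0 \<or> odd (ring_characteristic K)"
  shows "\<one>\<^bsub>K\<^esub> \<oplus>\<^bsub>K\<^esub> \<one>\<^bsub>K\<^esub> \<noteq> \<zero>\<^bsub>K\<^esub>"
proof
  interpret K: field K by fact
  note order = group.pow_eq_id[OF K.a_group, of "\<one>\<^bsub>K\<^esub>", folded ring_characteristic_def, simplified]
  assume two: "\<one>\<^bsub>K\<^esub> \<oplus>\<^bsub>K\<^esub> \<one>\<^bsub>K\<^esub> = \<zero>\<^bsub>K\<^esub>"
  have "\<one>\<^bsub>K\<^esub> [^]\<^bsub>add_monoid K\<^esub> (2::nat) = \<zero>\<^bsub>K\<^esub>"
    using two by (simp add: numeral_2_eq_2 nat_pow_def)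
  then have "ring_characteristic K dvd 2" using order by simp
  moreover from this have "ring_characteristic K \<le> 2" by (rule dvd_imp_le) simp
  moreover have "ring_characteristic K \<noteq> 2" using assms(2) by auto
  ultimately have "ring_characteristic K = 1" by (cases "ring_characteristic K = 0") auto
  then show False using order[of 1] by (simp add: nat_pow_def)
qed

theorem lemma16p12:
  fixes K :: "'u::infinite ring"
    and X :: "('u, 'x) k_group_functor"
    and A :: "('u, 'a) superalg"
    and \<epsilon> :: "'a \<Rightarrow> 'u"
    and \<theta> :: "('u, 'u) superalg \<Rightarrow> 'x \<Rightarrow> 'a \<Rightarrow> 'u"
    and l :: nat
    and \<gamma> :: "nat \<Rightarrow> 'a \<Rightarrow> 'u"
  assumes "field K"
    and "ring_characteristic K = 0 \<or> odd (ring_characteristic K)"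
    and "group_functor K X"
    and "strictly_pro_represented K X A \<epsilon> \<theta>"
    and "is_basis K (hyp K A) (Lie_odd K A) l \<gamma>"
  shows "\<forall>R. superalgebra K R \<longrightarrow>
    carrier (points X R) = X_ev X A \<theta> R <#>\<^bsub>points X R\<^esub> E_sub X A \<epsilon> \<theta> l \<gamma> R"
proof (intro allI impI)
  fix R :: "('u, 'u) superalg" assume R: "superalgebra K R"
  interpret pro_represented_group K X A \<epsilon> \<theta>
    by (intro pro_represented_group.intro assms(3,4))
  interpret RR: group "points X R" by (rule group_points[OF R])
  let ?is = "[1..<Suc l]"
  have is_set: "set ?is = {1..l}" by auto
  note two = odd_characteristic_two_nonzero[OF assms(1,2)]
  have \<gamma>: "\<gamma> i \<in> Lie_odd K A" if "i \<in> set ?is" for i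
    using assms(5) that unfolding is_basis_def is_set by blast
  have separates: "\<forall>w\<in>Lie_odd K A. \<forall>x\<in>carrier A. (\<forall>i\<in>set ?is. \<gamma> i x = \<zero>\<^bsub>K\<^esub>) \<longrightarrow> w x = \<zero>\<^bsub>K\<^esub>"
    using basis_separates[OF assms(5)] Lie_oddD(1) unfolding is_set by blast
  have points_E: "foldr (\<otimes>\<^bsub>points X R\<^esub>) (map (\<lambda>i. e_point X A \<epsilon> \<theta> R (a i) (\<gamma> i)) is) \<one>\<^bsub>points X R\<^esub> =
      pt R (E_prod \<gamma> R a is)"
    if "\<forall>i\<in>set is. \<gamma> i \<in> Lie_odd K A \<and> a i \<in> odd_part R" for a "is"
    using that
  proof (induction "is")
    case Nil
    then show ?case by (simp add: unit(2)[OF R])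
  next
    case (Cons i "is")
    have E: "E_prod \<gamma> R a is \<in> H R" using Cons.prems by (intro E_prod_H[OF two R]) auto
    have e: "e_hom A \<epsilon> R (a i) (\<gamma> i) \<in> H R" using Cons.prems by (intro e_hom_H[OF two R]) auto
    have "e_point X A \<epsilon> \<theta> R (a i) (\<gamma> i) = pt R (e_hom A \<epsilon> R (a i) (\<gamma> i))"
      by (simp add: e_point_def pt_def)
    then show ?case using Cons conv_closed(2)[OF R e E] by simp
  qed
  show "carrier (points X R) = X_ev X A \<theta> R <#>\<^bsub>points X R\<^esub> E_sub X A \<epsilon> \<theta> l \<gamma> R"
  proof (intro equalityI subsetI)
    fix p assume p: "p \<in> carrier (points X R)"
    obtain x a where x: "x \<in> H R" "\<forall>b\<in>odd_part A. x b = \<zero>\<^bsub>R\<^esub>"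
      and a: "\<forall>i. a i \<in> odd_part R" "\<theta> R p = conv R x (E_prod \<gamma> R a ?is)"
      using factorization[OF two \<gamma> distinct_upt separates R pt(4)[OF R p]] by blast
    have E: "E_prod \<gamma> R a ?is \<in> H R" by (rule E_prod_H[OF two R]) (use \<gamma> a in auto)
    have "p = pt R x \<otimes>\<^bsub>points X R\<^esub> pt R (E_prod \<gamma> R a ?is)"
      using pt(3)[OF R p] conv_closed(2)[OF R x(1) E] a(2) by simp
    moreover have "pt R x \<in> X_ev X A \<theta> R"
      using pt(1,2)[OF R x(1)] x(2) by (simp add: X_ev_def)
    moreover have "pt R (E_prod \<gamma> R a ?is) \<in> E_sub X A \<epsilon> \<theta> l \<gamma> R"
      unfolding E_sub_def using a(1) \<gamma> by (intro CollectI exI[of _ a] conjI points_E[symmetric]) auto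
    ultimately show "p \<in> X_ev X A \<theta> R <#>\<^bsub>points X R\<^esub> E_sub X A \<epsilon> \<theta> l \<gamma> R"
      unfolding set_mult_def by blast
  next
    fix p assume "p \<in> X_ev X A \<theta> R <#>\<^bsub>points X R\<^esub> E_sub X A \<epsilon> \<theta> l \<gamma> R"
    then obtain x a where x: "x \<in> X_ev X A \<theta> R" and a: "\<forall>i\<in>{1..l}. a i \<in> odd_part R"
      and p: "p = x \<otimes>\<^bsub>points X R\<^esub>
        foldr (\<otimes>\<^bsub>points X R\<^esub>) (map (\<lambda>i. e_point X A \<epsilon> \<theta> R (a i) (\<gamma> i)) ?is) \<one>\<^bsub>points X R\<^esub>"
      unfolding set_mult_def E_sub_def by blast
    have ga: "\<forall>i\<in>set ?is. \<gamma> i \<in> Lie_odd K A \<and> a i \<in> odd_part R" using \<gamma> a unfolding is_set by blast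
    have "E_prod \<gamma> R a ?is \<in> H R" by (rule E_prod_H[OF two R]) (use ga in auto)
    then show "p \<in> carrier (points X R)"
      unfolding p points_E[OF ga] using pt(1)[OF R] x by (simp add: X_ev_def)
  qed
qed

end
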